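(* Suppose that the samples are independent, i.e. the snapshot matrices $C_{\cdot,\omega_1},C_{\cdot,\omega_2},\dots$ (as random functions on $E$) are independent. Let $F\subset E$ be a closed set whose boundary $\partial F$ is a rectifiable curve, let $P^*\in[0,\infty)$, and suppose $P_{\mathrm{sym}}(\lambda)>P^*$ for all $\lambda\in\partial F$. Let $\#(\Sigma,F)$ and $\#(\hat\Sigma,F)$ denote the numbers of elements of $\Sigma$ and of $\hat\Sigma$ in $F$, counted with algebraic multiplicity. Then, with $$R_{\partial F}=\sup_{\lambda\in\partial F}\ \inf_{\substack{Q\succ0\\ P_{\mathrm{sym}}(\lambda,Q)\ge P^*}}\ \operatorname*{ess\,sup}_{\omega\in\Omega}\left\|C_\lambda^{-1}C_{\lambda,\omega}-I\right\|_Q,$$ one has $R_{\partial F}<\infty$, and there exists a constant $C$ (not depending on $M$) such that for all $M\geq 1$ $$\mathbb P\bigl(\#(\Sigma,F)\ne\#(\hat\Sigma,F)\bigr)\le C\,M\exp\left\{-\frac{1}{1+P^*R_{\partial F}/3}\cdot\frac{P^*}{2}M\right\}.$$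
   Context: Sampling setting. $(\Omega,\theta,\mu)$ is a probability space with an ergodic, $\mu$-preserving map $\theta$; $\omega\sim\mu$ and $\omega_m=\theta^m(\omega)$; $\mathbb E,\mathbb P$ are taken with respect to $\mu$. Let $N\ge 1$ and $E\subseteq\mathbb C$. For every $\omega\in\Omega$ and $\lambda\in E$ there is a matrix $C_{\lambda,\omega}\in\mathbb C^{N\times N}$ (measurable in $\omega$); these matrices are uniformly bounded in $(\lambda,\omega)$ and are analytic functions of $\lambda$ on $E$. Put $C_\lambda=\mathbb E[C_{\lambda,\omega}]$, $\hat C_\lambda=\frac1M\sum_{m=1}^M C_{\lambda,\omega_m}$ (depending on the number $M$ of samples), $\tilde C_\lambda=\hat C_\lambda-C_\lambda$, $\Sigma=\{\lambda\in E:\ker C_\lambda\ne\{0\}\}$ and $\hat\Sigma=\{\lambda\in E:\ker\hat C_\lambda\ne\{0\}\}$. The algebraic multiplicity of $\lambda\in\Sigma$ is the rank of the Riesz projection $\frac{1}{2\pi i}\int_\Gamma C_z^{-1}\,dz$ for some small closed circle $\Gamma$ around $\lambda$; the algebraic multiplicity of $\lambda\in\hat\Sigma$ is defined in the same way with $\hat C_z$ in place of $C_z$. Standing assumption (central limit theorem). For every $\lambda\in E$ and every linear $h:\mathbb C^{N\times N}\to\mathbb C$, with $S_M(\omega,h)=\frac1M\sum_{m=1}^M h[C_{\lambda,\omega_m}]-h[C_\lambda]$: the limit $\sigma^2_{h,\lambda}=\lim_{M\to\infty}M\,\mathbb E[|S_M(\omega,h)|^2]$ exists and is finite, and the real and imaginary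 parts of $\sqrt M S_M(\cdot,h)$ jointly converge in distribution to a centred normal distribution on $\mathbb R^2$ whose covariance matrix has trace $\sigma^2_{h,\lambda}$. $Q\succ0$ means $Q$ is Hermitian positive definite. $\|\mathbf v\|_Q^2=\mathbf v^*Q\mathbf v$, and for a matrix $A$, $\|A\|_Q$ is the induced operator norm. For $\lambda\in E\setminus\Sigma$ and Hermitian $Q$ define $$\mathcal S_\lambda[Q]=\lim_{M\to\infty}M\,\mathbb E\bigl[(C_\lambda^{-1}\tilde C_\lambda)^*Q\,(C_\lambda^{-1}\tilde C_\lambda)\bigr],\qquad \mathcal S^*_\lambda[Q]=\lim_{M\to\infty}M\,\mathbb E\bigl[(C_\lambda^{-1}\tilde C_\lambda)\,Q\,(C_\lambda^{-1}\tilde C_\lambda)^*\bigr],$$ and $$P_{\mathrm{sym}}(\lambda)=\sup_{Q\succ0}P_{\mathrm{sym}}(\lambda,Q),\qquad P_{\mathrm{sym}}(\lambda,Q)=\min\left\{\inf_{\mathbf v\ne0}\frac{\mathbf v^*Q\mathbf v}{\mathbf v^*\mathcal S_\lambda[Q]\mathbf v},\ \inf_{\mathbf v\ne0}\frac{\mathbf v^*Q^{-1}\mathbf v}{\mathbf v^*\mathcal S^*_\lambda[Q^{-1}]\mathbf v}\right\},$$ with quotients with zero denominator equal to $+\infty$. For $\lambda\in\Sigma$ set $P_{\mathrm{sym}}(\lambda)=0$.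
   Formalization: F is also assumed bounded and E open; algebraic multiplicity is the trace of (1/2πi)∫C_z^{-1}C_z'dz, and the rank of (1/2πi)∫C_z^{-1}dz is used only for linear pencils K−λL, since the claim with that rank fails for C=z²−εξ. *)

theory Defs
  imports "HOL-Probability.Probability" "HOL-Complex_Analysis.Complex_Analysis"
begin

section \<open>Hermitian forms and induced norms\<close>

definition adj :: "complex^'n^'n \<Rightarrow> complex^'n^'n" where
  "adj A = (\<chi> i j. cnj (A $ j $ i))"

definition hform :: "complex^'n^'n \<Rightarrow> complex^'n \<Rightarrow> complex" where
  "hform Q v = (\<Sum>i\<in>UNIV. \<Sum>j\<in>UNIV. cnj (v $ i) * Q $ i $ j * v $ j)"

text \<open>All forms below are Hermitian, so that \<open>hform Q v\<close> is real and taking \<open>Re\<close> loses nothing.\<close>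

definition posdef :: "complex^'n^'n \<Rightarrow> bool" where
  "posdef Q \<longleftrightarrow> adj Q = Q \<and> (\<forall>v. v \<noteq> 0 \<longrightarrow> Re (hform Q v) > 0)"

definition qnorm :: "complex^'n^'n \<Rightarrow> complex^'n \<Rightarrow> real" where
  "qnorm Q v = sqrt (Re (hform Q v))"

definition qopnorm :: "complex^'n^'n \<Rightarrow> complex^'n^'n \<Rightarrow> real" where
  "qopnorm Q A = (SUP v\<in>{v. v \<noteq> 0}. qnorm Q (A *v v) / qnorm Q v)"


section \<open>Sampling\<close>

definition ergodic_map :: "'a measure \<Rightarrow> ('a \<Rightarrow> 'a) \<Rightarrow> bool" where
  "ergodic_map \<mu> \<theta> \<longleftrightarrow>
     \<theta> \<in> measurable \<mu> \<mu> \<and> distr \<mu> \<mu> \<theta> = \<mu> \<and>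
     (\<forall>A\<in>sets \<mu>. \<theta> -` A \<inter> space \<mu> = A \<longrightarrow> measure \<mu> A = 0 \<or> measure \<mu> A = 1)"

definition Cmean :: "'a measure \<Rightarrow> (complex \<Rightarrow> 'a \<Rightarrow> complex^'n^'n) \<Rightarrow> complex \<Rightarrow> complex^'n^'n" where
  "Cmean \<mu> C \<zeta> = (\<integral>\<omega>. C \<zeta> \<omega> \<partial>\<mu>)"

definition Chat :: "('a \<Rightarrow> 'a) \<Rightarrow> (complex \<Rightarrow> 'a \<Rightarrow> complex^'n^'n) \<Rightarrow> nat \<Rightarrow> 'a \<Rightarrow> complex
    \<Rightarrow> complex^'n^'n" where
  "Chat \<theta> C M \<omega> \<zeta> = (1 / real M) *\<^sub>R (\<Sum>m=1..M. C \<zeta> ((\<theta> ^^ m) \<omega>))"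

definition Ctilde :: "'a measure \<Rightarrow> ('a \<Rightarrow> 'a) \<Rightarrow> (complex \<Rightarrow> 'a \<Rightarrow> complex^'n^'n) \<Rightarrow> nat \<Rightarrow> 'a
    \<Rightarrow> complex \<Rightarrow> complex^'n^'n" where
  "Ctilde \<mu> \<theta> C M \<omega> \<zeta> = Chat \<theta> C M \<omega> \<zeta> - Cmean \<mu> C \<zeta>"

text \<open>Independence of the random functions \<open>C\<^sub>\<cdot>\<^sub>,\<^sub>\<omega>\<^sub>m\<close> on \<open>E\<close>, \<open>m \<ge> 1\<close>, with respect to the
  \<open>\<sigma>\<close>-algebra generated by the evaluations at the points of \<open>E\<close>.\<close>

definition independent_samples ::
    "'a measure \<Rightarrow> ('a \<Rightarrow> 'a) \<Rightarrow> complex set \<Rightarrow> (complex \<Rightarrow> 'a \<Rightarrow> complex^'n^'n) \<Rightarrow> bool" where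
  "independent_samples \<mu> \<theta> E C \<longleftrightarrow>
     prob_space.indep_vars \<mu> (\<lambda>_. Pi\<^sub>M E (\<lambda>_. borel))
       (\<lambda>m \<omega>. \<lambda>\<zeta>\<in>E. C \<zeta> ((\<theta> ^^ m) \<omega>)) {1::nat..}"


section \<open>The central limit assumption\<close>

definition clinear_functional :: "(complex^'n^'n \<Rightarrow> complex) \<Rightarrow> bool" where
  "clinear_functional h \<longleftrightarrow>
     (\<forall>A B. h (A + B) = h A + h B) \<and> (\<forall>c A. h (\<chi> i j. c * A $ i $ j) = c * h A)"

text \<open>Centred, possibly degenerate, normal laws on the plane (identified with the complex numbers)
  are the images of the standard normal law on the plane under real-linear maps.\<close>

definition centred_normal :: "complex measure \<Rightarrow> bool" where
  "centred_normal \<nu> \<longleftrightarrow>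
     (\<exists>a b::complex. \<nu> = distr (std_normal_distribution \<Otimes>\<^sub>M std_normal_distribution) borel
                              (\<lambda>(x, y). x *\<^sub>R a + y *\<^sub>R b))"

definition cov_trace :: "complex measure \<Rightarrow> real" where
  "cov_trace \<nu> = (\<integral>z. (Re z)\<^sup>2 \<partial>\<nu>) + (\<integral>z. (Im z)\<^sup>2 \<partial>\<nu>)"

definition converges_in_law :: "'a measure \<Rightarrow> (nat \<Rightarrow> 'a \<Rightarrow> complex) \<Rightarrow> complex measure \<Rightarrow> bool" where
  "converges_in_law \<mu> X \<nu> \<longleftrightarrow>
     (\<forall>f::complex \<Rightarrow> real. continuous_on UNIV f \<and> bounded (range f) \<longrightarrow>
        (\<lambda>M. \<integral>\<omega>. f (X M \<omega>) \<partial>\<mu>) \<longlonglongrightarrow> (\<integral>z. f z \<partial>\<nu>))"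

definition S_err :: "'a measure \<Rightarrow> ('a \<Rightarrow> 'a) \<Rightarrow> (complex \<Rightarrow> 'a \<Rightarrow> complex^'n^'n) \<Rightarrow> complex
    \<Rightarrow> (complex^'n^'n \<Rightarrow> complex) \<Rightarrow> nat \<Rightarrow> 'a \<Rightarrow> complex" where
  "S_err \<mu> \<theta> C \<zeta> h M \<omega> =
     (1 / of_nat M) * (\<Sum>m=1..M. h (C \<zeta> ((\<theta> ^^ m) \<omega>))) - h (Cmean \<mu> C \<zeta>)"

definition clt_assumption ::
    "'a measure \<Rightarrow> ('a \<Rightarrow> 'a) \<Rightarrow> complex set \<Rightarrow> (complex \<Rightarrow> 'a \<Rightarrow> complex^'n^'n) \<Rightarrow> bool" where
  "clt_assumption \<mu> \<theta> E C \<longleftrightarrow>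
     (\<forall>\<zeta>\<in>E. \<forall>h. clinear_functional h \<longrightarrow>
        (\<exists>\<sigma>2::real. \<exists>\<nu>.
           (\<lambda>M. real M * (\<integral>\<omega>. (cmod (S_err \<mu> \<theta> C \<zeta> h M \<omega>))\<^sup>2 \<partial>\<mu>)) \<longlonglongrightarrow> \<sigma>2 \<and>
           centred_normal \<nu> \<and> cov_trace \<nu> = \<sigma>2 \<and>
           converges_in_law \<mu> (\<lambda>M \<omega>. sqrt (real M) *\<^sub>R S_err \<mu> \<theta> C \<zeta> h M \<omega>) \<nu>))"


section \<open>Spectra and algebraic multiplicities\<close>

definition spec :: "complex set \<Rightarrow> (complex \<Rightarrow> complex^'n^'n) \<Rightarrow> complex set" where
  "spec E A = {\<zeta>\<in>E. \<exists>v. v \<noteq> 0 \<and> A \<zeta> *v v = 0}"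

text \<open>\<open>residue f \<zeta>\<close> is \<open>1/(2\<pi>i)\<close> times the integral of \<open>f\<close> along any sufficiently small circle
  around \<open>\<zeta>\<close>; here it is taken entrywise.\<close>

definition mresidue :: "(complex \<Rightarrow> complex^'n^'n) \<Rightarrow> complex \<Rightarrow> complex^'n^'n" where
  "mresidue f \<zeta> = (\<chi> i j. residue (\<lambda>z. f z $ i $ j) \<zeta>)"

definition mderiv :: "(complex \<Rightarrow> complex^'n^'n) \<Rightarrow> complex \<Rightarrow> complex^'n^'n" where
  "mderiv A z = (\<chi> i j. deriv (\<lambda>w. A w $ i $ j) z)"

text \<open>For a pencil \<open>A z = K - z L\<close>, the matrix \<open>mresidue (\<lambda>z. matrix_inv (A z)) \<zeta>\<close> is, up to sign, the
  Riesz projection if \<open>L = 1\<close>, and in general it has the same rank as the Riesz projection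
  \<open>1/(2\<pi>i) \<integral> (A z)\<^sup>-\<^sup>1 (A' z) dz\<close>.\<close>

definition riesz_rank :: "(complex \<Rightarrow> complex^'n^'n) \<Rightarrow> complex \<Rightarrow> nat" where
  "riesz_rank A \<zeta> = rank (mresidue (\<lambda>z. matrix_inv (A z)) \<zeta>)"

text \<open>If \<open>A\<close> depends nonlinearly on \<open>z\<close>, \<open>riesz_rank\<close> is not the multiplicity and is not stable under
  perturbations: for the \<open>1 \<times> 1\<close> matrix \<open>A z = z\<^sup>2\<close> it vanishes at \<open>0\<close>, but it is \<open>1\<close> at each of the
  two zeros of \<open>z\<^sup>2 - \<epsilon>\<close>. The multiplicity is then the trace of
  \<open>1/(2\<pi>i) \<integral> (A z)\<^sup>-\<^sup>1 (A' z) dz\<close> (Gohberg and Sigal); for pencils that matrix is a projection, and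
  its trace is its rank.\<close>

definition alg_mult :: "(complex \<Rightarrow> complex^'n^'n) \<Rightarrow> complex \<Rightarrow> nat" where
  "alg_mult A \<zeta> = (THE k. of_nat k = trace (mresidue (\<lambda>z. matrix_inv (A z) ** mderiv A z) \<zeta>))"

text \<open>The number of elements of \<open>S\<close> in \<open>F\<close>, each \<open>\<zeta>\<close> counted \<open>m \<zeta>\<close> times.\<close>

definition count_in :: "complex set \<Rightarrow> (complex \<Rightarrow> nat) \<Rightarrow> complex set \<Rightarrow> enat" where
  "count_in S m F = (if finite (S \<inter> F) then enat (\<Sum>\<zeta>\<in>S \<inter> F. m \<zeta>) else \<infinity>)"

text \<open>The matrices depend on \<open>\<zeta>\<close> as a linear pencil.\<close>

definition affine_family ::
    "'a measure \<Rightarrow> complex set \<Rightarrow> (complex \<Rightarrow> 'a \<Rightarrow> complex^'n^'n) \<Rightarrow> bool" where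
  "affine_family \<mu> E C \<longleftrightarrow>
     (\<exists>K L. \<forall>\<omega>\<in>space \<mu>. \<forall>\<zeta>\<in>E. C \<zeta> \<omega> = (\<chi> i j. K \<omega> $ i $ j - \<zeta> * L \<omega> $ i $ j))"


section \<open>The quantity \<open>P\<^sub>s\<^sub>y\<^sub>m\<close>\<close>

definition rel_err :: "'a measure \<Rightarrow> ('a \<Rightarrow> 'a) \<Rightarrow> (complex \<Rightarrow> 'a \<Rightarrow> complex^'n^'n) \<Rightarrow> complex
    \<Rightarrow> nat \<Rightarrow> 'a \<Rightarrow> complex^'n^'n" where
  "rel_err \<mu> \<theta> C \<zeta> M \<omega> = matrix_inv (Cmean \<mu> C \<zeta>) ** Ctilde \<mu> \<theta> C M \<omega> \<zeta>"

definition Sop :: "'a measure \<Rightarrow> ('a \<Rightarrow> 'a) \<Rightarrow> (complex \<Rightarrow> 'a \<Rightarrow> complex^'n^'n) \<Rightarrow> complex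
    \<Rightarrow> complex^'n^'n \<Rightarrow> complex^'n^'n" where
  "Sop \<mu> \<theta> C \<zeta> Q = lim (\<lambda>M. real M *\<^sub>R
     (\<integral>\<omega>. adj (rel_err \<mu> \<theta> C \<zeta> M \<omega>) ** Q ** rel_err \<mu> \<theta> C \<zeta> M \<omega> \<partial>\<mu>))"

definition Sop_star :: "'a measure \<Rightarrow> ('a \<Rightarrow> 'a) \<Rightarrow> (complex \<Rightarrow> 'a \<Rightarrow> complex^'n^'n) \<Rightarrow> complex
    \<Rightarrow> complex^'n^'n \<Rightarrow> complex^'n^'n" where
  "Sop_star \<mu> \<theta> C \<zeta> Q = lim (\<lambda>M. real M *\<^sub>R
     (\<integral>\<omega>. rel_err \<mu> \<theta> C \<zeta> M \<omega> ** Q ** adj (rel_err \<mu> \<theta> C \<zeta> M \<omega>) \<partial>\<mu>))"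

definition quot :: "real \<Rightarrow> real \<Rightarrow> ereal" where
  "quot a b = (if b = 0 then \<infinity> else ereal (a / b))"

definition Psym_Q :: "'a measure \<Rightarrow> ('a \<Rightarrow> 'a) \<Rightarrow> (complex \<Rightarrow> 'a \<Rightarrow> complex^'n^'n) \<Rightarrow> complex
    \<Rightarrow> complex^'n^'n \<Rightarrow> ereal" where
  "Psym_Q \<mu> \<theta> C \<zeta> Q = min
     (INF v\<in>{v. v \<noteq> 0}. quot (Re (hform Q v)) (Re (hform (Sop \<mu> \<theta> C \<zeta> Q) v)))
     (INF v\<in>{v. v \<noteq> 0}. quot (Re (hform (matrix_inv Q) v))
                                (Re (hform (Sop_star \<mu> \<theta> C \<zeta> (matrix_inv Q)) v)))"

definition Psym :: "'a measure \<Rightarrow> ('a \<Rightarrow> 'a) \<Rightarrow> complex set \<Rightarrow> (complex \<Rightarrow> 'a \<Rightarrow> complex^'n^'n)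
    \<Rightarrow> complex \<Rightarrow> ereal" where
  "Psym \<mu> \<theta> E C \<zeta> =
     (if \<zeta> \<in> spec E (Cmean \<mu> C) then 0 else (SUP Q\<in>{Q. posdef Q}. Psym_Q \<mu> \<theta> C \<zeta> Q))"

definition R_bd :: "'a measure \<Rightarrow> ('a \<Rightarrow> 'a) \<Rightarrow> (complex \<Rightarrow> 'a \<Rightarrow> complex^'n^'n) \<Rightarrow> real
    \<Rightarrow> complex set \<Rightarrow> ereal" where
  "R_bd \<mu> \<theta> C P B =
     (SUP \<zeta>\<in>B. INF Q\<in>{Q. posdef Q \<and> Psym_Q \<mu> \<theta> C \<zeta> Q \<ge> ereal P}.
        esssup \<mu> (\<lambda>\<omega>. ereal (qopnorm Q (matrix_inv (Cmean \<mu> C \<zeta>) ** C \<zeta> \<omega> - mat 1))))"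


section \<open>Rectifiable curves\<close>

definition rectifiable_path :: "(real \<Rightarrow> complex) \<Rightarrow> bool" where
  "rectifiable_path g \<longleftrightarrow> path g \<and>
     (\<exists>L. \<forall>n. \<forall>t::nat \<Rightarrow> real. mono_on {..n} t \<and> t ` {..n} \<subseteq> {0..1} \<longrightarrow>
        (\<Sum>i<n. dist (g (t (Suc i))) (g (t i))) \<le> L)"

end

theory Submission
  imports Defs
begin

unbundle no fps_syntax

text \<open>The count of \<open>\<zeta>\<close> is the order of the zero of the determinant at \<open>\<zeta>\<close>, so by the homotopy
  invariance of the number of zeros (Rouche) the counts for the mean \<open>A\<close> and the empirical mean
  \<open>A + T\<close> agree unless some \<open>A w + s T w\<close> with \<open>w\<close> on the boundary and \<open>0 \<le> s \<le> 1\<close> is singular. A unit kernel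
  vector \<open>v\<close> then satisfies \<open>- Re \<langle>v, A\<^sup>-\<^sup>1 T v\<rangle> \<ge> \<langle>v, v\<rangle>\<close> in every form \<open>Q\<close>, and for fixed \<open>w\<close>, \<open>v\<close>
  this is a large deviation of a sum of bounded independent real variables, whose variance is
  bounded by means of \<open>P\<^sub>s\<^sub>y\<^sub>m\<close> and whose size by means of \<open>R\<close>. Bernstein's exponent is exactly the one
  claimed, and it is not attained: the strict improvement absorbs the passage from \<open>1\<close> to \<open>1 - \<eta>\<close>
  and from \<open>R\<close> to a slightly larger bound. Hence a finite cover of the compact set of pairs \<open>(w, v)\<close>,
  independent of the number of samples, reduces everything to scalar variables.\<close>

section \<open>Zeros in a compact set\<close>

text \<open>A form \<open>Q\<close> that is good at one boundary point may depend on the point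
  without any continuity, and the infimum inside \<open>R\<close> need not be attained. So a form is
  chosen for each pair separately and then frozen on a neighbourhood. What varies with the point is
  controlled by sure, not merely probable, Lipschitz bounds: Cauchy's inequality derives them from
  the uniform bound on the samples, and the mean and every empirical mean inherit them. Hence the
  neighbourhoods need not shrink as the number of samples grows. Independence acts twice: it makes
  the rescaled second moments of the relative error constant in the number of samples, so that
  \<open>Sop\<close> and \<open>Sop_star\<close> are second moments of one sample, and it factorises
  the exponential moment. That \<open>R\<close> is finite comes from the strict inequality for
  \<open>Psym\<close>: a form that beats \<open>P\<close> strictly at a point still reaches
  \<open>P\<close> nearby. The failure event is a union over uncountably many parameters with no
  evident measurability, so it is enclosed in a finite union of measurable events, whence the outer
  measure.\<close>

definition zero_count :: "(complex \<Rightarrow> complex) \<Rightarrow> complex set \<Rightarrow> int" where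
  "zero_count f F = (\<Sum>z\<in>{z\<in>F. f z = 0}. zorder f z)"

text \<open>An accumulation point of zeros is itself a zero, hence interior to \<open>F\<close>, and
  the identity theorem makes \<open>f\<close> vanish on its component of the interior. That
  component is bounded, so it has a frontier point; this point lies in the frontier of
  \<open>F\<close>, and by continuity \<open>f\<close> vanishes there as well. Working in one
  component is what allows \<open>E\<close> and \<open>F\<close> to be disconnected.\<close>

lemma finite_zeros_compact:
  assumes "F \<subseteq> E" "compact F" "f holomorphic_on E" "\<And>z. z \<in> frontier F \<Longrightarrow> f z \<noteq> 0"
  shows "finite {z\<in>F. f z = 0}"
proof (rule ccontr)
  let ?Z = "{z\<in>F. f z = 0}"
  assume "infinite ?Z"
  then obtain x where x: "x \<in> F" "x islimpt ?Z"
    using Heine_Borel_imp_Bolzano_Weierstrass[OF \<open>compact F\<close>, of ?Z] by auto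
  have cont: "continuous_on F f"
    by (rule holomorphic_on_imp_continuous_on[OF holomorphic_on_subset[OF assms(3,1)]])
  have "closed ?Z"
    using continuous_closed_preimage_constant[OF cont compact_imp_closed[OF \<open>compact F\<close>], of 0]
    by simp
  then have "f x = 0" using x(2) unfolding closed_limpt by blast
  then have xi: "x \<in> interior F"
    using assms(4) x(1) closure_subset[of F] unfolding frontier_def by blast
  define U where "U = connected_component_set (interior F) x"
  have U: "open U" "connected U" "x \<in> U" "U \<subseteq> interior F"
    unfolding U_def using xi by (auto simp: open_connected_component connected_component_subset)
  have UF: "U \<subseteq> F" using U(4) interior_subset by blast
  have lim: "x islimpt ?Z \<inter> U"
    using islimpt_Int_eventually[OF x(2) eventually_at_in_open'[OF U(1,3)]] by simp
  have zU: "f z = 0" if "z \<in> U" for z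
  proof (rule analytic_continuation[of f U "?Z \<inter> U" x])
    show "f holomorphic_on U" by (rule holomorphic_on_subset[OF assms(3) subset_trans[OF UF assms(1)]])
  qed (use U lim that in auto)
  have "bounded U" by (rule bounded_subset[OF compact_imp_bounded[OF \<open>compact F\<close>] UF])
  then have "U \<noteq> UNIV" using not_bounded_UNIV by auto
  then obtain w where w: "w \<in> frontier U" using U(3) frontier_eq_empty[of U] by blast
  have "frontier U \<subseteq> frontier F"
    unfolding U_def
    by (rule subset_trans[OF frontier_of_connected_component_subset frontier_interior_subset])
  then have "f w \<noteq> 0" using w assms(4) by blast
  moreover have "f w = 0"
  proof -
    have cl: "closure U \<subseteq> F" using UF \<open>compact F\<close> by (simp add: closure_minimal compact_imp_closed)
    have "w \<in> closure U" using w frontier_def by auto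
    then show ?thesis
      using continuous_constant_on_closure[OF continuous_on_subset[OF cont cl], of 0 w] zU by simp
  qed
  ultimately show False by simp
qed

lemma zero_in_interior:
  assumes "\<And>z. z \<in> frontier F \<Longrightarrow> f z \<noteq> 0" "z \<in> F" "f z = 0"
  shows "z \<in> interior F"
  using assms closure_subset[of F] unfolding frontier_def by blast

lemma eventually_nonzero_at:
  assumes "F \<subseteq> E" "compact F" "f holomorphic_on E" "\<And>z. z \<in> frontier F \<Longrightarrow> f z \<noteq> 0"
    and "z \<in> F" "f z = 0"
  shows "\<forall>\<^sub>F w in at z. f w \<noteq> 0"
proof -
  let ?Z = "{z\<in>F. f z = 0}"
  have "finite ?Z" by (rule finite_zeros_compact[OF assms(1-4)])
  then have "open (interior F - (?Z - {z}))"
    by (simp add: finite_imp_closed open_Diff)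
  moreover have "z \<in> interior F - (?Z - {z})" using zero_in_interior[of F f z] assms by blast
  ultimately have "\<forall>\<^sub>F w in at z. w \<in> interior F - (?Z - {z}) - {z}"
    by (rule eventually_at_in_open)
  then show ?thesis
    by eventually_elim (use interior_subset in auto)
qed

text \<open>Rouche's theorem on small circles around the zeros of \<open>h s0\<close>. Outside the
  discs, \<open>h s0\<close> is bounded away from zero by compactness, and uniform continuity keeps
  \<open>h s\<close> closer to \<open>h s0\<close> than this bound. The same estimate therefore
  excludes new zeros outside the discs and supplies Rouche's hypothesis on each circle.\<close>

lemma zero_count_locally_constant:
  fixes h :: "real \<Rightarrow> complex \<Rightarrow> complex"
  assumes F: "F \<subseteq> E" "compact F"
    and hol: "\<And>s. s \<in> {0..1} \<Longrightarrow> h s holomorphic_on E"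
    and cont: "continuous_on ({0..1} \<times> F) (\<lambda>(s, z). h s z)"
    and nz: "\<And>s z. s \<in> {0..1} \<Longrightarrow> z \<in> frontier F \<Longrightarrow> h s z \<noteq> 0"
    and s0: "s0 \<in> {0..1}"
  shows "\<exists>d>0. \<forall>s\<in>{0..1}. \<bar>s - s0\<bar> < d \<longrightarrow> zero_count (h s) F = zero_count (h s0) F"
proof -
  define Z where "Z s = {z\<in>F. h s z = 0}" for s
  have finZ: "finite (Z s)" if "s \<in> {0..1}" for s
    unfolding Z_def using finite_zeros_compact[OF F hol[OF that] nz[OF that]] .
  have Zint: "Z s \<subseteq> interior F" if "s \<in> {0..1}" for s
    unfolding Z_def using zero_in_interior nz[OF that] by blast
  have "\<exists>r>0. \<forall>z\<in>Z s0. cball z r \<subseteq> interior F \<and> (\<forall>w\<in>Z s0. w \<noteq> z \<longrightarrow> 2 * r < dist z w)"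
  proof -
    have "\<exists>r>0. cball z r \<subseteq> interior F \<and> (\<forall>w\<in>Z s0. w \<noteq> z \<longrightarrow> 2 * r < dist z w)" if "z \<in> Z s0" for z
    proof -
      have "open (interior F - (Z s0 - {z}))" "z \<in> interior F - (Z s0 - {z})"
        using finZ[OF s0] Zint[OF s0] that by (auto simp: finite_imp_closed open_Diff)
      then obtain r where r: "r > 0" "cball z r \<subseteq> interior F - (Z s0 - {z})"
        using open_contains_cball by blast
      have "cball z (r/2) \<subseteq> cball z r" using r by auto
      moreover have "2 * (r/2) < dist z w" if "w \<in> Z s0" "w \<noteq> z" for w
        using r that by (auto simp: subset_iff) (meson linorder_not_le)
      ultimately show ?thesis using r by (intro exI[of _ "r/2"]) auto
    qed
    then obtain r where r: "\<And>z. z \<in> Z s0 \<Longrightarrow> r z > 0 \<and> cball z (r z) \<subseteq> interior F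
        \<and> (\<forall>w\<in>Z s0. w \<noteq> z \<longrightarrow> 2 * r z < dist z w)" by metis
    define r0 where "r0 = Min (insert 1 (r ` Z s0))"
    have le: "r0 \<le> r z" if "z \<in> Z s0" for z unfolding r0_def using finZ[OF s0] that by auto
    have "r0 > 0" unfolding r0_def using finZ[OF s0] r by auto
    moreover have "cball z r0 \<subseteq> interior F \<and> (\<forall>w\<in>Z s0. w \<noteq> z \<longrightarrow> 2 * r0 < dist z w)" if "z \<in> Z s0" for z
      using r[OF that] le[OF that] by (smt (verit, best) mem_cball subset_eq)
    ultimately show ?thesis by blast
  qed
  then obtain r where r: "r > 0" and rint: "\<And>z. z \<in> Z s0 \<Longrightarrow> cball z r \<subseteq> interior F"
    and rsep: "\<And>z w. z \<in> Z s0 \<Longrightarrow> w \<in> Z s0 \<Longrightarrow> w \<noteq> z \<Longrightarrow> 2 * r < dist z w" by blast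
  \<comment> \<open>Distinct zeros are more than \<open>2 * r\<close> apart, so a circle of radius
    \<open>r / 2\<close> about one of them misses the discs of radius \<open>r / 2\<close> about the
    others and lies in \<open>K\<close>.\<close>
  define q where "q = r / 2"
  have q: "0 < q" "q < r" using r by (auto simp: q_def)
  define K where "K = F - (\<Union>z\<in>Z s0. ball z q)"
  have K: "compact K" unfolding K_def using F(2) by (intro compact_diff) auto
  have contF: "continuous_on F (h s)" if "s \<in> {0..1}" for s
    by (rule holomorphic_on_imp_continuous_on[OF holomorphic_on_subset[OF hol[OF that] F(1)]])
  have nzK: "h s0 z \<noteq> 0" if "z \<in> K" for z using that q unfolding K_def Z_def by auto
  obtain c where c: "c > 0" "\<And>z. z \<in> K \<Longrightarrow> c \<le> cmod (h s0 z)"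
  proof (cases "K = {}")
    case True then show ?thesis using that[of 1] by auto
  next
    case False
    have "continuous_on K (\<lambda>z. cmod (h s0 z))"
      using contF[OF s0] by (intro continuous_on_norm) (auto simp: K_def intro: continuous_on_subset)
    then obtain w where "w \<in> K" "\<And>z. z \<in> K \<Longrightarrow> cmod (h s0 w) \<le> cmod (h s0 z)"
      using continuous_attains_inf[OF K False] by blast
    then show ?thesis using that[of "cmod (h s0 w)"] nzK by auto
  qed
  have "uniformly_continuous_on ({0..1} \<times> F) (\<lambda>(s, z). h s z)"
    using cont F(2) by (intro compact_uniformly_continuous compact_Times) auto
  then obtain d where d: "d > 0"
    and dd: "\<And>x x'. x \<in> {0..1} \<times> F \<Longrightarrow> x' \<in> {0..1} \<times> F \<Longrightarrow> dist x' x < d \<Longrightarrow>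
       dist ((\<lambda>(s, z). h s z) x') ((\<lambda>(s, z). h s z) x) < c"
    unfolding uniformly_continuous_on_def using c(1) by metis
  have "zero_count (h s) F = zero_count (h s0) F" if s: "s \<in> {0..1}" and sd: "\<bar>s - s0\<bar> < d" for s
  proof -
    have close: "cmod (h s z - h s0 z) < c" if "z \<in> F" for z
      using dd[of "(s0, z)" "(s, z)"] s s0 that sd by (auto simp: dist_Pair_Pair dist_real_def dist_norm)
    have Zs: "Z s \<subseteq> (\<Union>z\<in>Z s0. ball z q)"
    proof
      fix z assume z: "z \<in> Z s"
      show "z \<in> (\<Union>z\<in>Z s0. ball z q)"
      proof (rule ccontr)
        assume "z \<notin> (\<Union>z\<in>Z s0. ball z q)"
        then have "c \<le> cmod (h s0 z)" "cmod (h s0 z) < c" "z \<in> K"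
          using c(2)[of z] close[of z] z by (auto simp: K_def Z_def)
        then show False by simp
      qed
    qed
    have loc: "(\<Sum>p\<in>Z s \<inter> ball z q. zorder (h s) p) = zorder (h s0) z" if z: "z \<in> Z s0" for z
    proof -
      let ?\<gamma> = "circlepath z q"
      let ?g = "\<lambda>p. h s p - h s0 p"
      have bF: "ball z r \<subseteq> F" using rint[OF z] interior_subset ball_subset_cball by blast
      have bE: "ball z r \<subseteq> E" using bF F(1) by blast
      have holb: "h t holomorphic_on ball z r" if "t \<in> {0..1}" for t
        by (rule holomorphic_on_subset[OF hol[OF that] bE])
      have zb: "{p \<in> ball z r. h s0 p = 0} = {z}"
      proof -
        have "p = z" if "p \<in> ball z r" "h s0 p = 0" for p
        proof -
          have "p \<in> Z s0" using that bF by (auto simp: Z_def)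
          then show "p = z" using rsep[OF z, of p] that(1) r by fastforce
        qed
        then show ?thesis using z r by (auto simp: Z_def)
      qed
      have subs: "{p \<in> ball z r. h s p = 0} \<subseteq> Z s" using bF by (auto simp: Z_def)
      then have fin: "finite {p \<in> ball z r. h s p = 0}" using finZ[OF s] finite_subset by blast
      have circK: "p \<in> K" if "p \<in> sphere z q" for p
      proof -
        have "p \<in> F" using that bF q by auto
        moreover have "p \<notin> ball w q" if "w \<in> Z s0" for w
        proof (cases "w = z")
          case True then show ?thesis using \<open>p \<in> sphere z q\<close> by auto
        next
          case False
          then have "2 * r < dist z w" using rsep[OF z that] by simp
          also have "dist z w \<le> dist z p + dist w p" by (metis dist_commute dist_triangle)
          finally show ?thesis using \<open>p \<in> sphere z q\<close> q by auto
        qed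
        ultimately show ?thesis by (auto simp: K_def)
      qed
      have *: "(\<lambda>p. h s0 p + (h s p - h s0 p)) = h s" by auto
      have "(\<Sum>p\<in>{p \<in> ball z r. h s0 p + ?g p = 0}. winding_number ?\<gamma> p * zorder (\<lambda>p. h s0 p + ?g p) p)
          = (\<Sum>p\<in>{p \<in> ball z r. h s0 p = 0}. winding_number ?\<gamma> p * zorder (h s0) p)"
      proof (rule Rouche_theorem)
        show "\<forall>w\<in>path_image ?\<gamma>. cmod (?g w) < cmod (h s0 w)"
        proof
          fix w assume "w \<in> path_image ?\<gamma>"
          then have "w \<in> K" using circK q by (auto simp: path_image_circlepath)
          then show "cmod (?g w) < cmod (h s0 w)"
            using c(2)[of w] close[of w] by (auto simp: K_def)
        qed
        show "\<forall>w. w \<notin> ball z r \<longrightarrow> winding_number ?\<gamma> w = 0"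
          using q by (auto intro!: winding_number_zero_outside[of _ "cball z q"] simp: path_image_circlepath)
      qed (use q fin zb holb s s0 in \<open>auto intro!: holomorphic_on_diff simp: path_image_circlepath\<close>)
      then have eq: "(\<Sum>p\<in>{p \<in> ball z r. h s p = 0}. winding_number ?\<gamma> p * zorder (h s) p) = zorder (h s0) z"
        using q zb unfolding * by (simp add: winding_number_circlepath)
      \<comment> \<open>Rouche's theorem weights the zeros in the larger ball by winding numbers. No
        zero lies on the circle, because the circle is in \<open>K\<close>; a zero beyond it would
        have weight \<open>0\<close>, and the zeros in the small disc have weight
        \<open>1\<close>.\<close>
      have "(\<Sum>p\<in>{p \<in> ball z r. h s p = 0}. winding_number ?\<gamma> p * zorder (h s) p)
          = (\<Sum>p\<in>Z s \<inter> ball z q. winding_number ?\<gamma> p * zorder (h s) p)"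
      proof (rule sum.mono_neutral_right[OF fin])
        show "Z s \<inter> ball z q \<subseteq> {p \<in> ball z r. h s p = 0}" using q by (auto simp: Z_def)
        show "\<forall>p\<in>{p \<in> ball z r. h s p = 0} - Z s \<inter> ball z q. winding_number ?\<gamma> p * zorder (h s) p = 0"
        proof
          fix p assume p: "p \<in> {p \<in> ball z r. h s p = 0} - Z s \<inter> ball z q"
          then have "p \<in> Z s" "p \<notin> ball z q" using subs by auto
          moreover have "p \<notin> sphere z q"
            using circK[of p] Zs \<open>p \<in> Z s\<close> by (auto simp: K_def)
          ultimately have "p \<notin> cball z q" by auto
          then have "winding_number ?\<gamma> p = 0"
            using q by (intro winding_number_zero_outside[of _ "cball z q"]) (auto simp: path_image_circlepath)
          then show "winding_number ?\<gamma> p * zorder (h s) p = 0" by simp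
        qed
      qed
      also have "\<dots> = (\<Sum>p\<in>Z s \<inter> ball z q. of_int (zorder (h s) p))"
        by (intro sum.cong) (auto simp: winding_number_circlepath dist_norm norm_minus_commute)
      finally have "(of_int (\<Sum>p\<in>Z s \<inter> ball z q. zorder (h s) p) :: complex) = of_int (zorder (h s0) z)"
        using eq by simp
      then show ?thesis using of_int_eq_iff by blast
    qed
    have "zero_count (h s) F = (\<Sum>p\<in>(\<Union>z\<in>Z s0. Z s \<inter> ball z q). zorder (h s) p)"
      unfolding zero_count_def Z_def[symmetric] using Zs by (intro sum.cong) auto
    also have "\<dots> = (\<Sum>z\<in>Z s0. \<Sum>p\<in>Z s \<inter> ball z q. zorder (h s) p)"
    proof (rule sum.UNION_disjoint)
      show "\<forall>z\<in>Z s0. \<forall>w\<in>Z s0. z \<noteq> w \<longrightarrow> Z s \<inter> ball z q \<inter> (Z s \<inter> ball w q) = {}"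
      proof (intro ballI impI)
        fix z w assume zw: "z \<in> Z s0" "w \<in> Z s0" "z \<noteq> w"
        have "2 * r < dist z w" using rsep zw by auto
        then have "ball z q \<inter> ball w q = {}" using q by (intro disjoint_ballI) auto
        then show "Z s \<inter> ball z q \<inter> (Z s \<inter> ball w q) = {}" by auto
      qed
    qed (use finZ s s0 in auto)
    also have "\<dots> = zero_count (h s0) F" unfolding zero_count_def Z_def[symmetric] using loc by simp
    finally show ?thesis .
  qed
  then show ?thesis using d by blast
qed

lemma zero_count_homotopy:
  fixes h :: "real \<Rightarrow> complex \<Rightarrow> complex"
  assumes F: "F \<subseteq> E" "compact F"
    and hol: "\<And>s. s \<in> {0..1} \<Longrightarrow> h s holomorphic_on E"
    and cont: "continuous_on ({0..1} \<times> F) (\<lambda>(s, z). h s z)"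
    and nz: "\<And>s z. s \<in> {0..1} \<Longrightarrow> z \<in> frontier F \<Longrightarrow> h s z \<noteq> 0"
  shows "zero_count (h 0) F = zero_count (h 1) F"
proof -
  have "(\<lambda>s. zero_count (h s) F) constant_on {0..1::real}"
  proof (rule locally_constant_imp_constant)
    fix a :: real assume a: "a \<in> {0..1}"
    obtain d where "d > 0" and d: "\<And>s. s \<in> {0..1} \<Longrightarrow> \<bar>s - a\<bar> < d \<Longrightarrow> zero_count (h s) F = zero_count (h a) F"
      using zero_count_locally_constant[OF F hol cont nz a] by blast
    show "\<exists>T. openin (top_of_set {0..1}) T \<and> a \<in> T \<and> (\<forall>x\<in>T. zero_count (h x) F = zero_count (h a) F)"
    proof (intro exI conjI ballI)
      show "openin (top_of_set {0..1}) ({0..1} \<inter> ball a d)" by (rule openin_open_Int[OF open_ball])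
      show "a \<in> {0..1} \<inter> ball a d" using a \<open>d > 0\<close> by simp
      show "zero_count (h x) F = zero_count (h a) F" if "x \<in> {0..1} \<inter> ball a d" for x
        using that by (intro d) (auto simp: dist_real_def)
    qed
  qed auto
  then show ?thesis by (auto simp: constant_on_def)
qed

section \<open>Multiplicities and the determinant\<close>

definition mat_holomorphic :: "(complex \<Rightarrow> complex^'m^'n) \<Rightarrow> complex set \<Rightarrow> bool" where
  "mat_holomorphic A S \<longleftrightarrow> (\<forall>i j. (\<lambda>z. A z $ i $ j) holomorphic_on S)"

lemma mat_holomorphic_subset:
  "mat_holomorphic A S \<Longrightarrow> T \<subseteq> S \<Longrightarrow> mat_holomorphic A T"
  unfolding mat_holomorphic_def using holomorphic_on_subset by blast

lemma holomorphic_on_det: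
  assumes "mat_holomorphic A S"
  shows "(\<lambda>z. det (A z)) holomorphic_on S"
  using assms unfolding det_def mat_holomorphic_def
  by (intro holomorphic_intros) auto

lemma matrix_inv_left_right:
  assumes "invertible (A :: 'a::field^'n^'n)"
  shows "A ** matrix_inv A = mat 1" "matrix_inv A ** A = mat 1"
  using someI_ex[of "\<lambda>A'. A ** A' = mat 1 \<and> A' ** A = mat 1"] assms
  unfolding invertible_def matrix_inv_def by auto

lemma matrix_inv_unique:
  assumes "B ** (A :: 'a::field^'n^'n) = mat 1"
  shows "matrix_inv A = B"
proof -
  have "invertible A" using assms invertible_left_inverse by blast
  then show ?thesis
    using matrix_inv_left_right[of A] assms by (metis matrix_mul_assoc matrix_mul_lid matrix_mul_rid)
qed

text \<open>The numerator in Cramer's rule, that is the \<open>(k, l)\<close> entry of the adjugate.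
  It is polynomial in the entries of \<open>A\<close> and defined for singular \<open>A\<close> too,
  so all singularities of the inverse sit in the denominator \<open>det A\<close>.\<close>

definition cofactor :: "'a::field^'n^'n \<Rightarrow> 'n \<Rightarrow> 'n \<Rightarrow> 'a" where
  "cofactor A k l = det (\<chi> i j. if j = k then (axis l 1) $ i else A $ i $ j)"

lemma matrix_inv_cofactor:
  fixes A :: "'a::field^'n^'n"
  assumes "det A \<noteq> 0"
  shows "matrix_inv A $ k $ l = cofactor A k l / det A"
proof -
  have "A ** matrix_inv A = mat 1" using assms invertible_det_nz matrix_inv_left_right by blast
  then have "A *v (matrix_inv A *v axis l 1) = axis l 1"
    by (simp add: matrix_vector_mul_assoc)
  then have "matrix_inv A *v axis l 1 =
      (\<chi> k. det (\<chi> i j. if j = k then (axis l 1) $ i else A $ i $ j) / det A)"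
    using cramer[OF assms, of "matrix_inv A *v axis l 1" "axis l 1"] by simp
  then have "(matrix_inv A *v axis l 1) $ k = cofactor A k l / det A" by (simp add: cofactor_def)
  moreover have "(matrix_inv A *v axis l 1) $ k = matrix_inv A $ k $ l"
    by (simp add: matrix_vector_mult_def axis_def if_distrib cong: if_cong)
  ultimately show ?thesis by simp
qed

lemma holomorphic_on_cofactor:
  assumes "mat_holomorphic A S"
  shows "(\<lambda>z. cofactor (A z) k l) holomorphic_on S"
  unfolding cofactor_def
proof (intro holomorphic_on_det, unfold mat_holomorphic_def, intro allI)
  fix i j show "(\<lambda>z. (\<chi> i j. if j = k then axis l 1 $ i else A z $ i $ j) $ i $ j) holomorphic_on S"
    using assms unfolding mat_holomorphic_def by (cases "j = k") (auto intro: holomorphic_intros)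
qed

lemma mat_holomorphic_inv:
  fixes A :: "complex \<Rightarrow> complex^'n^'n"
  assumes "mat_holomorphic A S" "\<And>z. z \<in> S \<Longrightarrow> det (A z) \<noteq> 0"
  shows "mat_holomorphic (\<lambda>z. matrix_inv (A z)) S"
  unfolding mat_holomorphic_def
proof (intro allI)
  fix i j
  have "(\<lambda>z. cofactor (A z) i j / det (A z)) holomorphic_on S"
    using assms by (intro holomorphic_intros holomorphic_on_cofactor holomorphic_on_det) auto
  then show "(\<lambda>z. matrix_inv (A z) $ i $ j) holomorphic_on S"
    by (rule holomorphic_transform) (simp add: matrix_inv_cofactor assms(2))
qed

lemma mat_holomorphic_mult:
  fixes A B :: "complex \<Rightarrow> complex^'n^'n"
  assumes "mat_holomorphic A S" "mat_holomorphic B S"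
  shows "mat_holomorphic (\<lambda>z. A z ** B z) S"
  using assms unfolding mat_holomorphic_def matrix_matrix_mult_def
  by (auto intro!: holomorphic_intros)

lemma mat_holomorphic_const: "mat_holomorphic (\<lambda>z. X) S"
  unfolding mat_holomorphic_def by (auto intro!: holomorphic_intros)

lemma mat_holomorphic_deriv:
  assumes "mat_holomorphic A S" "open S"
  shows "mat_holomorphic (mderiv A) S"
  using assms unfolding mat_holomorphic_def mderiv_def by (auto intro: holomorphic_deriv)

text \<open>At the identity, only the identity permutation contributes to the derivative of the
  determinant, since every other permutation has at least two off-diagonal factors.\<close>

lemma det_has_derivative_at_identity:
  fixes B :: "complex \<Rightarrow> complex^'n^'n"
  assumes B: "\<And>i j. ((\<lambda>w. B w $ i $ j) has_field_derivative D $ i $ j) (at z)" and "B z = mat 1"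
  shows "((\<lambda>w. det (B w)) has_field_derivative trace D) (at z)"
proof -
  let ?P = "{p. p permutes (UNIV::'n set)}"
  let ?d = "\<lambda>p. of_int (sign p) * (\<Sum>i\<in>UNIV. D $ i $ p i * (\<Prod>j\<in>UNIV-{i}. B z $ j $ p j))"
  have "((\<lambda>w. det (B w)) has_field_derivative (\<Sum>p\<in>?P. ?d p)) (at z)"
    unfolding det_def
    by (intro DERIV_sum DERIV_cmult has_field_derivative_prod B)
  moreover have "(\<Sum>p\<in>?P. ?d p) = (\<Sum>p\<in>{id}. ?d p)"
  proof (rule sum.mono_neutral_right)
    show "\<forall>p\<in>?P - {id}. ?d p = 0"
    proof
      fix p assume p: "p \<in> ?P - {id}"
      have "(\<Prod>j\<in>UNIV-{i}. B z $ j $ p j) = 0" for i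
      proof -
        have "\<exists>j. j \<noteq> i \<and> p j \<noteq> j"
        proof (rule ccontr)
          assume "\<not> ?thesis"
          then have fixed: "p j = j" if "j \<noteq> i" for j using that by blast
          have "inj p" using p permutes_inj by blast
          then have "p i = i" using fixed by (metis injD)
          then have "p = id" using fixed by fastforce
          then show False using p by blast
        qed
        then obtain j where "j \<noteq> i" "p j \<noteq> j" by blast
        then have "j \<in> UNIV - {i}" "B z $ j $ p j = 0" by (auto simp: assms(2) mat_def)
        then show ?thesis by (meson finite finite_Diff prod_zero)
      qed
      then show "?d p = 0" by (simp only: mult_zero_right sum.neutral_const)
    qed
  qed (auto simp: permutes_id finite_permutations)
  ultimately show ?thesis by (simp add: trace_def assms(2) mat_def)
qed

lemma mat_holomorphic_DERIV:
  assumes "mat_holomorphic A S" "open S" "z \<in> S"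
  shows "((\<lambda>w. A w $ i $ j) has_field_derivative mderiv A z $ i $ j) (at z)"
  using assms unfolding mat_holomorphic_def mderiv_def
  by (auto intro: holomorphic_derivI)

text \<open>Multiplying by the constant matrix \<open>matrix_inv (A z)\<close> normalises the family
  to the identity at the point \<open>z\<close>, where the derivative of the determinant is the
  trace.\<close>

lemma jacobi_formula:
  fixes A :: "complex \<Rightarrow> complex^'n^'n"
  assumes A: "mat_holomorphic A S" "open S" "z \<in> S" and nz: "det (A z) \<noteq> 0"
  shows "deriv (\<lambda>w. det (A w)) z = det (A z) * trace (matrix_inv (A z) ** mderiv A z)"
proof -
  let ?B = "\<lambda>w. matrix_inv (A z) ** A w"
  have inv: "A z ** matrix_inv (A z) = mat 1" "matrix_inv (A z) ** A z = mat 1"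
    using matrix_inv_left_right nz invertible_det_nz by blast+
  have "((\<lambda>w. det (?B w)) has_field_derivative trace (matrix_inv (A z) ** mderiv A z)) (at z)"
  proof (rule det_has_derivative_at_identity)
    show "((\<lambda>w. ?B w $ i $ j) has_field_derivative (matrix_inv (A z) ** mderiv A z) $ i $ j) (at z)" for i j
      unfolding matrix_matrix_mult_def
      by (simp, intro DERIV_sum DERIV_cmult mat_holomorphic_DERIV[OF A])
  qed (rule inv)
  then have "((\<lambda>w. det (A z) * det (?B w)) has_field_derivative
      det (A z) * trace (matrix_inv (A z) ** mderiv A z)) (at z)"
    by (rule DERIV_cmult)
  moreover have "det (A z) * det (?B w) = det (A w)" for w
    by (simp flip: det_mul add: matrix_mul_assoc inv)
  ultimately show ?thesis by (simp add: DERIV_imp_deriv)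
qed

lemma residue_sum:
  assumes "finite I" "open S" "z \<in> S" "\<And>i. i \<in> I \<Longrightarrow> f i holomorphic_on S - {z}"
  shows "residue (\<lambda>w. \<Sum>i\<in>I. f i w) z = (\<Sum>i\<in>I. residue (f i) z)"
  using assms
proof (induction I rule: finite_induct)
  case empty then show ?case by (simp add: residue_const)
next
  case (insert i I)
  then have "residue (\<lambda>w. f i w + (\<Sum>i\<in>I. f i w)) z = residue (f i) z + residue (\<lambda>w. \<Sum>i\<in>I. f i w) z"
    by (intro residue_add[of S]) (auto intro!: holomorphic_intros)
  then show ?case using insert by simp
qed

lemma trace_mresidue:
  fixes B :: "complex \<Rightarrow> complex^'n^'n"
  assumes "open S" "\<zeta> \<in> S" "mat_holomorphic B (S - {\<zeta>})"
  shows "trace (mresidue B \<zeta>) = residue (\<lambda>z. trace (B z)) \<zeta>"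
  unfolding trace_def using assms
  by (subst residue_sum[of _ S]) (auto simp: mresidue_def mat_holomorphic_def)

lemma mresidue_mult_left:
  fixes B :: "complex \<Rightarrow> complex^'n^'n"
  assumes "open S" "\<zeta> \<in> S" "mat_holomorphic B (S - {\<zeta>})"
  shows "mresidue (\<lambda>z. X ** B z) \<zeta> = X ** mresidue B \<zeta>"
proof -
  have h: "(\<lambda>z. B z $ i $ j) holomorphic_on S - {\<zeta>}" for i j using assms(3) by (auto simp: mat_holomorphic_def)
  have "residue (\<lambda>z. \<Sum>k\<in>UNIV. X $ i $ k * B z $ k $ j) \<zeta> = (\<Sum>k\<in>UNIV. X $ i $ k * residue (\<lambda>z. B z $ k $ j) \<zeta>)" for i j
    using assms(1,2) h by (subst residue_sum[of _ S]) (auto intro!: holomorphic_intros sum.cong residue_lmul[of S])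
  then show ?thesis by (simp add: mresidue_def matrix_matrix_mult_def)
qed

lemma mresidue_mult_right:
  fixes B :: "complex \<Rightarrow> complex^'n^'n"
  assumes "open S" "\<zeta> \<in> S" "mat_holomorphic B (S - {\<zeta>})"
  shows "mresidue (\<lambda>z. B z ** X) \<zeta> = mresidue B \<zeta> ** X"
proof -
  have h: "(\<lambda>z. B z $ i $ j) holomorphic_on S - {\<zeta>}" for i j using assms(3) by (auto simp: mat_holomorphic_def)
  have "residue (\<lambda>z. \<Sum>k\<in>UNIV. B z $ i $ k * X $ k $ j) \<zeta> = (\<Sum>k\<in>UNIV. residue (\<lambda>z. B z $ i $ k) \<zeta> * X $ k $ j)" for i j
    using assms(1,2) h by (subst residue_sum[of _ S]) (auto intro!: holomorphic_intros sum.cong residue_rmul[of S])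
  then show ?thesis by (simp add: mresidue_def matrix_matrix_mult_def)
qed

lemma mresidue_add:
  assumes "open S" "\<zeta> \<in> S" "mat_holomorphic A (S - {\<zeta>})" "mat_holomorphic B (S - {\<zeta>})"
  shows "mresidue (\<lambda>z. A z + B z) \<zeta> = mresidue A \<zeta> + mresidue B \<zeta>"
  using assms unfolding mat_holomorphic_def
  by (auto simp: mresidue_def vec_eq_iff intro!: residue_add[of S])

lemma mresidue_cong:
  assumes "open S" "\<zeta> \<in> S" "\<And>z. z \<in> S - {\<zeta>} \<Longrightarrow> A z = B z"
  shows "mresidue A \<zeta> = mresidue B \<zeta>"
proof -
  have ev: "\<forall>\<^sub>F z in at \<zeta>. A z = B z"
    using eventually_at_in_open[OF assms(1,2)] by eventually_elim (rule assms(3))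
  have "residue (\<lambda>z. A z $ i $ j) \<zeta> = residue (\<lambda>z. B z $ i $ j) \<zeta>" for i j
    using ev by (intro residue_cong) (auto elim: eventually_mono)
  then show ?thesis by (simp add: mresidue_def)
qed

text \<open>Covers the case \<open>f \<zeta> \<noteq> 0\<close> as well, with order
  \<open>0\<close>. Knowing that \<open>zorder\<close> is nonnegative makes the conversion by
  \<open>nat\<close> faithful.\<close>

lemma holomorphic_nonzero_near_factor:
  assumes f: "f holomorphic_on S" "open S" "\<zeta> \<in> S" and nz: "\<forall>\<^sub>F w in at \<zeta>. f w \<noteq> 0"
  obtains r g where "r > 0" "ball \<zeta> r \<subseteq> S" "g holomorphic_on ball \<zeta> r" "zorder f \<zeta> \<ge> 0"
    "\<And>w. w \<in> ball \<zeta> r \<Longrightarrow> g w \<noteq> 0 \<and> f w = g w * (w - \<zeta>) ^ nat (zorder f \<zeta>)"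
proof -
  obtain e where e: "e > 0" "ball \<zeta> e \<subseteq> S" using f(2,3) open_contains_ball by blast
  have "\<forall>\<^sub>F w in at \<zeta>. w \<in> ball \<zeta> e - {\<zeta>}" using e by (intro eventually_at_in_open) auto
  then have "\<forall>\<^sub>F w in at \<zeta>. w \<in> ball \<zeta> e \<and> f w \<noteq> 0" using nz by eventually_elim auto
  then have nc: "\<exists>w\<in>ball \<zeta> e. f w \<noteq> 0" using eventually_happens[of "\<lambda>w. w \<in> ball \<zeta> e \<and> f w \<noteq> 0" "at \<zeta>"] by auto
  have hb: "f holomorphic_on ball \<zeta> e" using f(1) e(2) by (rule holomorphic_on_subset)
  have "\<zeta> \<in> ball \<zeta> e" using e(1) by simp
  from zorder_exist_zero[OF hb open_ball connected_ball this nc]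
  obtain r where r: "r > 0" "cball \<zeta> r \<subseteq> ball \<zeta> e" "zor_poly f \<zeta> holomorphic_on cball \<zeta> r"
    "\<And>w. w \<in> cball \<zeta> r \<Longrightarrow> f w = zor_poly f \<zeta> w * (w - \<zeta>) ^ nat (zorder f \<zeta>) \<and> zor_poly f \<zeta> w \<noteq> 0"
    "(if f \<zeta> = 0 then zorder f \<zeta> > 0 else zorder f \<zeta> = 0)"
    by blast
  show ?thesis
  proof (rule that[of r "zor_poly f \<zeta>"])
    show "zor_poly f \<zeta> holomorphic_on ball \<zeta> r"
      using r(3) ball_subset_cball by (rule holomorphic_on_subset)
    show "ball \<zeta> r \<subseteq> S" using r(2) e(2) ball_subset_cball[of \<zeta> r] by blast
    show "zorder f \<zeta> \<ge> 0" using r(5) by (auto split: if_splits)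
  qed (use r in auto)
qed

lemma residue_logderiv:
  assumes f: "f holomorphic_on S" "open S" "\<zeta> \<in> S" and nz: "\<forall>\<^sub>F w in at \<zeta>. f w \<noteq> 0"
  shows "residue (\<lambda>w. deriv f w / f w) \<zeta> = of_int (zorder f \<zeta>)"
proof -
  obtain r g where r: "r > 0" "ball \<zeta> r \<subseteq> S" and g: "g holomorphic_on ball \<zeta> r" "zorder f \<zeta> \<ge> 0"
    and fg: "\<And>w. w \<in> ball \<zeta> r \<Longrightarrow> g w \<noteq> 0 \<and> f w = g w * (w - \<zeta>) ^ nat (zorder f \<zeta>)"
    by (rule holomorphic_nonzero_near_factor[OF assms]) auto
  define n where "n = nat (zorder f \<zeta>)"
  have eq: "deriv f w / f w = of_nat n / (w - \<zeta>) + deriv g w / g w" if w: "w \<in> ball \<zeta> r - {\<zeta>}" for w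
  proof -
    have gd: "(g has_field_derivative deriv g w) (at w)"
      using w g(1) by (intro holomorphic_derivI[of _ "ball \<zeta> r"]) auto
    have "((\<lambda>w. g w * (w - \<zeta>) ^ n) has_field_derivative
        deriv g w * (w - \<zeta>) ^ n + g w * (of_nat n * (w - \<zeta>) ^ (n - 1))) (at w)"
      by (rule derivative_eq_intros gd refl | simp)+
    moreover have "\<forall>\<^sub>F u in nhds w. f u = g u * (u - \<zeta>) ^ n"
      using eventually_nhds_in_open[of "ball \<zeta> r" w] w by (auto elim!: eventually_mono simp: fg n_def)
    ultimately have "deriv f w = deriv g w * (w - \<zeta>) ^ n + g w * (of_nat n * (w - \<zeta>) ^ (n - 1))"
      by (simp add: deriv_cong_ev DERIV_imp_deriv)
    \<comment> \<open>For \<open>n = 0\<close> the exponent \<open>n - 1\<close> is truncated to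
      \<open>0\<close>, but the coefficient \<open>of_nat n\<close> removes that term; hence the
      case distinction.\<close>
    then show ?thesis using w fg[of w]
      by (cases n) (auto simp: n_def[symmetric] divide_simps, simp add: algebra_simps)
  qed
  have "residue (\<lambda>w. deriv f w / f w) \<zeta> = residue (\<lambda>w. of_nat n / (w - \<zeta>) + deriv g w / g w) \<zeta>"
    using eventually_at_in_open[of "ball \<zeta> r" \<zeta>] r(1)
    by (intro residue_cong) (auto elim!: eventually_mono simp: eq)
  also have "\<dots> = residue (\<lambda>w. of_nat n / (w - \<zeta>)) \<zeta> + residue (\<lambda>w. deriv g w / g w) \<zeta>"
    using r(1) g(1) fg
    by (intro residue_add[of "ball \<zeta> r"]) (auto intro!: holomorphic_intros holomorphic_on_subset[OF g(1)])
  also have "residue (\<lambda>w. deriv g w / g w) \<zeta> = 0"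
    using r(1) g(1) fg by (intro residue_holo[of "ball \<zeta> r"] holomorphic_intros) auto
  also have "residue (\<lambda>w. of_nat n / (w - \<zeta>)) \<zeta> = of_nat n"
    by (rule residue_simple[of UNIV]) auto
  finally show ?thesis using g(2) by (simp add: n_def)
qed

text \<open>By Jacobi's formula the trace of \<open>matrix_inv (A z) ** mderiv A z\<close> is the
  logarithmic derivative of the determinant, and the trace commutes with the residue. In particular
  the trace is a natural number, so the description \<open>THE\<close> in \<open>alg_mult\<close>
  denotes it.\<close>

lemma alg_mult_eq_zorder:
  fixes A :: "complex \<Rightarrow> complex^'n^'n"
  assumes A: "mat_holomorphic A E" "open E" "\<zeta> \<in> E" and nz: "\<forall>\<^sub>F w in at \<zeta>. det (A w) \<noteq> 0"
  shows "int (alg_mult A \<zeta>) = zorder (\<lambda>z. det (A z)) \<zeta>"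
    and "trace (mresidue (\<lambda>z. matrix_inv (A z) ** mderiv A z) \<zeta>) = of_int (zorder (\<lambda>z. det (A z)) \<zeta>)"
proof -
  have hd: "(\<lambda>z. det (A z)) holomorphic_on E" using A(1) by (rule holomorphic_on_det)
  obtain S where S: "open S" "\<zeta> \<in> S" "S \<subseteq> E" "\<And>z. z \<in> S - {\<zeta>} \<Longrightarrow> det (A z) \<noteq> 0"
  proof -
    obtain U where "open U" "\<zeta> \<in> U" "\<And>z. z \<in> U \<Longrightarrow> z \<noteq> \<zeta> \<Longrightarrow> det (A z) \<noteq> 0"
      using nz unfolding eventually_at_topological by blast
    then show ?thesis using that[of "U \<inter> E"] A(2,3) by auto
  qed
  have h: "mat_holomorphic (\<lambda>z. matrix_inv (A z) ** mderiv A z) (S - {\<zeta>})"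
  proof (intro mat_holomorphic_mult mat_holomorphic_inv)
    show "mat_holomorphic A (S - {\<zeta>})" using A(1) by (rule mat_holomorphic_subset) (use S in auto)
    show "mat_holomorphic (mderiv A) (S - {\<zeta>})"
      by (rule mat_holomorphic_subset[OF mat_holomorphic_deriv[OF A(1,2)]]) (use S in auto)
  qed (use S in auto)
  have "trace (mresidue (\<lambda>z. matrix_inv (A z) ** mderiv A z) \<zeta>)
      = residue (\<lambda>z. trace (matrix_inv (A z) ** mderiv A z)) \<zeta>"
    by (rule trace_mresidue[OF S(1,2) h])
  also have "\<dots> = residue (\<lambda>w. deriv (\<lambda>z. det (A z)) w / det (A w)) \<zeta>"
  proof (rule residue_cong[OF _ refl])
    show "\<forall>\<^sub>F z in at \<zeta>. trace (matrix_inv (A z) ** mderiv A z) = deriv (\<lambda>z. det (A z)) z / det (A z)"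
      using eventually_at_in_open[OF S(1,2)]
    proof eventually_elim
      case (elim z)
      then show ?case using jacobi_formula[OF A(1,2), of z] S(3,4) by auto
    qed
  qed
  also have "\<dots> = of_int (zorder (\<lambda>z. det (A z)) \<zeta>)"
    by (rule residue_logderiv[OF hd A(2,3) nz])
  finally show tr: "trace (mresidue (\<lambda>z. matrix_inv (A z) ** mderiv A z) \<zeta>) = of_int (zorder (\<lambda>z. det (A z)) \<zeta>)" .
  have "zorder (\<lambda>z. det (A z)) \<zeta> \<ge> 0"
    by (rule holomorphic_nonzero_near_factor[OF hd A(2,3) nz]) auto
  then obtain n where n: "zorder (\<lambda>z. det (A z)) \<zeta> = int n" using nonneg_int_cases by blast
  have "alg_mult A \<zeta> = n"
    unfolding alg_mult_def tr n by (rule the_equality) auto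
  then show "int (alg_mult A \<zeta>) = zorder (\<lambda>z. det (A z)) \<zeta>" using n by simp
qed

lemma det_eq_0_iff_kernel:
  fixes A :: "'a::field^'n^'n"
  shows "det A = 0 \<longleftrightarrow> (\<exists>v. v \<noteq> 0 \<and> A *v v = 0)"
  using invertible_det_nz[of A] invertible_left_inverse[of A] matrix_left_invertible_ker[of A] by blast

section \<open>Linear pencils\<close>

lemma matrix_vector_mult_axis: "(A :: 'a::comm_ring_1^'n^'m) *v axis k 1 = column k A"
  by (simp add: matrix_vector_mult_def axis_def column_def vec_eq_iff if_distrib cong: if_cong)

lemma matrix_add_rdistrib: "(A + B) ** (C :: 'a::semiring_1^'p^'n) = A ** C + (B :: 'a^'n^'m) ** C"
  by (simp add: vec_eq_iff matrix_matrix_mult_def distrib_right sum.distrib)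

lemma matrix_uminus_left: "(- A) ** (B :: 'a::ring_1^'p^'n) = - ((A :: 'a^'n^'m) ** B)"
  by (simp add: vec_eq_iff matrix_matrix_mult_def sum_negf)

lemma matrix_uminus_right: "(A :: 'a::ring_1^'n^'m) ** (- B) = - (A ** (B :: 'a^'p^'n))"
  by (simp add: vec_eq_iff matrix_matrix_mult_def sum_negf)

lemma rank_mult_le_right:
  fixes A B :: "'a::field^'n^'n"
  shows "rank (A ** B) \<le> rank B"
  unfolding row_rank_def_gen
proof (rule vec.dim_mono, rule subsetI)
  fix r assume "r \<in> rows (A ** B)"
  then obtain i where i: "r = row i (A ** B)" by (auto simp: rows_def)
  have "row i (A ** B) = (\<Sum>k\<in>UNIV. A $ i $ k *s row k B)"
    by (simp add: vec_eq_iff row_def matrix_matrix_mult_def)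
  moreover have "(\<Sum>k\<in>UNIV. A $ i $ k *s row k B) \<in> vec.span (rows B)"
    by (intro vec.span_sum vec.span_scale vec.span_base) (auto simp: rows_def)
  ultimately show "r \<in> vec.span (rows B)" using i by simp
qed

text \<open>A projection is diagonalised by a basis of its range, extended to the whole space and
  corrected so that the added vectors lie in the kernel. The diagonal form has one entry
  \<open>1\<close> for each basis vector of the range.\<close>

lemma trace_idempotent:
  fixes A :: "complex^'n^'n"
  assumes "A ** A = A"
  shows "trace A = of_nat (rank A)"
proof -
  \<comment> \<open>\<open>rank\<close> is unfolded as a row rank; after transposing it becomes the
    dimension of the range of \<open>M\<close>.\<close>
  define M where "M = transpose A"
  have MM: "M ** M = M" unfolding M_def by (simp flip: matrix_transpose_mul add: assms)
  define W where "W = range ((*v) M)"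
  have "columns M \<subseteq> W"
    unfolding W_def columns_def by (force simp flip: matrix_vector_mult_axis)
  moreover have "W \<subseteq> vec.span (columns M)"
    unfolding W_def using matrix_vector_mult_in_columnspace_gen by blast
  ultimately have "vec.dim (columns M) = vec.dim W"
    by (metis vec.dim_subset vec.dim_span antisym)
  then have rk: "rank A = vec.dim W" by (simp add: row_rank_def_gen M_def columns_transpose)
  have fixW: "M *v x = x" if "x \<in> W" for x
    using that MM by (auto simp: W_def matrix_vector_mul_assoc)
  obtain B1 where B1: "B1 \<subseteq> W" "vec.independent B1" "W \<subseteq> vec.span B1" "card B1 = vec.dim W"
    by (rule vec.basis_exists[of W]) blast
  obtain B where B: "B1 \<subseteq> B" "vec.independent B" "UNIV \<subseteq> vec.span B"
    by (rule vec.maximal_independent_subset_extend[OF subset_UNIV B1(2)]) blast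
  have finB: "finite B" using B(2) by (rule vec.finiteI_independent)
  have "card B = CARD('n)"
    using vec.basis_card_eq_dim[OF subset_UNIV B(3,2)] by (simp only: vec_dim_card)
  then obtain f :: "'n \<Rightarrow> complex^'n" where f: "bij_betw f UNIV B"
    using finite_same_card_bij[of "UNIV :: 'n set" B] finB by auto
  \<comment> \<open>For \<open>f j\<close> outside \<open>B1\<close>, the vector
    \<open>f j - M *v f j\<close> is annihilated by \<open>M\<close> because
    \<open>M ** M = M\<close>; the vectors in \<open>B1\<close> are fixed by
    \<open>M\<close>.\<close>
  define g where "g j = (if f j \<in> B1 then f j else f j - M *v f j)" for j
  define S :: "complex^'n^'n" where "S = (\<chi> i j. g j $ i)"
  have S_axis: "S *v axis j 1 = g j" for j
    by (simp add: matrix_vector_mult_axis S_def column_def vec_eq_iff)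
  have sub: "vec.subspace (range ((*v) S))"
    by (intro vec.subspaceI) (auto simp: image_iff intro: exI[of _ 0]
        simp flip: matrix_vector_right_distrib vector_scalar_commute)
  have B1S: "vec.span B1 \<subseteq> range ((*v) S)"
  proof (rule vec.span_minimal[OF subsetI sub])
    fix b assume b: "b \<in> B1"
    then obtain j where "b = f j" using B(1) f by (auto simp: bij_betw_def)
    then show "b \<in> range ((*v) S)" using S_axis[of j] b by (auto simp: g_def intro: range_eqI[OF sym])
  qed
  \<comment> \<open>Invertibility of \<open>S\<close> is obtained from surjectivity: a basis vector
    \<open>b\<close> outside \<open>B1\<close> is \<open>g j + M *v b\<close>, and
    \<open>M *v b\<close> lies in the span of \<open>B1\<close>.\<close>
  have "vec.span B \<subseteq> range ((*v) S)"
  proof (rule vec.span_minimal[OF subsetI sub])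
    fix b assume b: "b \<in> B"
    then obtain j where j: "b = f j" using f by (auto simp: bij_betw_def)
    have gS: "g j \<in> range ((*v) S)" using S_axis[of j] by (metis rangeI)
    have "M *v b \<in> range ((*v) S)" using B1(3) B1S by (auto simp: W_def)
    then have "g j + M *v b \<in> range ((*v) S)" using gS sub vec.subspace_add by blast
    then show "b \<in> range ((*v) S)" using gS by (cases "b \<in> B1") (auto simp: g_def j)
  qed
  then have "surj ((*v) S)" using B(3) by blast
  then obtain S' where S': "S ** S' = mat 1" using matrix_right_invertible_surjective[of S] by auto
  then have S'': "S' ** S = mat 1" using matrix_left_right_inverse by blast
  define D :: "complex^'n^'n" where "D = (\<chi> i j. if i = j \<and> f j \<in> B1 then 1 else 0)"
  have "M ** S = S ** D"
  proof -
    have "(M ** S) *v axis j 1 = (S ** D) *v axis j 1" for j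
    proof -
      have D: "D *v axis j 1 = (if f j \<in> B1 then axis j 1 else 0)"
        unfolding matrix_vector_mult_axis by (simp add: D_def column_def vec_eq_iff axis_def)
      have "M *v g j = (if f j \<in> B1 then g j else 0)"
        using fixW[of "f j"] B1(1) MM
        by (auto simp: g_def matrix_vector_mult_diff_distrib matrix_vector_mul_assoc)
      then show ?thesis by (simp flip: matrix_vector_mul_assoc add: S_axis D)
    qed
    then have "column j (M ** S) = column j (S ** D)" for j by (simp add: matrix_vector_mult_axis)
    then show ?thesis by (auto simp: column_def vec_eq_iff)
  qed
  then have "M = S ** D ** S'" by (metis S' matrix_mul_assoc matrix_mul_rid)
  then have "trace M = trace (S' ** (S ** D))" by (metis trace_mul_sym)
  also have "\<dots> = trace D" by (simp add: matrix_mul_assoc S'')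
  also have "\<dots> = of_nat (card {j. f j \<in> B1})" by (simp add: trace_def D_def sum.If_cases)
  also have "card {j. f j \<in> B1} = card B1"
  proof (rule bij_betw_same_card)
    show "bij_betw f {j. f j \<in> B1} B1"
      using f B(1) by (auto simp: bij_betw_def inj_on_def image_iff)
  qed
  finally have "trace M = of_nat (rank A)" using B1(4) rk by simp
  then show ?thesis by (simp add: M_def trace_def transpose_def)
qed

lemma residue_powi: "residue (\<lambda>z. (z - \<zeta>) powi k) \<zeta> = (if k = -1 then 1 else 0)"
proof (cases "k \<ge> 0")
  case True
  then show ?thesis by (subst residue_holo[of UNIV]) (auto intro!: holomorphic_intros)
next
  case False
  define n where "n = nat (- k - 1)"
  have n: "k = - int (Suc n)" using False by (simp add: n_def)
  have "residue (\<lambda>z. 1 / (z - \<zeta>) ^ Suc n) \<zeta> = (deriv ^^ n) (\<lambda>_. 1) \<zeta> / fact n"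
    by (rule residue_holomorphic_over_power[of UNIV]) auto
  moreover have "(\<lambda>z. (z - \<zeta>) powi k) = (\<lambda>z. 1 / (z - \<zeta>) ^ Suc n)"
    unfolding n by (simp only: power_int_minus power_int_of_nat inverse_eq_divide)
  moreover have "(deriv ^^ n) (\<lambda>_. 1 :: complex) \<zeta> = (if n = 0 then 1 else 0)"
    by (cases n) (simp_all add: funpow_Suc_right higher_deriv_const del: funpow.simps)
  ultimately show ?thesis using n by auto
qed

text \<open>Complex multiples of matrices are written as products with the scalar matrix
  \<open>mat c\<close>, since \<open>*\<^sub>R\<close> offers only real factors; associativity of
  \<open>**\<close> then handles them like any other product.\<close>

lemma mat_scale_nth: "(mat c ** (A :: complex^'n^'n)) $ i $ j = c * A $ i $ j"
  by (simp add: matrix_matrix_mult_def mat_def if_distrib[of "\<lambda>x. x * _"] cong: if_cong)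

lemma mat_scale_commute: "mat c ** (A :: complex^'n^'n) = A ** mat c"
  by (simp add: vec_eq_iff mat_scale_nth)
    (simp add: matrix_matrix_mult_def mat_def if_distrib[of "\<lambda>x. _ * x"] mult.commute cong: if_cong)

lemma mat_holomorphic_scale:
  assumes "f holomorphic_on S" "mat_holomorphic A S"
  shows "mat_holomorphic (\<lambda>z. mat (f z) ** (A z :: complex^'n^'n)) S"
  using assms unfolding mat_holomorphic_def by (auto simp: mat_scale_nth intro!: holomorphic_intros)

text \<open>The matrices \<open>T k\<close> are the Laurent coefficients of \<open>(A z)\<^sup>-\<^sup>1\<close> at \<open>\<zeta>\<close>. Comparing coefficients
  in \<open>A\<^sup>-\<^sup>1 A = A A\<^sup>-\<^sup>1 = 1\<close> gives recursions for \<open>T k A(\<zeta>)\<close> and \<open>A(\<zeta>) T k\<close>, and running them against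
  the finite principal part yields \<open>T (-1) L T (-1) = - T (-1)\<close>, so that \<open>- L T (-1)\<close> is a
  projection of the same rank as \<open>T (-1)\<close>.\<close>

lemma riesz_rank_eq_zorder:
  fixes A :: "complex \<Rightarrow> complex^'n^'n"
  assumes E: "open E" "\<zeta> \<in> E" and nz: "\<forall>\<^sub>F w in at \<zeta>. det (A w) \<noteq> 0"
    and pencil: "\<And>z. z \<in> E \<Longrightarrow> A z = (\<chi> i j. K $ i $ j - z * L $ i $ j)"
  shows "int (riesz_rank A \<zeta>) = zorder (\<lambda>z. det (A z)) \<zeta>"
proof -
  have Ah: "mat_holomorphic A E"
    unfolding mat_holomorphic_def
  proof (intro allI)
    fix i j
    have "(\<lambda>z. K $ i $ j - z * L $ i $ j) holomorphic_on E" by (intro holomorphic_intros)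
    then show "(\<lambda>z. A z $ i $ j) holomorphic_on E"
      by (rule holomorphic_transform) (simp add: pencil)
  qed
  have hd: "(\<lambda>z. det (A z)) holomorphic_on E" using Ah by (rule holomorphic_on_det)
  obtain r g where r: "r > 0" "ball \<zeta> r \<subseteq> E" and g: "g holomorphic_on ball \<zeta> r"
    and fg: "\<And>w. w \<in> ball \<zeta> r \<Longrightarrow> g w \<noteq> 0 \<and> det (A w) = g w * (w - \<zeta>) ^ nat (zorder (\<lambda>z. det (A z)) \<zeta>)"
    by (rule holomorphic_nonzero_near_factor[OF hd E nz]) auto
  define n where "n = nat (zorder (\<lambda>z. det (A z)) \<zeta>)"
  define S where "S = ball \<zeta> r"
  have S: "open S" "\<zeta> \<in> S" "S \<subseteq> E" using r by (auto simp: S_def)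
  have dnz: "det (A z) \<noteq> 0" if "z \<in> S - {\<zeta>}" for z using fg[of z] that by (auto simp: S_def)
  define R where "R z = matrix_inv (A z)" for z
  have Rh: "mat_holomorphic R (S - {\<zeta>})"
    unfolding R_def using dnz S(3) by (intro mat_holomorphic_inv mat_holomorphic_subset[OF Ah]) auto
  \<comment> \<open>The weight \<open>(z - \<zeta>) powi (- k - 1)\<close> moves the coefficient of
    index \<open>k\<close> into the residue.\<close>
  define T where "T k = mresidue (\<lambda>z. mat ((z - \<zeta>) powi (- k - 1)) ** R z) \<zeta>" for k :: int
  have sRh: "mat_holomorphic (\<lambda>z. mat ((z - \<zeta>) powi k) ** R z) (S - {\<zeta>})" for k
    using Rh by (intro mat_holomorphic_scale holomorphic_intros) auto
  have sIh: "mat_holomorphic (\<lambda>z. mat ((z - \<zeta>) powi k) ** mat 1 :: complex^'n^'n) (S - {\<zeta>})" for k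
    by (intro mat_holomorphic_scale mat_holomorphic_const holomorphic_intros) auto
  have resI: "mresidue (\<lambda>z. mat ((z - \<zeta>) powi k) ** mat 1 :: complex^'n^'n) \<zeta> = (if k = -1 then mat 1 else 0)" for k
    by (auto simp: mresidue_def mat_scale_nth vec_eq_iff mat_def[of 1] residue_powi residue_const
        residue_powi[of \<zeta> "-1", simplified])
  define A0 where "A0 = A \<zeta>"
  have Az: "A0 = A z + mat (z - \<zeta>) ** L" if "z \<in> S" for z
  proof -
    have "z \<in> E" using that S(3) by blast
    then show ?thesis unfolding A0_def pencil[OF \<open>z \<in> E\<close>] pencil[OF E(2)]
      by (simp add: vec_eq_iff mat_scale_nth algebra_simps)
  qed
  have inv: "R z ** A z = mat 1" "A z ** R z = mat 1" if "z \<in> S - {\<zeta>}" for z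
    using dnz[OF that] matrix_inv_left_right invertible_det_nz unfolding R_def by blast+
  have powi: "mat ((z - \<zeta>) powi (- k - 1)) ** mat (z - \<zeta>) = (mat ((z - \<zeta>) powi (- (k - 1) - 1)) :: complex^'n^'n)"
    if "z \<in> S - {\<zeta>}" for z k
  proof -
    have "(z - \<zeta>) powi (- k - 1) * (z - \<zeta>) = (z - \<zeta>) powi (- k - 1 + 1)"
      using that by (subst power_int_add) auto
    then show ?thesis by (simp add: vec_eq_iff mat_scale_nth) (simp add: mat_def)
  qed
  have T1: "T k ** A0 = (if k = 0 then mat 1 else 0) + T (k - 1) ** L" for k
  proof -
    have "T k ** A0 = mresidue (\<lambda>z. mat ((z - \<zeta>) powi (- k - 1)) ** R z ** A0) \<zeta>"
      unfolding T_def by (rule mresidue_mult_right[OF S(1,2) sRh, symmetric])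
    also have "\<dots> = mresidue (\<lambda>z. mat ((z - \<zeta>) powi (- k - 1)) ** mat 1
        + mat ((z - \<zeta>) powi (- (k - 1) - 1)) ** R z ** L) \<zeta>"
    proof (rule mresidue_cong[OF S(1,2)])
      fix z assume z: "z \<in> S - {\<zeta>}"
      have "R z ** A0 = mat 1 + mat (z - \<zeta>) ** (R z ** L)"
        using Az[of z] z inv[OF z]
        by (simp add: matrix_add_ldistrib) (metis mat_scale_commute matrix_mul_assoc)
      then show "mat ((z - \<zeta>) powi (- k - 1)) ** R z ** A0 = mat ((z - \<zeta>) powi (- k - 1)) ** mat 1
        + mat ((z - \<zeta>) powi (- (k - 1) - 1)) ** R z ** L"
        by (simp only: matrix_add_ldistrib powi[OF z, symmetric] matrix_mul_assoc[symmetric])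
    qed
    also have "\<dots> = (if k = 0 then mat 1 else 0) + T (k - 1) ** L"
      unfolding T_def mresidue_mult_right[OF S(1,2) sRh, symmetric]
      by (subst mresidue_add[OF S(1,2) sIh mat_holomorphic_mult[OF sRh mat_holomorphic_const]])
        (simp only: resI, simp)
    finally show ?thesis .
  qed
  have T2: "A0 ** T k = (if k = 0 then mat 1 else 0) + L ** T (k - 1)" for k
  proof -
    have "A0 ** T k = mresidue (\<lambda>z. A0 ** (mat ((z - \<zeta>) powi (- k - 1)) ** R z)) \<zeta>"
      unfolding T_def by (rule mresidue_mult_left[OF S(1,2) sRh, symmetric])
    also have "\<dots> = mresidue (\<lambda>z. mat ((z - \<zeta>) powi (- k - 1)) ** mat 1
        + L ** (mat ((z - \<zeta>) powi (- (k - 1) - 1)) ** R z)) \<zeta>"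
    proof (rule mresidue_cong[OF S(1,2)])
      fix z assume z: "z \<in> S - {\<zeta>}"
      have "A0 ** R z = mat 1 + mat (z - \<zeta>) ** (L ** R z)"
        using Az[of z] z inv[OF z]
        by (simp add: matrix_add_rdistrib matrix_mul_assoc)
      then have "mat ((z - \<zeta>) powi (- k - 1)) ** (A0 ** R z) = mat ((z - \<zeta>) powi (- k - 1)) ** mat 1
        + mat ((z - \<zeta>) powi (- (k - 1) - 1)) ** (L ** R z)"
        by (simp only: matrix_add_ldistrib powi[OF z, symmetric] matrix_mul_assoc[symmetric])
      then show "A0 ** (mat ((z - \<zeta>) powi (- k - 1)) ** R z) = mat ((z - \<zeta>) powi (- k - 1)) ** mat 1
        + L ** (mat ((z - \<zeta>) powi (- (k - 1) - 1)) ** R z)"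
        by (metis mat_scale_commute matrix_mul_assoc)
    qed
    also have "\<dots> = (if k = 0 then mat 1 else 0) + L ** T (k - 1)"
      unfolding T_def mresidue_mult_left[OF S(1,2) sRh, symmetric]
      by (subst mresidue_add[OF S(1,2) sIh mat_holomorphic_mult[OF mat_holomorphic_const sRh]])
        (simp only: resI, simp)
    finally show ?thesis .
  qed
  \<comment> \<open>The inverse is \<open>cofactor\<close> over the determinant, and the determinant
    vanishes to order \<open>n\<close>, so the pole has order at most \<open>n\<close>.\<close>
  have T0: "T (- int m - 1) = 0" if "m \<ge> n" for m
  proof -
    have "residue (\<lambda>z. (mat ((z - \<zeta>) powi (int m)) ** R z) $ i $ j) \<zeta> = 0" for i j
    proof -
      have "residue (\<lambda>z. (mat ((z - \<zeta>) powi (int m)) ** R z) $ i $ j) \<zeta>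
         = residue (\<lambda>z. (z - \<zeta>) ^ (m - n) * cofactor (A z) i j / g z) \<zeta>"
      proof (rule residue_cong[OF _ refl])
        show "\<forall>\<^sub>F z in at \<zeta>. (mat ((z - \<zeta>) powi int m) ** R z) $ i $ j
            = (z - \<zeta>) ^ (m - n) * cofactor (A z) i j / g z"
          using eventually_at_in_open[OF S(1,2)]
        proof eventually_elim
          case (elim z)
          have "g z \<noteq> 0" "det (A z) = g z * (z - \<zeta>) ^ n" using fg[of z] elim by (auto simp: S_def n_def)
          moreover have "(z - \<zeta>) ^ m = (z - \<zeta>) ^ (m - n) * (z - \<zeta>) ^ n"
            using that by (simp flip: power_add)
          ultimately show ?case using elim dnz[OF elim]
            by (simp add: mat_scale_nth R_def matrix_inv_cofactor)
        qed
      qed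
      also have "\<dots> = 0"
        using fg g r(1) by (intro residue_holo[of S] holomorphic_intros holomorphic_on_cofactor
            mat_holomorphic_subset[OF Ah S(3)]) (auto simp: S_def)
      finally show ?thesis .
    qed
    then show ?thesis by (simp add: T_def mresidue_def vec_eq_iff)
  qed
  define X where "X = T (-1)"
  \<comment> \<open>\<open>L\<close> is traded for \<open>A0\<close> on the left by
    \<open>T1\<close> and back on the right by \<open>T2\<close>: the product
    \<open>T j ** L ** T (- j - 2)\<close> does not change when \<open>j\<close> increases by
    one.\<close>
  have step: "T (int j) ** L ** T (- int j - 2) = T (int (j + m)) ** L ** T (- int (j + m) - 2)" for j m
  proof (induction m)
    case (Suc m)
    let ?j = "int (j + m)"
    have "T ?j ** L = T (?j + 1) ** A0" using T1[of "?j + 1"] by simp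
    moreover have "A0 ** T (- ?j - 2) = L ** T (- ?j - 3)" using T2[of "- ?j - 2"] by (simp add: algebra_simps)
    ultimately have "T ?j ** L ** T (- ?j - 2) = T (?j + 1) ** L ** T (- ?j - 3)"
      by (metis matrix_mul_assoc)
    then show ?case using Suc by (simp add: algebra_simps)
  qed simp
  \<comment> \<open>After \<open>n\<close> steps the right factor is \<open>T (- n - 2)\<close>,
    which is beyond the principal part and vanishes.\<close>
  have "T 0 ** L ** T (-2) = 0"
    using step[of 0 n] T0[of "n + 1"] by (simp add: algebra_simps)
  moreover have "X ** L = T 0 ** A0 - mat 1" using T1[of 0] by (simp add: X_def)
  moreover have "A0 ** X = L ** T (-2)" using T2[of "-1"] by (simp add: X_def)
  moreover have "(X ** L + mat 1) ** X = X ** L ** X + X"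
    by (simp add: matrix_add_rdistrib)
  ultimately have XLX: "X ** L ** X = - X"
    by (simp add: matrix_mul_assoc[symmetric]) (simp add: matrix_mul_assoc eq_neg_iff_add_eq_0)
  define Q where "Q = - (L ** X)"
  have XQ: "X ** Q = X"
    using XLX by (simp add: Q_def matrix_uminus_right matrix_mul_assoc)
  have Q': "Q = (- L) ** X" by (simp add: Q_def matrix_uminus_left)
  have QQ: "Q ** Q = Q" using XQ by (metis Q' matrix_mul_assoc)
  \<comment> \<open>\<open>X = X ** Q\<close> and \<open>Q = (- L) ** X\<close> each bound one rank
    by the other.\<close>
  have "rank X = rank Q"
    by (metis XQ Q' rank_mult_le_right antisym)
  moreover have "of_nat (rank Q) = trace Q" using trace_idempotent[OF QQ] by simp
  moreover have "trace Q = of_int (zorder (\<lambda>z. det (A z)) \<zeta>)"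
  proof -
    have md: "mderiv A z = - L" if "z \<in> S - {\<zeta>}" for z
    proof -
      have "deriv (\<lambda>w. A w $ i $ j) z = - L $ i $ j" for i j
      proof -
        have "\<forall>\<^sub>F w in nhds z. A w $ i $ j = K $ i $ j - w * L $ i $ j"
        proof -
          have "z \<in> E" using that S(3) by blast
          then show ?thesis
            using eventually_nhds_in_open[OF E(1) \<open>z \<in> E\<close>] by (auto elim!: eventually_mono simp: pencil)
        qed
        then have "deriv (\<lambda>w. A w $ i $ j) z = deriv (\<lambda>w. K $ i $ j - w * L $ i $ j) z"
          by (rule deriv_cong_ev) simp
        also have "\<dots> = - L $ i $ j"
          by (rule DERIV_imp_deriv) (auto intro!: derivative_eq_intros)
        finally show ?thesis .
      qed
      then show ?thesis by (simp add: mderiv_def vec_eq_iff)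
    qed
    have "mresidue (\<lambda>z. matrix_inv (A z) ** mderiv A z) \<zeta> = mresidue (\<lambda>z. R z ** (- L)) \<zeta>"
      by (rule mresidue_cong[OF S(1,2)]) (simp add: md R_def)
    also have "\<dots> = mresidue R \<zeta> ** (- L)" by (rule mresidue_mult_right[OF S(1,2) Rh])
    also have "mresidue R \<zeta> = X" by (simp add: X_def T_def)
    finally have "trace (X ** (- L)) = of_int (zorder (\<lambda>z. det (A z)) \<zeta>)"
      using alg_mult_eq_zorder(2)[OF Ah E nz] by simp
    then show ?thesis unfolding Q' by (subst trace_mul_sym)
  qed
  moreover have "riesz_rank A \<zeta> = rank X" by (simp add: riesz_rank_def X_def T_def R_def[abs_def])
  ultimately have "(of_int (int (riesz_rank A \<zeta>)) :: complex) = of_int (zorder (\<lambda>z. det (A z)) \<zeta>)" by simp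
  then show ?thesis using of_int_eq_iff by blast
qed

section \<open>Bernstein's inequality with slack\<close>

text \<open>The function \<open>(exp x - 1 - x) / x\<^sup>2\<close> has a power series with positive
  coefficients, so for \<open>\<bar>x\<bar> \<le> c\<close> it is at most its value at
  \<open>c\<close>. The proof compares the series termwise, which avoids dividing by
  \<open>x\<close>.\<close>

lemma exp_le_quadratic:
  fixes x c :: real
  assumes "\<bar>x\<bar> \<le> c" "c > 0"
  shows "exp x \<le> 1 + x + x\<^sup>2 * ((exp c - 1 - c) / c\<^sup>2)"
proof -
  let ?a = "\<lambda>n. inverse (fact (n + 2)) :: real"
  have sm: "summable (\<lambda>n. ?a n *\<^sub>R y ^ (n + 2))" for y :: real
    using summable_exp_generic[of y] by (subst summable_iff_shift) (simp add: scaleR_conv_of_real)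
  have ex: "exp y - 1 - y = (\<Sum>n. ?a n *\<^sub>R y ^ (n + 2))" for y :: real
    using exp_first_two_terms[of y] by simp
  have "exp x - 1 - x \<le> (\<Sum>n. x\<^sup>2 / c\<^sup>2 * (?a n *\<^sub>R c ^ (n + 2)))"
    unfolding ex
  proof (rule suminf_le[OF _ sm summable_mult[OF sm]])
    fix n
    have "x ^ n \<le> c ^ n" using assms(1) by (metis abs_ge_self abs_ge_zero order_trans power_abs power_mono)
    then have "x ^ (n + 2) \<le> x\<^sup>2 / c\<^sup>2 * c ^ (n + 2)"
      using assms(2) mult_left_mono[of "x ^ n" "c ^ n" "x\<^sup>2"] by (simp add: power_add mult.commute power2_eq_square)
    then have "?a n * x ^ (n + 2) \<le> ?a n * (x\<^sup>2 / c\<^sup>2 * c ^ (n + 2))"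
      by (intro mult_left_mono) auto
    then show "?a n *\<^sub>R x ^ (n + 2) \<le> x\<^sup>2 / c\<^sup>2 * (?a n *\<^sub>R c ^ (n + 2))"
      by (simp only: real_scaleR_def mult.left_commute)
  qed
  also have "\<dots> = x\<^sup>2 / c\<^sup>2 * (exp c - 1 - c)" unfolding ex by (rule suminf_mult[OF sm])
  finally show ?thesis by simp
qed

text \<open>The strict form of the usual estimate of \<open>exp x - 1 - x\<close> by
  \<open>x\<^sup>2 / (2 * (1 - x / 3))\<close>, kept free of the division so that no bound
  \<open>x < 3\<close> arises. The difference \<open>h\<close> of the two sides vanishes at
  \<open>0\<close> together with its first derivative \<open>h'\<close>, and the second derivative
  is \<open>2 / 3 * (1 + (u - 1) * exp u)\<close>, which is positive since its own bracket increases
  from \<open>0\<close>.\<close>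

lemma bernstein_strict:
  fixes x :: real
  assumes "x > 0"
  shows "2 * (1 - x / 3) * (exp x - 1 - x) < x\<^sup>2"
proof -
  have 3: "1 + (t - 1) * exp t > 0" if "t > 0" for t :: real
  proof -
    have "1 + (0 - 1) * exp 0 < 1 + (t - 1) * exp t"
    proof (rule DERIV_pos_imp_increasing_open[OF that])
      fix u :: real assume "0 < u" "u < t"
      have "((\<lambda>t. 1 + (t - 1) * exp t) has_field_derivative u * exp u) (at u)"
        by (auto intro!: derivative_eq_intros simp: algebra_simps)
      then show "\<exists>y. ((\<lambda>t. 1 + (t - 1) * exp t) has_field_derivative y) (at u) \<and> y > 0"
        using \<open>0 < u\<close> by auto
    qed (auto intro!: continuous_intros)
    then show ?thesis by simp
  qed
  define h' where "h' t = 2 * t - 2 * (1 - t / 3) * (exp t - 1) + 2 / 3 * (exp t - 1 - t)" for t :: real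
  have 2: "h' t > 0" if "t > 0" for t
  proof -
    have "h' 0 < h' t"
    proof (rule DERIV_pos_imp_increasing_open[OF that])
      fix u :: real assume "0 < u" "u < t"
      have "(h' has_field_derivative 2 / 3 * (1 + (u - 1) * exp u)) (at u)"
        unfolding h'_def by (auto intro!: derivative_eq_intros simp: field_simps)
      then show "\<exists>y. (h' has_field_derivative y) (at u) \<and> y > 0"
        using 3[OF \<open>0 < u\<close>] by (intro exI[of _ "2 / 3 * (1 + (u - 1) * exp u)"]) auto
    qed (auto intro!: continuous_intros simp: h'_def)
    then show ?thesis by (simp add: h'_def)
  qed
  define h where "h t = t\<^sup>2 - 2 * (1 - t / 3) * (exp t - 1 - t)" for t :: real
  have "h 0 < h x"
  proof (rule DERIV_pos_imp_increasing_open[OF assms])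
    fix u :: real assume "0 < u" "u < x"
    have "(h has_field_derivative h' u) (at u)"
      unfolding h_def h'_def by (auto intro!: derivative_eq_intros simp: field_simps)
    then show "\<exists>y. (h has_field_derivative y) (at u) \<and> y > 0" using 2[OF \<open>0 < u\<close>] by auto
  qed (auto intro!: continuous_intros simp: h_def)
  then show ?thesis by (simp add: h_def)
qed

text \<open>At \<open>R = R0\<close> and \<open>\<eta> = 0\<close> the exponent exceeds the target
  strictly by \<open>bernstein_strict\<close>; continuity in \<open>R\<close> and in
  \<open>\<eta>\<close> leaves room for both perturbations.\<close>

lemma bernstein_slack:
  fixes P R0 :: real
  assumes "P > 0" "R0 > 0"
  obtains R \<eta> s where "R > R0" "0 < \<eta>" "\<eta> < 1" "s > 0"
    "s * (1 - \<eta>) - 1 / P * ((exp (s * R) - 1 - s * R) / R\<^sup>2) \<ge> 1 / (1 + P * R0 / 3) * (P / 2)"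
proof -
  \<comment> \<open>The parameter of the classical proof of Bernstein's inequality. It solves
    \<open>1 - s * R0 / 3 = s / P\<close>, which is how \<open>bernstein_strict\<close> at
    \<open>x = s * R0\<close> becomes a bound involving \<open>1 / P\<close>; the target rate is
    \<open>s / 2\<close>.\<close>
  define s where "s = P / (1 + P * R0 / 3)"
  have pos: "1 + P * R0 / 3 > 0" using assms by (simp add: add_pos_pos)
  have s: "s > 0" unfolding s_def using pos assms by simp
  have b: "1 / (1 + P * R0 / 3) * (P / 2) = s / 2" by (simp add: s_def)
  define g where "g R = s - 1 / P * ((exp (s * R) - 1 - s * R) / R\<^sup>2)" for R
  have "1 - s * R0 / 3 = s / P"
  proof -
    define d where "d = 1 + P * R0 / 3"
    have "d > 0" using pos by (simp add: d_def)
    then have "1 - P / d * R0 / 3 = (d - P * R0 / 3) / d" by (simp add: field_simps)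
    also have "\<dots> = P / d / P" using assms by (simp add: d_def)
    finally have "1 - P / d * R0 / 3 = P / d / P" .
    then show ?thesis by (simp add: s_def d_def)
  qed
  then have "2 * (s / P) * (exp (s * R0) - 1 - s * R0) < (s * R0)\<^sup>2"
    using bernstein_strict[of "s * R0"] s assms by simp
  then have "s * (2 / P * (exp (s * R0) - 1 - s * R0)) < s * (s * R0\<^sup>2)"
    by (simp add: power2_eq_square mult_ac)
  then have "2 / P * (exp (s * R0) - 1 - s * R0) < s * R0\<^sup>2"
    using s by (simp only: mult_less_cancel_left_pos)
  then have "1 / P * (exp (s * R0) - 1 - s * R0) < s / 2 * R0\<^sup>2" by (simp add: algebra_simps add_divide_distrib)
  then have "g R0 > s / 2" using assms by (simp add: g_def field_simps)
  moreover have "isCont g R0" unfolding g_def using assms by (intro continuous_intros) auto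
  ultimately have "\<forall>\<^sub>F R in at R0. g R > s / 2"
    using order_tendstoD(1)[of g "g R0" "at R0" "s / 2"] by (simp add: isCont_def)
  then have "\<forall>\<^sub>F R in at_right R0. g R > s / 2" by (simp add: eventually_at_split)
  then have "\<forall>\<^sub>F R in at_right R0. g R > s / 2 \<and> R > R0"
    using eventually_at_right_less by eventually_elim auto
  then obtain R where R: "g R > s / 2" "R > R0" using eventually_happens'[OF trivial_limit_at_right_real] by blast
  \<comment> \<open>Lowering the threshold by \<open>\<eta>\<close> costs \<open>s * \<eta>\<close>,
    which the surplus \<open>g R - s / 2\<close> has to pay; the cap \<open>1/2\<close> keeps
    \<open>\<eta>\<close> below \<open>1\<close>.\<close>
  define \<eta> where "\<eta> = min (1/2) ((g R - s / 2) / s)"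
  have "\<eta> > 0" "\<eta> < 1" using R s by (auto simp: \<eta>_def)
  moreover have "s * (1 - \<eta>) - 1 / P * ((exp (s * R) - 1 - s * R) / R\<^sup>2) \<ge> s / 2"
  proof -
    have "\<eta> * s \<le> g R - s / 2" using s by (simp add: \<eta>_def flip: pos_le_divide_eq)
    moreover define \<phi> where "\<phi> = 1 / P * ((exp (s * R) - 1 - s * R) / R\<^sup>2)"
    moreover have "g R = s - \<phi>" by (simp add: g_def \<phi>_def)
    moreover have "s * (1 - \<eta>) = s - \<eta> * s" by (simp add: algebra_simps)
    ultimately have "s * (1 - \<eta>) - \<phi> \<ge> s / 2" by linarith
    then show ?thesis by (simp only: \<phi>_def)
  qed
  ultimately show ?thesis using that R(2) s b by metis
qed

text \<open>The exponential Markov inequality with \<open>s\<close> left free, because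
  \<open>s\<close> is fixed by the slack argument and not by optimising here. The size bound is only
  almost sure, since it will come from an essential supremum.\<close>

lemma (in prob_space) bernstein_chernoff:
  fixes Y :: "nat \<Rightarrow> 'a \<Rightarrow> real"
  assumes indep: "indep_vars (\<lambda>_. borel) Y I" and I: "finite I"
    and bnd: "\<And>i. i \<in> I \<Longrightarrow> AE \<omega> in M. \<bar>Y i \<omega>\<bar> \<le> R"
    and mean: "\<And>i. i \<in> I \<Longrightarrow> expectation (Y i) = 0"
    and var: "\<And>i. i \<in> I \<Longrightarrow> expectation (\<lambda>\<omega>. (Y i \<omega>)\<^sup>2) \<le> v"
    and R: "R > 0" and s: "s > 0" 
  shows "prob {\<omega> \<in> space M. real (card I) * a \<le> (\<Sum>i\<in>I. Y i \<omega>)}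
     \<le> exp (- (s * a - v * ((exp (s * R) - 1 - s * R) / R\<^sup>2)) * real (card I))"
proof -
  have rv[measurable]: "i \<in> I \<Longrightarrow> Y i \<in> borel_measurable M" for i
    using indep by (auto simp: indep_vars_def)
  define \<phi> where "\<phi> = (exp (s * R) - 1 - s * R) / R\<^sup>2"
  have \<phi>: "\<phi> \<ge> 0" 
  proof -
    have "1 + s * R \<le> exp (s * R)" by (rule exp_ge_add_one_self)
    then have "0 \<le> exp (s * R) - 1 - s * R" by linarith
    then show ?thesis by (simp add: \<phi>_def)
  qed
  have int: "integrable M (Y i)" "integrable M (\<lambda>\<omega>. (Y i \<omega>)\<^sup>2)" "integrable M (\<lambda>\<omega>. exp (s * Y i \<omega>))"
    if "i \<in> I" for i
  proof -
    note [measurable] = rv[OF that]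
    show "integrable M (Y i)"
      by (rule integrable_const_bound[of _ R]) (use bnd[OF that] in auto)
    show "integrable M (\<lambda>\<omega>. (Y i \<omega>)\<^sup>2)"
      by (rule integrable_const_bound[of _ "R\<^sup>2"])
        (use bnd[OF that] R in \<open>auto elim!: eventually_mono simp: abs_le_square_iff[symmetric]\<close>)
    show "integrable M (\<lambda>\<omega>. exp (s * Y i \<omega>))"
      by (rule integrable_const_bound[of _ "exp (s * R)"]) (use bnd[OF that] s in \<open>auto elim!: eventually_mono\<close>)
  qed
  have mgf: "expectation (\<lambda>\<omega>. exp (s * Y i \<omega>)) \<le> exp (v * \<phi>)" if i: "i \<in> I" for i
  proof -
    have "expectation (\<lambda>\<omega>. exp (s * Y i \<omega>)) \<le> expectation (\<lambda>\<omega>. 1 + s * Y i \<omega> + (Y i \<omega>)\<^sup>2 * \<phi>)"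
    proof (rule integral_mono_AE)
      show "AE \<omega> in M. exp (s * Y i \<omega>) \<le> 1 + s * Y i \<omega> + (Y i \<omega>)\<^sup>2 * \<phi>"
        using bnd[OF i]
      proof eventually_elim
        case (elim \<omega>)
        have "\<bar>s * Y i \<omega>\<bar> \<le> s * R" using elim s by (simp add: abs_mult)
        from exp_le_quadratic[OF this] R s show ?case
          by (simp add: \<phi>_def power_mult_distrib)
      qed
    qed (use int[OF i] in auto)
    also have "\<dots> = 1 + expectation (\<lambda>\<omega>. (Y i \<omega>)\<^sup>2) * \<phi>"
      using int[OF i] mean[OF i] by (simp add: prob_space)
    also have "\<dots> \<le> 1 + v * \<phi>" using var[OF i] \<phi> by (intro add_left_mono mult_right_mono)
    also have "\<dots> \<le> exp (v * \<phi>)" by (rule exp_ge_add_one_self)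
    finally show ?thesis .
  qed
  let ?Z = "\<lambda>\<omega>. \<Prod>i\<in>I. exp (s * Y i \<omega>)"
  have indE: "indep_vars (\<lambda>_. borel) (\<lambda>i \<omega>. exp (s * Y i \<omega>)) I"
    by (rule indep_vars_compose2[OF indep, of "\<lambda>_ y. exp (s * y)"]) auto
  have Zint: "integrable M ?Z" by (rule indep_vars_integrable[OF I indE int(3)])
  have Z: "expectation ?Z = (\<Prod>i\<in>I. expectation (\<lambda>\<omega>. exp (s * Y i \<omega>)))"
    by (rule indep_vars_lebesgue_integral[OF I indE int(3)])
  have "\<dots> \<le> (\<Prod>i\<in>I. exp (v * \<phi>))" by (intro prod_mono) (auto intro: mgf)
  then have Zle: "expectation ?Z \<le> exp (v * \<phi> * real (card I))"
    using Z by (simp add: exp_of_nat_mult[symmetric] mult.commute)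
  let ?c = "exp (s * (real (card I) * a))"
  have "{\<omega> \<in> space M. real (card I) * a \<le> (\<Sum>i\<in>I. Y i \<omega>)} = {\<omega> \<in> space M. ?c \<le> ?Z \<omega>}"
    using s by (auto simp: exp_sum[OF I, symmetric] sum_distrib_left[symmetric])
  also have "prob \<dots> \<le> expectation ?Z / ?c"
    using Zint by (intro integral_Markov_inequality_measure[of M ?Z "{}"]) (auto intro!: prod_nonneg)
  also have "\<dots> \<le> exp (v * \<phi> * real (card I)) / ?c" using Zle by (simp add: divide_right_mono)
  also have "\<dots> = exp (- (s * a - v * \<phi>) * real (card I))"
    by (simp add: exp_diff[symmetric] algebra_simps)
  finally show ?thesis unfolding \<phi>_def .
qed

text \<open>Quantifying over all families inside the predicate lets \<open>R\<close> and
  \<open>\<eta>\<close> be fixed before the covering argument produces the variables to which the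
  bound is applied.\<close>

definition (in prob_space) uniform_tail_bound :: "real \<Rightarrow> real \<Rightarrow> real \<Rightarrow> real \<Rightarrow> bool" where
  "uniform_tail_bound R v a b \<longleftrightarrow> (\<forall>(Y :: nat \<Rightarrow> 'a \<Rightarrow> real) I.
     indep_vars (\<lambda>_. borel) Y I \<and> finite I \<and> I \<noteq> {} \<and>
     (\<forall>i\<in>I. (AE \<omega> in M. \<bar>Y i \<omega>\<bar> \<le> R) \<and> expectation (Y i) = 0 \<and> expectation (\<lambda>\<omega>. (Y i \<omega>)\<^sup>2) \<le> v) \<longrightarrow>
     prob {\<omega> \<in> space M. real (card I) * a \<le> (\<Sum>i\<in>I. Y i \<omega>)} \<le> exp (- (b * real (card I))))"

text \<open>For \<open>R0 = 0\<close> the strict inequality behind \<open>bernstein_slack\<close> degenerates, but then \<open>R\<close> may be chosen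
  so small that the event is null.\<close>

lemma (in prob_space) bernstein_tail:
  fixes P R0 :: real
  assumes "P > 0" "R0 \<ge> 0"
  obtains R \<eta> where "R > R0" "0 < \<eta>" "\<eta> < 1"
    "uniform_tail_bound R (1 / P) (1 - \<eta>) (1 / (1 + P * R0 / 3) * (P / 2))"
proof (cases "R0 = 0")
  case True
  \<comment> \<open>An average of variables bounded by \<open>1/2\<close> cannot reach the threshold
    \<open>1 - 1/4\<close>.\<close>
  show ?thesis
  proof (rule that[of "1/2" "1/4"])
    show "uniform_tail_bound (1/2) (1 / P) (1 - 1/4) (1 / (1 + P * R0 / 3) * (P / 2))"
      unfolding uniform_tail_bound_def
    proof (intro allI impI)
      fix Y :: "nat \<Rightarrow> 'a \<Rightarrow> real" and I
      assume H: "indep_vars (\<lambda>_. borel) Y I \<and> finite I \<and> I \<noteq> {} \<and> (\<forall>i\<in>I. (AE \<omega> in M. \<bar>Y i \<omega>\<bar> \<le> 1/2) \<and>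
        expectation (Y i) = 0 \<and> expectation (\<lambda>\<omega>. (Y i \<omega>)\<^sup>2) \<le> 1 / P)"
      then have "AE \<omega> in M. \<forall>i\<in>I. \<bar>Y i \<omega>\<bar> \<le> 1/2" by (simp add: AE_finite_all)
      then have "AE \<omega> in M. \<not> (real (card I) * (1 - 1/4) \<le> (\<Sum>i\<in>I. Y i \<omega>))"
      proof eventually_elim
        case (elim \<omega>)
        have "(\<Sum>i\<in>I. Y i \<omega>) \<le> (\<Sum>i\<in>I. 1/2)" using elim by (intro sum_mono) force
        moreover have "card I > 0" using H by (simp add: card_gt_0_iff)
        ultimately show ?case by (simp add: not_le)
      qed
      then have "prob {\<omega> \<in> space M. real (card I) * (1 - 1/4) \<le> (\<Sum>i\<in>I. Y i \<omega>)} = 0"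
      proof (subst prob_eq_0)
        have "i \<in> I \<Longrightarrow> Y i \<in> borel_measurable M" for i using H by (auto simp: indep_vars_def)
        then have [measurable]: "(\<lambda>\<omega>. \<Sum>i\<in>I. Y i \<omega>) \<in> borel_measurable M" by measurable
        show "{\<omega> \<in> space M. real (card I) * (1 - 1/4) \<le> (\<Sum>i\<in>I. Y i \<omega>)} \<in> events" by measurable
      qed auto
      then show "prob {\<omega> \<in> space M. real (card I) * (1 - 1/4) \<le> (\<Sum>i\<in>I. Y i \<omega>)}
          \<le> exp (- (1 / (1 + P * R0 / 3) * (P / 2) * real (card I)))" by simp
    qed
  qed (use True in auto)
next
  case False
  then have "R0 > 0" using assms by simp
  obtain R \<eta> s where *: "R > R0" "0 < \<eta>" "\<eta> < 1" "s > 0"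
    "s * (1 - \<eta>) - 1 / P * ((exp (s * R) - 1 - s * R) / R\<^sup>2) \<ge> 1 / (1 + P * R0 / 3) * (P / 2)"
    by (rule bernstein_slack[OF assms(1) \<open>R0 > 0\<close>])
  show ?thesis
  proof (rule that[OF *(1-3)])
    show "uniform_tail_bound R (1 / P) (1 - \<eta>) (1 / (1 + P * R0 / 3) * (P / 2))"
      unfolding uniform_tail_bound_def
    proof (intro allI impI)
      fix Y :: "nat \<Rightarrow> 'a \<Rightarrow> real" and I
      assume H: "indep_vars (\<lambda>_. borel) Y I \<and> finite I \<and> I \<noteq> {} \<and> (\<forall>i\<in>I. (AE \<omega> in M. \<bar>Y i \<omega>\<bar> \<le> R) \<and>
        expectation (Y i) = 0 \<and> expectation (\<lambda>\<omega>. (Y i \<omega>)\<^sup>2) \<le> 1 / P)"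
      have "R > 0" using * assms by simp
      have "prob {\<omega> \<in> space M. real (card I) * (1 - \<eta>) \<le> (\<Sum>i\<in>I. Y i \<omega>)}
         \<le> exp (- (s * (1 - \<eta>) - 1 / P * ((exp (s * R) - 1 - s * R) / R\<^sup>2)) * real (card I))"
        by (rule bernstein_chernoff[OF _ _ _ _ _ \<open>R > 0\<close> *(4)]) (use H in auto)
      also have "exp (- (s * (1 - \<eta>) - 1 / P * ((exp (s * R) - 1 - s * R) / R\<^sup>2)) * real (card I))
         \<le> exp (- (1 / (1 + P * R0 / 3) * (P / 2) * real (card I)))"
        using mult_right_mono[OF *(5), of "real (card I)"]
        by (simp only: exp_le_cancel_iff mult_minus_left neg_le_iff_le of_nat_0_le_iff)
      finally show "prob {\<omega> \<in> space M. real (card I) * (1 - \<eta>) \<le> (\<Sum>i\<in>I. Y i \<omega>)}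
          \<le> exp (- (1 / (1 + P * R0 / 3) * (P / 2) * real (card I)))" .
    qed
  qed
qed

section \<open>Hermitian forms\<close>

definition sesq :: "complex^'n^'n \<Rightarrow> complex^'n \<Rightarrow> complex^'n \<Rightarrow> complex" where
  "sesq Q u v = (\<Sum>i\<in>UNIV. cnj (u $ i) * (Q *v v) $ i)"

lemma scaleR_conv_smult: "r *\<^sub>R (v :: complex^'n) = complex_of_real r *s v"
  by (simp only: vec_eq_iff vector_smult_component vector_scaleR_component)
    (simp add: scaleR_conv_of_real)

lemma hform_eq_sesq: "hform Q v = sesq Q v v"
  by (simp add: hform_def sesq_def matrix_vector_mult_def sum_distrib_left mult.assoc)

lemma sesq_add_right: "sesq Q u (v + w) = sesq Q u v + sesq Q u w"
  by (simp add: sesq_def matrix_vector_right_distrib distrib_left sum.distrib)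

lemma sesq_diff_right: "sesq Q u (v - w) = sesq Q u v - sesq Q u w"
  by (simp add: sesq_def matrix_vector_mult_diff_distrib right_diff_distrib sum_subtractf)

lemma sesq_add_left: "sesq Q (u + v) w = sesq Q u w + sesq Q v w"
  by (simp add: sesq_def distrib_right sum.distrib)

lemma sesq_diff_left: "sesq Q (u - v) w = sesq Q u w - sesq Q v w"
  by (simp add: sesq_def left_diff_distrib sum_subtractf)

lemma sesq_scale_right: "sesq Q u (c *s v) = c * sesq Q u v"
  by (simp add: sesq_def vector_scalar_commute sum_distrib_left mult.left_commute)

lemma sesq_scale_left: "sesq Q (c *s u) v = cnj c * sesq Q u v"
  by (simp add: sesq_def sum_distrib_left mult.assoc)

lemma sesq_sum_right: "sesq Q u (\<Sum>i\<in>I. v i) = (\<Sum>i\<in>I. sesq Q u (v i))"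
proof (induction I rule: infinite_finite_induct)
  case empty
  then show ?case by (simp add: sesq_def)
qed (simp_all add: sesq_add_right, simp add: sesq_def)

lemma sesq_adj: "sesq Q (A *v u) v = sesq (adj A ** Q) u v"
proof -
  have adjA: "(adj A *v w) $ k = (\<Sum>i\<in>UNIV. cnj (A $ i $ k) * w $ i)" for w k
    by (simp add: matrix_vector_mult_def adj_def)
  have "sesq Q (A *v u) v = (\<Sum>i\<in>UNIV. \<Sum>k\<in>UNIV. cnj (A $ i $ k) * cnj (u $ k) * (Q *v v) $ i)"
    by (simp add: sesq_def matrix_vector_mult_def[of A] sum_distrib_right)
  also have "\<dots> = (\<Sum>k\<in>UNIV. \<Sum>i\<in>UNIV. cnj (A $ i $ k) * cnj (u $ k) * (Q *v v) $ i)"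
    by (rule sum.swap)
  also have "\<dots> = (\<Sum>k\<in>UNIV. cnj (u $ k) * (adj A *v (Q *v v)) $ k)"
    by (simp add: adjA sum_distrib_left mult_ac)
  finally show ?thesis by (simp add: sesq_def matrix_vector_mul_assoc)
qed

lemma sesq_mult: "sesq Q u (A *v v) = sesq (Q ** A) u v"
  by (simp add: sesq_def matrix_vector_mul_assoc)

lemma hform_mult: "hform Q (A *v v) = hform (adj A ** Q ** A) v"
  by (simp add: hform_eq_sesq sesq_adj sesq_mult matrix_mul_assoc)

lemma adj_adj [simp]: "adj (adj A) = A" by (simp add: adj_def vec_eq_iff)

lemma adj_mult: "adj (A ** B) = adj B ** adj A"
  by (simp add: adj_def vec_eq_iff matrix_matrix_mult_def mult.commute)

lemma adj_mat_1 [simp]: "adj (mat 1) = mat 1" by (simp add: adj_def vec_eq_iff mat_def)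

lemma sesq_hermitian:
  assumes "adj Q = Q"
  shows "cnj (sesq Q u v) = sesq Q v u"
proof -
  have Q: "cnj (Q $ i $ j) = Q $ j $ i" for i j
    using arg_cong[OF assms, of "\<lambda>A. A $ j $ i"] by (simp add: adj_def)
  have "cnj (sesq Q u v) = (\<Sum>i\<in>UNIV. \<Sum>j\<in>UNIV. u $ i * (Q $ j $ i * cnj (v $ j)))"
    by (simp add: sesq_def matrix_vector_mult_def sum_distrib_left Q)
  also have "\<dots> = (\<Sum>j\<in>UNIV. \<Sum>i\<in>UNIV. u $ i * (Q $ j $ i * cnj (v $ j)))" by (rule sum.swap)
  also have "\<dots> = sesq Q v u"
    by (simp add: sesq_def matrix_vector_mult_def sum_distrib_left mult_ac)
  finally show ?thesis .
qed

lemma hform_Re: "adj Q = Q \<Longrightarrow> hform Q v = of_real (Re (hform Q v))"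
  using sesq_hermitian[of Q v v] by (simp add: hform_eq_sesq complex_eq_iff)

lemma hform_0 [simp]: "hform Q 0 = 0" by (simp add: hform_def)

lemma posdef_nonneg: "posdef Q \<Longrightarrow> 0 \<le> Re (hform Q v)"
  by (cases "v = 0") (auto simp: posdef_def intro: less_imp_le)

text \<open>Expanding \<open>0 \<le> Re (hform Q (v - c u))\<close> at the minimizing \<open>c\<close>.\<close>

lemma posdef_cauchy_schwarz_sq:
  assumes "posdef Q"
  shows "(cmod (sesq Q u v))\<^sup>2 \<le> Re (hform Q u) * Re (hform Q v)"
proof (cases "u = 0")
  case True
  then show ?thesis by (simp add: sesq_def)
next
  case False
  have herm: "adj Q = Q" using assms by (simp add: posdef_def)
  define a where "a = Re (hform Q u)"
  have a: "a > 0" "sesq Q u u = of_real a"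
    using False assms hform_Re[OF herm, of u] by (auto simp: a_def posdef_def hform_eq_sesq)
  define c where "c = sesq Q u v / of_real a"
  have cc: "cnj c * sesq Q u v = of_real ((cmod (sesq Q u v))\<^sup>2 / a)"
    using complex_norm_square[of "sesq Q u v"] by (simp add: c_def mult.commute)
  have "hform Q (v - c *s u) = sesq Q v v - c * sesq Q v u - (cnj c * sesq Q u v - cnj c * c * sesq Q u u)"
    by (simp add: hform_eq_sesq sesq_diff_left sesq_diff_right sesq_scale_left sesq_scale_right
        right_diff_distrib mult_ac)
  also have "cnj c * c * sesq Q u u = cnj c * sesq Q u v" using a by (simp add: c_def)
  also have "c * sesq Q v u = cnj (cnj c * sesq Q u v)"
    using sesq_hermitian[OF herm, of u v] by simp
  finally have "hform Q (v - c *s u) = hform Q v - of_real ((cmod (sesq Q u v))\<^sup>2 / a)"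
    by (simp only: cc complex_cnj_complex_of_real hform_eq_sesq) simp
  then have "0 \<le> Re (hform Q v) - (cmod (sesq Q u v))\<^sup>2 / a"
    using posdef_nonneg[OF assms, of "v - c *s u"] by simp
  then show ?thesis using a by (simp add: a_def field_simps)
qed

lemma posdef_cauchy_schwarz:
  assumes "posdef Q"
  shows "cmod (sesq Q u v) \<le> qnorm Q u * qnorm Q v"
  using posdef_cauchy_schwarz_sq[OF assms, of u v] unfolding qnorm_def
  by (simp flip: real_sqrt_mult add: real_le_rsqrt)

lemma continuous_on_hform: "continuous_on S (\<lambda>v. hform Q v)"
  unfolding hform_def by (intro continuous_intros)

text \<open>The minimum of the form over the compact unit sphere is positive, and homogeneity of
  degree two carries it to all vectors.\<close>

lemma posdef_lower_bound:
  fixes Q :: "complex^'n^'n"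
  assumes "posdef Q"
  obtains m where "m > 0" "\<And>v. m * (norm v)\<^sup>2 \<le> Re (hform Q v)"
proof -
  have "continuous_on (sphere 0 1) (\<lambda>v. Re (hform Q v))"
    by (intro continuous_intros continuous_on_hform)
  moreover have "sphere (0 :: complex^'n) 1 \<noteq> {}"
    using vector_choose_size[of 1, where 'a = "complex^'n"] by (metis empty_iff mem_sphere_0 zero_le_one)
  ultimately obtain w :: "complex^'n"
    where w: "w \<in> sphere 0 1" "\<And>v. v \<in> sphere 0 1 \<Longrightarrow> Re (hform Q w) \<le> Re (hform Q v)"
    using continuous_attains_inf[OF compact_sphere] by blast
  have "w \<noteq> 0" using w(1) by auto
  then have "Re (hform Q w) > 0" using assms by (auto simp: posdef_def)
  moreover have "Re (hform Q w) * (norm v)\<^sup>2 \<le> Re (hform Q v)" for v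
  proof (cases "v = 0")
    case False
    let ?u = "complex_of_real (inverse (norm v)) *s v"
    have "?u = inverse (norm v) *\<^sub>R v" by (rule scaleR_conv_smult[symmetric])
    then have "?u \<in> sphere 0 1" using False by simp
    from w(2)[OF this] have "Re (hform Q w) \<le> (inverse (norm v))\<^sup>2 * Re (hform Q v)"
      unfolding hform_eq_sesq sesq_scale_left sesq_scale_right
      by (simp add: power2_eq_square mult.assoc flip: of_real_inverse)
    then show ?thesis using False by (simp add: field_simps power2_eq_square)
  qed simp
  ultimately show ?thesis using that by blast
qed

lemma invertible_posdef: "posdef Q \<Longrightarrow> det Q \<noteq> 0"
  using det_eq_0_iff_kernel[of Q] by (force simp: posdef_def hform_eq_sesq sesq_def)

text \<open>The value of the inverse form at \<open>v\<close> is the value of \<open>Q\<close> at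
  \<open>matrix_inv Q *v v\<close>.\<close>

lemma posdef_matrix_inv:
  assumes "posdef Q"
  shows "posdef (matrix_inv Q)"
proof -
  let ?I = "matrix_inv Q"
  have inv: "Q ** ?I = mat 1" "?I ** Q = mat 1"
    using invertible_posdef[OF assms] invertible_det_nz matrix_inv_left_right by blast+
  have herm: "adj Q = Q" using assms by (simp add: posdef_def)
  have "adj ?I ** Q = mat 1" using inv(1) herm adj_mult[of Q ?I] by simp
  then have hI: "adj ?I = ?I" using matrix_inv_unique[of "adj ?I" Q] by simp
  have "Re (hform ?I v) > 0" if "v \<noteq> 0" for v
  proof -
    have "?I *v v \<noteq> 0"
      using that by (metis inv(1) matrix_vector_mul_assoc matrix_vector_mul_lid matrix_vector_mult_0_right)
    then have "Re (hform Q (?I *v v)) > 0" using assms by (simp add: posdef_def)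
    then show ?thesis by (simp add: hform_mult hI inv)
  qed
  then show ?thesis using hI by (simp add: posdef_def)
qed

text \<open>An auxiliary submultiplicative norm, invariant under \<open>adj\<close> and controlled
  directly by bounds on the entries. It serves for estimates in which the size of the constant does
  not matter, never for the sharp exponent.\<close>

definition l1norm :: "complex^'n^'n \<Rightarrow> real" where
  "l1norm A = (\<Sum>i\<in>UNIV. \<Sum>j\<in>UNIV. cmod (A $ i $ j))"

lemma l1norm_nonneg: "0 \<le> l1norm A"
  unfolding l1norm_def by (intro sum_nonneg norm_ge_zero)

lemma l1norm_triangle: "l1norm (A + B) \<le> l1norm A + l1norm B"
  unfolding l1norm_def sum.distrib[symmetric] by (intro sum_mono) (simp add: norm_triangle_ineq)

lemma l1norm_adj: "l1norm (adj A) = l1norm A"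
  unfolding l1norm_def adj_def by (subst sum.swap) simp

lemma l1norm_minus: "l1norm (- A) = l1norm A"
  by (simp add: l1norm_def)

lemma norm_mult_vec_le: "norm (A *v v) \<le> l1norm A * norm v"
proof -
  have "norm (A *v v) \<le> (\<Sum>i\<in>UNIV. cmod ((A *v v) $ i))"
    unfolding norm_vec_def by (rule L2_set_le_sum) simp
  also have "\<dots> \<le> (\<Sum>i\<in>UNIV. \<Sum>j\<in>UNIV. cmod (A $ i $ j) * norm v)"
  proof (rule sum_mono)
    fix i
    have "cmod ((A *v v) $ i) \<le> (\<Sum>j\<in>UNIV. cmod (A $ i $ j * v $ j))"
      by (simp add: matrix_vector_mult_def norm_sum)
    also have "\<dots> \<le> (\<Sum>j\<in>UNIV. cmod (A $ i $ j) * norm v)"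
      by (intro sum_mono) (simp add: norm_mult mult_left_mono Finite_Cartesian_Product.norm_nth_le)
    finally show "cmod ((A *v v) $ i) \<le> (\<Sum>j\<in>UNIV. cmod (A $ i $ j) * norm v)" .
  qed
  finally show ?thesis by (simp add: l1norm_def sum_distrib_right)
qed

lemma norm_sesq_le: "cmod (sesq Q u v) \<le> real CARD('n) * l1norm Q * norm u * norm (v :: complex^'n)"
proof -
  have "cmod (sesq Q u v) \<le> (\<Sum>i\<in>UNIV. cmod (cnj (u $ i) * (Q *v v) $ i))"
    unfolding sesq_def by (rule norm_sum)
  also have "\<dots> \<le> (\<Sum>i\<in>(UNIV::'n set). norm u * (l1norm Q * norm v))"
    by (intro sum_mono) (auto simp: norm_mult intro!: mult_mono Finite_Cartesian_Product.norm_nth_le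
        order_trans[OF Finite_Cartesian_Product.norm_nth_le norm_mult_vec_le])
  finally show ?thesis by (simp add: mult_ac)
qed

lemma l1norm_mult: "l1norm (A ** B) \<le> l1norm A * l1norm B"
proof -
  have "l1norm (A ** B) \<le> (\<Sum>i\<in>UNIV. \<Sum>j\<in>UNIV. \<Sum>k\<in>UNIV. cmod (A $ i $ k) * cmod (B $ k $ j))"
    unfolding l1norm_def matrix_matrix_mult_def
    by (intro sum_mono) (auto intro!: order_trans[OF norm_sum] sum_mono simp: norm_mult)
  also have "\<dots> \<le> (\<Sum>i\<in>UNIV. \<Sum>j\<in>UNIV. \<Sum>k\<in>UNIV. cmod (A $ i $ k) * (\<Sum>l\<in>UNIV. cmod (B $ l $ j)))"
    by (intro sum_mono mult_left_mono) (auto intro!: member_le_sum)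
  also have "\<dots> = (\<Sum>i\<in>UNIV. (\<Sum>k\<in>UNIV. cmod (A $ i $ k)) * (\<Sum>j\<in>UNIV. \<Sum>l\<in>UNIV. cmod (B $ l $ j)))"
  proof (rule sum.cong[OF refl])
    fix i
    show "(\<Sum>j\<in>UNIV. \<Sum>k\<in>UNIV. cmod (A $ i $ k) * (\<Sum>l\<in>UNIV. cmod (B $ l $ j)))
        = (\<Sum>k\<in>UNIV. cmod (A $ i $ k)) * (\<Sum>j\<in>UNIV. \<Sum>l\<in>UNIV. cmod (B $ l $ j))"
      unfolding sum_product by (rule sum.swap)
  qed
  also have "\<dots> = l1norm A * (\<Sum>j\<in>UNIV. \<Sum>l\<in>UNIV. cmod (B $ l $ j))"
    by (simp add: sum_distrib_right l1norm_def)
  also have "(\<Sum>j\<in>UNIV. \<Sum>l\<in>UNIV. cmod (B $ l $ j)) = l1norm B"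
    unfolding l1norm_def by (rule sum.swap)
  finally show ?thesis .
qed

lemma l1norm_le_norm: "l1norm (A :: complex^'n^'n) \<le> (real CARD('n))\<^sup>2 * norm A"
proof -
  have "l1norm A \<le> (\<Sum>i\<in>(UNIV::'n set). \<Sum>j\<in>(UNIV::'n set). norm A)"
    unfolding l1norm_def by (intro sum_mono) (meson Finite_Cartesian_Product.norm_nth_le order_trans)
  then show ?thesis by (simp add: power2_eq_square)
qed

lemma norm_hform_le: "cmod (hform Q v) \<le> real CARD('n) * l1norm Q * (norm (v :: complex^'n))\<^sup>2"
  using norm_sesq_le[of Q v v] by (simp add: hform_eq_sesq power2_eq_square mult_ac)

lemma norm_hform_add_diff_le:
  fixes a d :: "complex^'n"
  shows "cmod (hform Q (a + d) - hform Q a) \<le> real CARD('n) * l1norm Q * (norm d * (2 * norm a + norm d))"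
proof -
  have "hform Q (a + d) - hform Q a = sesq Q a d + sesq Q d a + sesq Q d d"
    by (simp add: hform_eq_sesq sesq_add_left sesq_add_right)
  also have "cmod \<dots> \<le> cmod (sesq Q a d) + cmod (sesq Q d a) + cmod (sesq Q d d)"
    by (meson add_right_mono norm_triangle_ineq order_trans)
  also have "\<dots> \<le> real CARD('n) * l1norm Q * norm a * norm d + real CARD('n) * l1norm Q * norm d * norm a
      + real CARD('n) * l1norm Q * norm d * norm d"
    by (intro add_mono norm_sesq_le)
  finally show ?thesis by (simp add: algebra_simps)
qed

lemma qnorm_pos: "posdef Q \<Longrightarrow> v \<noteq> 0 \<Longrightarrow> qnorm Q v > 0"
  by (simp add: qnorm_def posdef_def)

lemma qnorm_nonneg: "posdef Q \<Longrightarrow> qnorm Q v \<ge> 0"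
  by (simp add: qnorm_def posdef_nonneg)

text \<open>\<open>qnorm Q\<close> is equivalent to the Euclidean norm. The constant depends on
  \<open>Q\<close> alone; this keeps the set in the real supremum \<open>qopnorm\<close> bounded,
  and later bounds the operator norms of all samples at once.\<close>

lemma qnorm_mult_bound:
  fixes Q :: "complex^'n^'n"
  assumes "posdef Q"
  obtains k where "k \<ge> 0" "\<And>A v. qnorm Q (A *v v) \<le> k * l1norm A * qnorm Q v"
proof -
  obtain m where m: "m > 0" "\<And>v. m * (norm v)\<^sup>2 \<le> Re (hform Q v)"
    by (rule posdef_lower_bound[OF assms]) blast
  define K where "K = real CARD('n) * l1norm Q"
  have K: "K \<ge> 0" by (simp add: K_def l1norm_nonneg)
  have "qnorm Q (A *v v) \<le> sqrt (K / m) * l1norm A * qnorm Q v" for A v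
  proof -
    have "Re (hform Q (A *v v)) \<le> K * (norm (A *v v))\<^sup>2"
      using complex_Re_le_cmod norm_hform_le unfolding K_def by (metis order_trans)
    also have "\<dots> \<le> K * (l1norm A * norm v)\<^sup>2"
      using K norm_mult_vec_le by (intro mult_left_mono power_mono) auto
    also have "\<dots> = K / m * (l1norm A)\<^sup>2 * (m * (norm v)\<^sup>2)"
      using m(1) by (simp add: power_mult_distrib)
    also have "\<dots> \<le> K / m * (l1norm A)\<^sup>2 * Re (hform Q v)"
      using K m by (intro mult_left_mono) auto
    finally have "qnorm Q (A *v v) \<le> sqrt (K / m * (l1norm A)\<^sup>2 * Re (hform Q v))"
      by (simp add: qnorm_def)
    then show ?thesis
      by (simp only: real_sqrt_mult real_sqrt_abs abs_of_nonneg[OF l1norm_nonneg] qnorm_def)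
  qed
  moreover have "sqrt (K / m) \<ge> 0" using K m by simp
  ultimately show ?thesis using that by blast
qed

lemma qopnorm_bdd:
  assumes "posdef Q"
  shows "bdd_above ((\<lambda>v. qnorm Q (A *v v) / qnorm Q v) ` {v. v \<noteq> 0})"
proof -
  obtain k where "\<And>A v. qnorm Q (A *v v) \<le> k * l1norm A * qnorm Q v"
    by (rule qnorm_mult_bound[OF assms]) blast
  then show ?thesis using qnorm_pos[OF assms]
    by (intro bdd_aboveI[of _ "k * l1norm A"]) (auto simp: pos_divide_le_eq)
qed

lemma nonzero_vec_nonempty: "{v :: complex^'n. v \<noteq> 0} \<noteq> {}"
  using axis_eq_0_iff[of undefined "1::complex"] by auto

lemma qopnorm_le:
  assumes "posdef Q" "\<And>v. qnorm Q (A *v v) \<le> c * qnorm Q v"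
  shows "qopnorm Q A \<le> c"
  unfolding qopnorm_def using assms(2) qnorm_pos[OF assms(1)]
  by (intro cSUP_least nonzero_vec_nonempty) (auto simp: pos_divide_le_eq)

lemma qnorm_mult_le_qopnorm:
  assumes "posdef Q"
  shows "qnorm Q (A *v v) \<le> qopnorm Q A * qnorm Q v"
proof (cases "v = 0")
  case True
  then show ?thesis by (simp add: qnorm_def)
next
  case False
  then have "qnorm Q (A *v v) / qnorm Q v \<le> qopnorm Q A"
    unfolding qopnorm_def by (intro cSUP_upper qopnorm_bdd[OF assms]) auto
  then show ?thesis using qnorm_pos[OF assms False] by (simp add: pos_divide_le_eq)
qed

lemma qopnorm_nonneg:
  fixes Q :: "complex^'n^'n"
  assumes "posdef Q" shows "0 \<le> qopnorm Q A"
proof -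
  obtain v :: "complex^'n" where v: "v \<noteq> 0" using nonzero_vec_nonempty by blast
  have "0 \<le> qopnorm Q A * qnorm Q v"
    using qnorm_mult_le_qopnorm[OF assms] qnorm_nonneg[OF assms] by (metis order_trans)
  then show ?thesis using qnorm_pos[OF assms v] by (simp add: zero_le_mult_iff)
qed

text \<open>A supremum of continuous functions is lower semicontinuous.\<close>

lemma borel_measurable_qopnorm:
  fixes Q :: "complex^'n^'n"
  assumes "posdef Q"
  shows "qopnorm Q \<in> borel_measurable borel"
proof (rule borel_measurableI_greater)
  fix c
  have "{A \<in> space borel. c < qopnorm Q A} = (\<Union>v\<in>{v. v \<noteq> 0}. {A. c < qnorm Q (A *v v) / qnorm Q v})"
    unfolding qopnorm_def by (auto simp: less_cSUP_iff[OF nonzero_vec_nonempty qopnorm_bdd[OF assms]])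
  moreover have "open {A. c < qnorm Q (A *v v) / qnorm Q v}" if "v \<noteq> 0" for v
  proof -
    have "continuous_on UNIV (\<lambda>A. qnorm Q (A *v v))"
      unfolding qnorm_def hform_def matrix_vector_mult_def vec_lambda_beta
      by (intro continuous_intros)
    then have "continuous_on UNIV (\<lambda>A. qnorm Q (A *v v) / qnorm Q v)"
      using qnorm_pos[OF assms that] by (intro continuous_on_divide continuous_on_const) auto
    then show ?thesis by (intro open_Collect_less continuous_on_const) auto
  qed
  ultimately show "{A \<in> space borel. c < qopnorm Q A} \<in> sets borel" by (auto intro!: borel_open)
qed

section \<open>Independent samples\<close>

lemma linear_matrix_mult_left: "linear (\<lambda>Z. X ** (Z :: complex^'n^'n))"
proof (rule linearI)
  show "X ** (r *\<^sub>R Z) = r *\<^sub>R (X ** Z)" for r Z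
    by (simp add: vec_eq_iff matrix_matrix_mult_def scaleR_sum_right)
qed (rule matrix_add_ldistrib)

lemma bounded_linear_matrix_mult_left: "bounded_linear (\<lambda>Z. X ** (Z :: complex^'n^'n))"
  using linear_matrix_mult_left[of X] by (simp add: linear_conv_bounded_linear)

lemma continuous_on_matrix_mult_left: "continuous_on S (\<lambda>Z. X ** (Z :: complex^'n^'n))"
  by (rule linear_continuous_on[OF bounded_linear_matrix_mult_left])

lemma scaleR_entry: "(r *\<^sub>R (A :: complex^'n^'n)) $ i $ j = of_real r * A $ i $ j"
  by (simp only: vector_scaleR_component, simp add: scaleR_conv_of_real)

lemma linear_hform: "linear (\<lambda>Q. hform Q v)"
  by (rule linearI)
    (simp_all add: hform_def algebra_simps sum.distrib scaleR_sum_right)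

lemma integral_vec_nth2:
  fixes f :: "'a \<Rightarrow> complex^'n^'n"
  assumes "integrable M f"
  shows "(\<integral>x. f x \<partial>M) $ i $ j = (\<integral>x. f x $ i $ j \<partial>M)"
proof -
  have "bounded_linear (\<lambda>A :: complex^'n^'n. A $ i $ j)"
    by (intro bounded_linear_compose[OF bounded_linear_vec_nth bounded_linear_vec_nth])
  from integral_bounded_linear[OF this assms] show ?thesis by simp
qed

lemma integral_linear_matrix:
  fixes f :: "'a \<Rightarrow> complex^'n^'n" and h :: "complex^'n^'n \<Rightarrow> 'b::euclidean_space"
  assumes "integrable M f" "linear h"
  shows "(\<integral>x. h (f x) \<partial>M) = h (\<integral>x. f x \<partial>M)"
  using integral_bounded_linear[of h M f] assms linear_conv_bounded_linear[of h] by blast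

text \<open>Here and in \<open>mult_adj_entry\<close> the conjugated factor is written first, so one
  lemma on second moments of entries serves both \<open>Sop\<close> and
  \<open>Sop_star\<close>.\<close>

lemma adj_mult_entry:
  "(adj R ** Q ** S) $ i $ j = (\<Sum>k\<in>UNIV. \<Sum>l\<in>UNIV. Q $ k $ l * (cnj (R $ k $ i) * S $ l $ j))"
proof -
  have "(adj R ** Q ** S) $ i $ j = (\<Sum>l\<in>UNIV. \<Sum>k\<in>UNIV. Q $ k $ l * (cnj (R $ k $ i) * S $ l $ j))"
    by (simp add: matrix_matrix_mult_def adj_def sum_distrib_left sum_distrib_right mult_ac)
  then show ?thesis by (subst sum.swap)
qed

lemma mult_adj_entry:
  "(R ** Q ** adj S) $ i $ j = (\<Sum>k\<in>UNIV. \<Sum>l\<in>UNIV. Q $ k $ l * (cnj (S $ j $ l) * R $ i $ k))"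
proof -
  have "(R ** Q ** adj S) $ i $ j = (\<Sum>l\<in>UNIV. \<Sum>k\<in>UNIV. Q $ k $ l * (cnj (S $ j $ l) * R $ i $ k))"
    by (simp add: matrix_matrix_mult_def adj_def sum_distrib_left sum_distrib_right mult_ac)
  then show ?thesis by (subst sum.swap)
qed

lemma borel_measurable_vec_nth2 [measurable (raw)]:
  assumes "f \<in> borel_measurable M"
  shows "(\<lambda>x. (f x :: complex^'n^'n) $ i $ j) \<in> borel_measurable M"
  by (rule borel_measurable_continuous_on[OF _ assms, of "\<lambda>A. A $ i $ j"]) (intro continuous_intros)

lemma borel_measurable_cnj [measurable (raw)]:
  "f \<in> borel_measurable M \<Longrightarrow> (\<lambda>x. cnj (f x)) \<in> borel_measurable M"
  by (rule borel_measurable_continuous_on[of cnj]) (intro continuous_intros)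

lemma cmod_entry_le_l1norm: "cmod (A $ i $ j) \<le> l1norm A"
proof -
  have "cmod (A $ i $ j) \<le> (\<Sum>j\<in>UNIV. cmod (A $ i $ j))" by (rule member_le_sum) auto
  also have "\<dots> \<le> l1norm A" unfolding l1norm_def
    by (rule member_le_sum[of i UNIV "\<lambda>i. \<Sum>j\<in>UNIV. cmod (A $ i $ j)"]) (auto intro: sum_nonneg)
  finally show ?thesis .
qed

lemma norm_le_l1norm: "norm (A :: complex^'n^'n) \<le> l1norm A"
proof -
  have "norm A \<le> (\<Sum>i\<in>UNIV. norm (A $ i))"
    unfolding norm_vec_def[of A] by (rule L2_set_le_sum) simp
  also have "\<dots> \<le> l1norm A"
    unfolding l1norm_def
  proof (rule sum_mono)
    show "norm (A $ i) \<le> (\<Sum>j\<in>UNIV. cmod (A $ i $ j))" for i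
      unfolding norm_vec_def[of "A $ i"] by (rule L2_set_le_sum) simp
  qed
  finally show ?thesis .
qed

text \<open>Independence is the assumption \<open>indep_C\<close>; the identical distribution of the
  samples comes from the invariance of \<open>\<mu>\<close> under \<open>\<theta>\<close>.\<close>

locale iid_sampling = prob_space \<mu> for \<mu> :: "'a measure" +
  fixes \<theta> :: "'a \<Rightarrow> 'a" and E :: "complex set" and C :: "complex \<Rightarrow> 'a \<Rightarrow> complex^'n^'n"
  assumes theta_measurable: "\<theta> \<in> measurable \<mu> \<mu>"
    and theta_distr: "distr \<mu> \<mu> \<theta> = \<mu>"
    and open_E: "open E"
    and C_measurable: "\<And>\<zeta>. \<zeta> \<in> E \<Longrightarrow> C \<zeta> \<in> borel_measurable \<mu>"
    and C_bounded: "\<exists>B. \<forall>\<zeta>\<in>E. \<forall>\<omega>\<in>space \<mu>. norm (C \<zeta> \<omega>) \<le> B"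
    and C_analytic: "\<And>\<omega> i j. \<omega> \<in> space \<mu> \<Longrightarrow> (\<lambda>\<zeta>. C \<zeta> \<omega> $ i $ j) analytic_on E"
    and indep_C: "independent_samples \<mu> \<theta> E C"
begin

abbreviation "mean_C \<equiv> Cmean \<mu> C"
abbreviation "emp_C \<equiv> Chat \<theta> C"
abbreviation "err \<equiv> rel_err \<mu> \<theta> C"
abbreviation "mean_form Q D v \<equiv> \<integral>\<omega>. Re (hform Q (D \<omega> *v v)) \<partial>\<mu>"
abbreviation "PQ \<equiv> Psym_Q \<mu> \<theta> C"

lemma theta_pow_measurable [measurable]: "(\<theta> ^^ m) \<in> measurable \<mu> \<mu>"
proof (induction m)
  case (Suc m)
  then have "\<theta> \<circ> (\<theta> ^^ m) \<in> measurable \<mu> \<mu>" by (rule measurable_comp[OF _ theta_measurable])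
  then show ?case by (simp only: funpow.simps)
qed (simp add: id_def)

lemma theta_pow_space: "\<omega> \<in> space \<mu> \<Longrightarrow> (\<theta> ^^ m) \<omega> \<in> space \<mu>"
  using measurable_space[OF theta_pow_measurable] .

lemma theta_pow_distr: "distr \<mu> \<mu> (\<theta> ^^ m) = \<mu>"
proof (induction m)
  case 0
  have "distr \<mu> \<mu> (\<lambda>x. x) = \<mu>" by (rule distr_id)
  then show ?case by (simp add: id_def)
next
  case (Suc m)
  have "distr \<mu> \<mu> (\<theta> \<circ> (\<theta> ^^ m)) = distr (distr \<mu> \<mu> (\<theta> ^^ m)) \<mu> \<theta>"
    by (rule distr_distr[symmetric]) (rule theta_measurable theta_pow_measurable)+
  then show ?case using Suc theta_distr by (simp only: funpow.simps)
qed

lemma integral_theta_pow: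
  fixes f :: "'a \<Rightarrow> 'b::{banach, second_countable_topology}"
  assumes "f \<in> borel_measurable \<mu>"
  shows "(\<integral>\<omega>. f ((\<theta> ^^ m) \<omega>) \<partial>\<mu>) = (\<integral>\<omega>. f \<omega> \<partial>\<mu>)"
  using integral_distr[OF theta_pow_measurable assms, of m] by (simp add: theta_pow_distr)

lemma AE_theta_pow:
  assumes "AE \<omega> in \<mu>. P \<omega>"
  shows "AE \<omega> in \<mu>. P ((\<theta> ^^ m) \<omega>)"
  by (rule AE_distrD[OF theta_pow_measurable[of m]]) (subst theta_pow_distr, rule assms)

lemma indep_samples_at:
  assumes "\<zeta> \<in> E"
  shows "indep_vars (\<lambda>_. borel) (\<lambda>m \<omega>. C \<zeta> ((\<theta> ^^ m) \<omega>)) {1..}"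
proof -
  have "indep_vars (\<lambda>_. borel) (\<lambda>m \<omega>. (\<lambda>f. f \<zeta>) ((\<lambda>\<zeta>\<in>E. C \<zeta> ((\<theta> ^^ m) \<omega>)))) {1..}"
    using indep_C unfolding independent_samples_def
    by (rule indep_vars_compose2) (rule measurable_component_singleton[OF assms])
  then show ?thesis using assms by simp
qed

lemma C_bound_ex:
  obtains B where "B \<ge> 0" "\<And>\<zeta> \<omega>. \<zeta> \<in> E \<Longrightarrow> \<omega> \<in> space \<mu> \<Longrightarrow> l1norm (C \<zeta> \<omega>) \<le> B"
proof -
  obtain B where B: "\<And>\<zeta> \<omega>. \<zeta> \<in> E \<Longrightarrow> \<omega> \<in> space \<mu> \<Longrightarrow> norm (C \<zeta> \<omega>) \<le> B" using C_bounded by blast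
  have "l1norm (C \<zeta> \<omega>) \<le> (real CARD('n))\<^sup>2 * \<bar>B\<bar>" if "\<zeta> \<in> E" "\<omega> \<in> space \<mu>" for \<zeta> \<omega>
    using l1norm_le_norm[of "C \<zeta> \<omega>"] B[OF that]
    by (meson abs_ge_self mult_left_mono order_trans zero_le_power2)
  then show ?thesis using that[of "(real CARD('n))\<^sup>2 * \<bar>B\<bar>"] by simp
qed

lemma integrable_bounded:
  fixes f :: "'a \<Rightarrow> 'b::{banach, second_countable_topology}"
  assumes "f \<in> borel_measurable \<mu>" "\<And>\<omega>. \<omega> \<in> space \<mu> \<Longrightarrow> norm (f \<omega>) \<le> K"
  shows "integrable \<mu> f"
  by (rule integrable_const_bound[of _ K]) (use assms in auto)

lemma integrable_C: "\<zeta> \<in> E \<Longrightarrow> integrable \<mu> (C \<zeta>)"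
proof -
  assume z: "\<zeta> \<in> E"
  obtain B where "\<And>\<zeta> \<omega>. \<zeta> \<in> E \<Longrightarrow> \<omega> \<in> space \<mu> \<Longrightarrow> norm (C \<zeta> \<omega>) \<le> B" using C_bounded by blast
  then show ?thesis using integrable_bounded[OF C_measurable[OF z]] z by blast
qed

text \<open>The relative error of a single sample. It has mean zero, \<open>rel_err\<close> is its
  average along the orbit, and its norm is what \<open>R_bd\<close> measures.\<close>

definition dev :: "complex \<Rightarrow> 'a \<Rightarrow> complex^'n^'n" where
  "dev \<zeta> \<omega> = matrix_inv (mean_C \<zeta>) ** C \<zeta> \<omega> - mat 1"

lemma dev_measurable: "\<zeta> \<in> E \<Longrightarrow> dev \<zeta> \<in> borel_measurable \<mu>"
proof -
  assume "\<zeta> \<in> E"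
  have "continuous_on UNIV (\<lambda>Z. matrix_inv (mean_C \<zeta>) ** Z - mat 1)"
    by (intro continuous_on_diff continuous_on_const continuous_on_matrix_mult_left)
  then have "(\<lambda>\<omega>. matrix_inv (mean_C \<zeta>) ** C \<zeta> \<omega> - mat 1) \<in> borel_measurable \<mu>"
    by (rule borel_measurable_continuous_on[OF _ C_measurable[OF \<open>\<zeta> \<in> E\<close>]])
  then show ?thesis by (simp add: dev_def[abs_def])
qed

lemma dev_bound_ex:
  assumes "\<zeta> \<in> E"
  obtains B where "B \<ge> 0" "\<And>\<omega>. \<omega> \<in> space \<mu> \<Longrightarrow> l1norm (dev \<zeta> \<omega>) \<le> B"
proof -
  obtain B where B: "B \<ge> 0" "\<And>\<zeta> \<omega>. \<zeta> \<in> E \<Longrightarrow> \<omega> \<in> space \<mu> \<Longrightarrow> l1norm (C \<zeta> \<omega>) \<le> B"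
    by (rule C_bound_ex) blast
  let ?I = "matrix_inv (mean_C \<zeta>)"
  have "l1norm (dev \<zeta> \<omega>) \<le> l1norm ?I * B + l1norm (mat 1 :: complex^'n^'n)" if "\<omega> \<in> space \<mu>" for \<omega>
  proof -
    have "l1norm (dev \<zeta> \<omega>) \<le> l1norm (?I ** C \<zeta> \<omega>) + l1norm (- mat 1 :: complex^'n^'n)"
      using l1norm_triangle[of "?I ** C \<zeta> \<omega>" "- mat 1"] by (simp add: dev_def)
    also have "l1norm (?I ** C \<zeta> \<omega>) \<le> l1norm ?I * B"
      by (rule order_trans[OF l1norm_mult mult_left_mono[OF B(2)[OF assms that] l1norm_nonneg]])
    finally show ?thesis by (simp add: l1norm_minus)
  qed
  then show ?thesis using that[of "l1norm ?I * B + l1norm (mat 1 :: complex^'n^'n)"] B(1)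
    by (auto simp: l1norm_nonneg)
qed

lemma dev_entry_integrable:
  assumes "\<zeta> \<in> E"
  shows "integrable \<mu> (\<lambda>\<omega>. dev \<zeta> \<omega> $ i $ j)"
proof -
  obtain B where "\<And>\<omega>. \<omega> \<in> space \<mu> \<Longrightarrow> l1norm (dev \<zeta> \<omega>) \<le> B" by (rule dev_bound_ex[OF assms]) blast
  then show ?thesis using dev_measurable[OF assms]
    by (intro integrable_bounded[of _ B] borel_measurable_vec_nth2)
      (auto intro: order_trans[OF cmod_entry_le_l1norm])
qed

lemma dev_mean:
  assumes "\<zeta> \<in> E" "det (mean_C \<zeta>) \<noteq> 0"
  shows "(\<integral>\<omega>. dev \<zeta> \<omega> $ i $ j \<partial>\<mu>) = 0"
proof -
  let ?I = "matrix_inv (mean_C \<zeta>)"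
  have inv: "?I ** mean_C \<zeta> = mat 1"
    using assms(2) matrix_inv_left_right invertible_det_nz by blast
  have iC: "integrable \<mu> (\<lambda>\<omega>. ?I ** C \<zeta> \<omega>)"
    by (rule integrable_bounded_linear[OF bounded_linear_matrix_mult_left integrable_C[OF assms(1)]])
  have "(\<integral>\<omega>. ?I ** C \<zeta> \<omega> \<partial>\<mu>) = mat 1"
    using integral_linear_matrix[OF integrable_C[OF assms(1)] linear_matrix_mult_left[of ?I]] inv
    by (simp add: Cmean_def)
  then have "(\<integral>\<omega>. dev \<zeta> \<omega> \<partial>\<mu>) = 0"
    using iC by (simp add: dev_def prob_space)
  moreover have "integrable \<mu> (dev \<zeta>)" using iC by (simp add: dev_def[abs_def])
  ultimately show ?thesis using integral_vec_nth2[of \<mu> "dev \<zeta>" i j] by simp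
qed

lemma rel_err_eq:
  assumes "det (mean_C \<zeta>) \<noteq> 0" "M \<ge> 1"
  shows "err \<zeta> M \<omega> = (1 / real M) *\<^sub>R (\<Sum>m=1..M. dev \<zeta> ((\<theta> ^^ m) \<omega>))"
proof -
  let ?I = "matrix_inv (mean_C \<zeta>)"
  have inv: "?I ** mean_C \<zeta> = mat 1"
    using assms(1) matrix_inv_left_right invertible_det_nz by blast
  note lin = linear_matrix_mult_left[of ?I]
  have "err \<zeta> M \<omega> = (1 / real M) *\<^sub>R (\<Sum>m=1..M. ?I ** C \<zeta> ((\<theta> ^^ m) \<omega>)) - mat 1"
    unfolding rel_err_def Ctilde_def Chat_def
    by (simp add: linear_diff[OF lin] linear_cmul[OF lin] linear_sum[OF lin] inv)
  also have "\<dots> = (1 / real M) *\<^sub>R ((\<Sum>m=1..M. ?I ** C \<zeta> ((\<theta> ^^ m) \<omega>)) - real M *\<^sub>R mat 1)"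
    using assms(2) by (simp add: scaleR_diff_right)
  also have "(\<Sum>m=1..M. ?I ** C \<zeta> ((\<theta> ^^ m) \<omega>)) - real M *\<^sub>R mat 1 = (\<Sum>m=1..M. dev \<zeta> ((\<theta> ^^ m) \<omega>))"
    by (simp add: dev_def sum_subtractf sum_constant_scaleR del: sum_constant)
  finally show ?thesis .
qed

lemma dev_uncorrelated:
  assumes z: "\<zeta> \<in> E" "det (mean_C \<zeta>) \<noteq> 0" and m: "m \<ge> 1" "m' \<ge> 1" "m \<noteq> m'"
  shows "(\<integral>\<omega>. cnj (dev \<zeta> ((\<theta> ^^ m) \<omega>) $ p $ q) * dev \<zeta> ((\<theta> ^^ m') \<omega>) $ r $ s \<partial>\<mu>) = 0"
proof -
  let ?I = "matrix_inv (mean_C \<zeta>)"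
  \<comment> \<open>The two entries are different functions of the matrix, one of them conjugated.
    Indexing them by the time \<open>k\<close> makes them one family, as the product rule for
    independent variables requires.\<close>
  define f where "f k Z = (if k = m then cnj ((?I ** Z - mat 1) $ p $ q) else (?I ** Z - mat 1) $ r $ s)"
    for k :: nat and Z :: "complex^'n^'n"
  have "continuous_on UNIV (\<lambda>Z :: complex^'n^'n. ?I ** Z)"
    by (rule continuous_on_matrix_mult_left)
  then have cont: "continuous_on UNIV (f k)" for k
    unfolding f_def by (cases "k = m") (simp_all, (intro continuous_intros | assumption)+)
  have "indep_vars (\<lambda>_. borel) (\<lambda>k \<omega>. f k (C \<zeta> ((\<theta> ^^ k) \<omega>))) {m, m'}"
  proof (rule indep_vars_compose2[OF indep_vars_subset[OF indep_samples_at[OF z(1)]]])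
    show "f k \<in> borel_measurable borel" for k using cont by (rule borel_measurable_continuous_onI)
  qed (use m in auto)
  moreover have f: "f m (C \<zeta> \<omega>) = cnj (dev \<zeta> \<omega> $ p $ q)" "f m' (C \<zeta> \<omega>) = dev \<zeta> \<omega> $ r $ s" for \<omega>
    using m by (auto simp: f_def dev_def)
  have int: "integrable \<mu> (\<lambda>\<omega>. dev \<zeta> ((\<theta> ^^ k) \<omega>) $ i $ j)" for k i j
    using integrable_distr[OF theta_pow_measurable, of k "\<lambda>\<omega>. dev \<zeta> \<omega> $ i $ j"] dev_entry_integrable[OF z(1)]
    by (simp add: theta_pow_distr)
  have "integrable \<mu> (\<lambda>\<omega>. f k (C \<zeta> ((\<theta> ^^ k) \<omega>)))" if "k \<in> {m, m'}" for k
    using that int f m by auto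
  ultimately have "(\<integral>\<omega>. (\<Prod>k\<in>{m, m'}. f k (C \<zeta> ((\<theta> ^^ k) \<omega>))) \<partial>\<mu>) = (\<Prod>k\<in>{m, m'}. \<integral>\<omega>. f k (C \<zeta> ((\<theta> ^^ k) \<omega>)) \<partial>\<mu>)"
    by (intro indep_vars_lebesgue_integral) auto
  moreover have "(\<integral>\<omega>. f m' (C \<zeta> ((\<theta> ^^ m') \<omega>)) \<partial>\<mu>) = 0"
    unfolding f using integral_theta_pow[OF borel_measurable_vec_nth2[OF dev_measurable[OF z(1)]], of m' r s] dev_mean[OF z] by simp
  ultimately show ?thesis using m(3) by (simp add: f)
qed

text \<open>In the double sum over pairs of times the off-diagonal terms vanish, by independence and
  zero mean, and the \<open>M\<close> diagonal terms agree by invariance. The factor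
  \<open>M\<close> cancels what remains of the squared normalisation, so the right-hand side no
  longer contains \<open>M\<close>.\<close>

lemma rel_err_second_moment:
  assumes z: "\<zeta> \<in> E" "det (mean_C \<zeta>) \<noteq> 0" and M: "M \<ge> 1"
  shows "of_nat M * (\<integral>\<omega>. cnj (err \<zeta> M \<omega> $ p $ q) * err \<zeta> M \<omega> $ r $ s \<partial>\<mu>)
       = (\<integral>\<omega>. cnj (dev \<zeta> \<omega> $ p $ q) * dev \<zeta> \<omega> $ r $ s \<partial>\<mu>)" (is "_ = ?c")
proof -
  obtain B where B: "B \<ge> 0" "\<And>\<omega>. \<omega> \<in> space \<mu> \<Longrightarrow> l1norm (dev \<zeta> \<omega>) \<le> B" by (rule dev_bound_ex[OF z(1)]) blast
  have eb: "cmod (dev \<zeta> \<omega> $ i $ j) \<le> B" if "\<omega> \<in> space \<mu>" for \<omega> i j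
    using cmod_entry_le_l1norm B(2)[OF that] by (rule order_trans)
  have ms[measurable]: "(\<lambda>\<omega>. dev \<zeta> ((\<theta> ^^ k) \<omega>) $ i $ j) \<in> borel_measurable \<mu>" for k i j
    using measurable_compose[OF theta_pow_measurable borel_measurable_vec_nth2[OF dev_measurable[OF z(1)]]] .
  have ms0[measurable]: "(\<lambda>\<omega>. dev \<zeta> \<omega> $ i $ j) \<in> borel_measurable \<mu>" for i j
    using borel_measurable_vec_nth2[OF dev_measurable[OF z(1)]] .
  let ?D = "\<lambda>m \<omega>. dev \<zeta> ((\<theta> ^^ m) \<omega>)"
  have int: "integrable \<mu> (\<lambda>\<omega>. cnj (?D m \<omega> $ p $ q) * ?D m' \<omega> $ r $ s)" for m m'
    by (rule integrable_bounded[of _ "B * B"]) (auto simp: norm_mult intro!: mult_mono eb theta_pow_space B(1))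
  have diag: "(\<integral>\<omega>. cnj (?D m \<omega> $ p $ q) * ?D m \<omega> $ r $ s \<partial>\<mu>) = ?c" for m
    by (rule integral_theta_pow) measurable
  have "(\<integral>\<omega>. cnj (err \<zeta> M \<omega> $ p $ q) * err \<zeta> M \<omega> $ r $ s \<partial>\<mu>)
      = (\<integral>\<omega>. (1 / of_nat M)\<^sup>2 * (\<Sum>m=1..M. \<Sum>m'=1..M. cnj (?D m \<omega> $ p $ q) * ?D m' \<omega> $ r $ s) \<partial>\<mu>)"
    unfolding rel_err_eq[OF z(2) M]
    by (intro Bochner_Integration.integral_cong refl)
      (simp add: scaleR_entry sum_product power2_eq_square del: vector_scaleR_component)
  also have "\<dots> = (1 / of_nat M)\<^sup>2 * (\<Sum>m=1..M. \<Sum>m'=1..M. (\<integral>\<omega>. cnj (?D m \<omega> $ p $ q) * ?D m' \<omega> $ r $ s \<partial>\<mu>))"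
    using int by simp
  also have "(\<Sum>m=1..M. \<Sum>m'=1..M. (\<integral>\<omega>. cnj (?D m \<omega> $ p $ q) * ?D m' \<omega> $ r $ s \<partial>\<mu>))
      = (\<Sum>m=1..M. \<Sum>m'=1..M. if m = m' then ?c else 0)"
    by (intro sum.cong refl) (auto simp: diag dev_uncorrelated[OF z])
  also have "\<dots> = of_nat M * ?c" by simp
  finally show ?thesis using M by (simp add: power2_eq_square)
qed

lemma integrable_matrix:
  fixes Z :: "'a \<Rightarrow> complex^'n^'n"
  assumes "\<And>i j. (\<lambda>\<omega>. Z \<omega> $ i $ j) \<in> borel_measurable \<mu>" "\<And>\<omega>. \<omega> \<in> space \<mu> \<Longrightarrow> l1norm (Z \<omega>) \<le> K"
  shows "integrable \<mu> Z"
proof (rule integrable_bounded[of _ K])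
  have "(\<lambda>\<omega>. Z \<omega> $ i) \<in> borel_measurable \<mu>" for i
  proof (subst borel_measurable_euclidean_space, intro ballI)
    fix b :: "complex^'n" assume "b \<in> Basis"
    then obtain j c where b: "b = axis j c" by (auto simp: Basis_vec_def)
    show "(\<lambda>\<omega>. Z \<omega> $ i \<bullet> b) \<in> borel_measurable \<mu>"
      unfolding b inner_axis using assms(1) by measurable
  qed
  note row = this
  show "Z \<in> borel_measurable \<mu>"
  proof (subst borel_measurable_euclidean_space, intro ballI)
    fix b :: "complex^'n^'n" assume "b \<in> Basis"
    then obtain j c where b: "b = axis j c" by (auto simp: Basis_vec_def)
    show "(\<lambda>\<omega>. Z \<omega> \<bullet> b) \<in> borel_measurable \<mu>"
      unfolding b inner_axis using row by measurable
  qed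
qed (use assms(2) norm_le_l1norm order_trans in blast)

lemma entry_measurable_adj:
  fixes Z :: "'a \<Rightarrow> complex^'n^'n"
  assumes "\<And>i j. (\<lambda>\<omega>. Z \<omega> $ i $ j) \<in> borel_measurable \<mu>"
  shows "(\<lambda>\<omega>. (adj (Z \<omega>) ** Q ** Z \<omega>) $ i $ j) \<in> borel_measurable \<mu>"
    and "(\<lambda>\<omega>. (Z \<omega> ** Q ** adj (Z \<omega>)) $ i $ j) \<in> borel_measurable \<mu>"
  unfolding adj_mult_entry mult_adj_entry using assms by measurable

lemma l1norm_sandwich:
  assumes "l1norm Z \<le> B" "B \<ge> 0"
  shows "l1norm (adj Z ** Q ** Z) \<le> B * l1norm Q * B"
    and "l1norm (Z ** Q ** adj Z) \<le> B * l1norm Q * B"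
proof -
  have "l1norm (adj Z ** Q) \<le> B * l1norm Q" "l1norm (Z ** Q) \<le> B * l1norm Q"
    using assms l1norm_mult[of "adj Z" Q] l1norm_mult[of Z Q]
    by (auto simp: l1norm_adj intro: order_trans mult_right_mono[OF _ l1norm_nonneg])
  then show "l1norm (adj Z ** Q ** Z) \<le> B * l1norm Q * B" "l1norm (Z ** Q ** adj Z) \<le> B * l1norm Q * B"
    using assms by (auto simp: l1norm_adj l1norm_nonneg intro!: order_trans[OF l1norm_mult] mult_mono)
qed

lemma integrable_sandwich:
  fixes Z :: "'a \<Rightarrow> complex^'n^'n"
  assumes "\<And>i j. (\<lambda>\<omega>. Z \<omega> $ i $ j) \<in> borel_measurable \<mu>" "\<And>\<omega>. \<omega> \<in> space \<mu> \<Longrightarrow> l1norm (Z \<omega>) \<le> B" "B \<ge> 0"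
  shows "integrable \<mu> (\<lambda>\<omega>. adj (Z \<omega>) ** Q ** Z \<omega>)" "integrable \<mu> (\<lambda>\<omega>. Z \<omega> ** Q ** adj (Z \<omega>))"
  by (rule integrable_matrix[of _ "B * l1norm Q * B"];
      intro entry_measurable_adj l1norm_sandwich assms; assumption)+

lemma rel_err_measurable_bound:
  assumes z: "\<zeta> \<in> E" "det (mean_C \<zeta>) \<noteq> 0" and M: "M \<ge> 1"
  obtains B where "B \<ge> 0" "\<And>\<omega>. \<omega> \<in> space \<mu> \<Longrightarrow> l1norm (err \<zeta> M \<omega>) \<le> B"
    "\<And>i j. (\<lambda>\<omega>. err \<zeta> M \<omega> $ i $ j) \<in> borel_measurable \<mu>"
proof -
  obtain B where B: "B \<ge> 0" "\<And>\<omega>. \<omega> \<in> space \<mu> \<Longrightarrow> l1norm (dev \<zeta> \<omega>) \<le> B" by (rule dev_bound_ex[OF z(1)]) blast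
  have [measurable]: "(\<lambda>\<omega>. dev \<zeta> ((\<theta> ^^ k) \<omega>) $ i $ j) \<in> borel_measurable \<mu>" for k i j
    using measurable_compose[OF theta_pow_measurable borel_measurable_vec_nth2[OF dev_measurable[OF z(1)]]] .
  have ms: "(\<lambda>\<omega>. err \<zeta> M \<omega> $ i $ j) \<in> borel_measurable \<mu>" for i j
    unfolding rel_err_eq[OF z(2) M] by simp
  have "cmod (err \<zeta> M \<omega> $ i $ j) \<le> B" if "\<omega> \<in> space \<mu>" for \<omega> i j
  proof -
    have "cmod (\<Sum>m=1..M. dev \<zeta> ((\<theta> ^^ m) \<omega>) $ i $ j) \<le> (\<Sum>m=1..M. B)"
      by (intro order_trans[OF norm_sum] sum_mono order_trans[OF cmod_entry_le_l1norm] B(2) theta_pow_space that)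
    then show ?thesis using M unfolding rel_err_eq[OF z(2) M] by (simp add: field_simps)
  qed
  then have "l1norm (err \<zeta> M \<omega>) \<le> real CARD('n) * (real CARD('n) * B)" if "\<omega> \<in> space \<mu>" for \<omega>
    unfolding l1norm_def using that
    by (intro order_trans[OF sum_bounded_above[of _ _ "real CARD('n) * B"]] order_trans[OF sum_bounded_above[of _ _ B]]) auto
  then show ?thesis using that[of "real CARD('n) * (real CARD('n) * B)"] ms B(1) by simp
qed

text \<open>The sequences whose limits define the two operators are constant from
  \<open>M = 1\<close> on, so the limits are second moments of one sample. This links
  \<open>Psym\<close> to the variance in Bernstein's inequality.\<close>

lemma Sop_eq:
  assumes z: "\<zeta> \<in> E" "det (mean_C \<zeta>) \<noteq> 0"
  shows "Sop \<mu> \<theta> C \<zeta> Q = (\<integral>\<omega>. adj (dev \<zeta> \<omega>) ** Q ** dev \<zeta> \<omega> \<partial>\<mu>)" (is "_ = ?S")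
    and "Sop_star \<mu> \<theta> C \<zeta> Q = (\<integral>\<omega>. dev \<zeta> \<omega> ** Q ** adj (dev \<zeta> \<omega>) \<partial>\<mu>)" (is "_ = ?T")
proof -
  obtain B where B: "B \<ge> 0" "\<And>\<omega>. \<omega> \<in> space \<mu> \<Longrightarrow> l1norm (dev \<zeta> \<omega>) \<le> B" by (rule dev_bound_ex[OF z(1)]) blast
  have ms0: "(\<lambda>\<omega>. dev \<zeta> \<omega> $ i $ j) \<in> borel_measurable \<mu>" for i j
    using borel_measurable_vec_nth2[OF dev_measurable[OF z(1)]] .
  note intd = integrable_sandwich[OF ms0 B(2,1)]
  have pint: "integrable \<mu> (\<lambda>\<omega>. cnj (Z \<omega> $ p $ q) * Z \<omega> $ r $ s)"
    if "\<And>i j. (\<lambda>\<omega>. Z \<omega> $ i $ j) \<in> borel_measurable \<mu>" "\<And>\<omega>. \<omega> \<in> space \<mu> \<Longrightarrow> l1norm (Z \<omega>) \<le> b" "b \<ge> 0"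
    for Z :: "'a \<Rightarrow> complex^'n^'n" and b p q r s
    using that(1) by (intro integrable_bounded[of _ "b * b"])
      (auto simp: norm_mult intro!: mult_mono order_trans[OF cmod_entry_le_l1norm that(2)] that(3))
  have *: "real M *\<^sub>R (\<integral>\<omega>. adj (err \<zeta> M \<omega>) ** Q ** err \<zeta> M \<omega> \<partial>\<mu>) = ?S \<and>
      real M *\<^sub>R (\<integral>\<omega>. err \<zeta> M \<omega> ** Q ** adj (err \<zeta> M \<omega>) \<partial>\<mu>) = ?T" if M: "M \<ge> 1" for M
  proof -
    obtain b where b: "b \<ge> 0" "\<And>\<omega>. \<omega> \<in> space \<mu> \<Longrightarrow> l1norm (err \<zeta> M \<omega>) \<le> b"
      "\<And>i j. (\<lambda>\<omega>. err \<zeta> M \<omega> $ i $ j) \<in> borel_measurable \<mu>"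
      by (rule rel_err_measurable_bound[OF z M]) blast
    note intr = integrable_sandwich[OF b(3) b(2,1)]
    note p1 = pint[OF b(3) b(2,1)] and p2 = pint[OF ms0 B(2,1)]
    have 1: "(real M *\<^sub>R (\<integral>\<omega>. adj (err \<zeta> M \<omega>) ** Q ** err \<zeta> M \<omega> \<partial>\<mu>)) $ i $ j = ?S $ i $ j" for i j
      using p1 p2 by (simp add: integral_vec_nth2[OF intr(1)] integral_vec_nth2[OF intd(1)] adj_mult_entry
          scaleR_entry sum_distrib_left mult.left_commute[of "of_nat M"] rel_err_second_moment[OF z M]
          del: vector_scaleR_component)
    have 2: "(real M *\<^sub>R (\<integral>\<omega>. err \<zeta> M \<omega> ** Q ** adj (err \<zeta> M \<omega>) \<partial>\<mu>)) $ i $ j = ?T $ i $ j" for i j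
      using p1 p2 by (simp add: integral_vec_nth2[OF intr(2)] integral_vec_nth2[OF intd(2)] mult_adj_entry
          scaleR_entry sum_distrib_left mult.left_commute[of "of_nat M"] rel_err_second_moment[OF z M]
          del: vector_scaleR_component)
    show ?thesis using 1 2 by (simp add: vec_eq_iff)
  qed
  show "Sop \<mu> \<theta> C \<zeta> Q = ?S" unfolding Sop_def
    by (intro limI tendsto_eventually eventually_sequentiallyI[of 1]) (use * in blast)
  show "Sop_star \<mu> \<theta> C \<zeta> Q = ?T" unfolding Sop_star_def
    by (intro limI tendsto_eventually eventually_sequentiallyI[of 1]) (use * in blast)
qed

lemma hform_Sop:
  assumes z: "\<zeta> \<in> E" "det (mean_C \<zeta>) \<noteq> 0"
  shows "Re (hform (Sop \<mu> \<theta> C \<zeta> Q) v) = mean_form Q (dev \<zeta>) v"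
    and "Re (hform (Sop_star \<mu> \<theta> C \<zeta> Q) v) = (\<integral>\<omega>. Re (hform Q (adj (dev \<zeta> \<omega>) *v v)) \<partial>\<mu>)"
    and "integrable \<mu> (\<lambda>\<omega>. Re (hform Q (dev \<zeta> \<omega> *v v)))"
    and "integrable \<mu> (\<lambda>\<omega>. Re (hform Q (adj (dev \<zeta> \<omega>) *v v)))"
proof -
  obtain B where B: "B \<ge> 0" "\<And>\<omega>. \<omega> \<in> space \<mu> \<Longrightarrow> l1norm (dev \<zeta> \<omega>) \<le> B" by (rule dev_bound_ex[OF z(1)]) blast
  have ms0: "(\<lambda>\<omega>. dev \<zeta> \<omega> $ i $ j) \<in> borel_measurable \<mu>" for i j
    using borel_measurable_vec_nth2[OF dev_measurable[OF z(1)]] .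
  note intd = integrable_sandwich[OF ms0 B(2,1)]
  have lin: "linear (\<lambda>Q. Re (hform Q v))" using linear_compose[OF linear_hform bounded_linear.linear[OF bounded_linear_Re]] by (simp add: o_def)
  then have bl: "bounded_linear (\<lambda>Q. Re (hform Q v))" by (simp add: linear_conv_bounded_linear)
  show "Re (hform (Sop \<mu> \<theta> C \<zeta> Q) v) = mean_form Q (dev \<zeta>) v"
    unfolding hform_mult Sop_eq[OF z] by (rule integral_linear_matrix[OF intd(1) lin, symmetric])
  show "Re (hform (Sop_star \<mu> \<theta> C \<zeta> Q) v) = (\<integral>\<omega>. Re (hform Q (adj (dev \<zeta> \<omega>) *v v)) \<partial>\<mu>)"
    unfolding hform_mult Sop_eq[OF z] adj_adj by (rule integral_linear_matrix[OF intd(2) lin, symmetric])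
  show "integrable \<mu> (\<lambda>\<omega>. Re (hform Q (dev \<zeta> \<omega> *v v)))"
    unfolding hform_mult by (rule integrable_bounded_linear[OF bl intd(1)])
  show "integrable \<mu> (\<lambda>\<omega>. Re (hform Q (adj (dev \<zeta> \<omega>) *v v)))"
    unfolding hform_mult adj_adj by (rule integrable_bounded_linear[OF bl intd(2)])
qed

end

lemma l1norm_le_const:
  fixes A :: "complex^'n^'n"
  assumes "\<And>i j. cmod (A $ i $ j) \<le> K"
  shows "l1norm A \<le> (real CARD('n))\<^sup>2 * K"
proof -
  have "l1norm A \<le> (\<Sum>i\<in>(UNIV::'n set). \<Sum>j\<in>(UNIV::'n set). K)"
    unfolding l1norm_def by (intro sum_mono assms)
  then show ?thesis by (simp add: power2_eq_square)
qed

lemma l1norm_scaleR: "l1norm (r *\<^sub>R A) = \<bar>r\<bar> * l1norm A"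
  by (simp add: l1norm_def sum_distrib_left)

lemma l1norm_sum: "l1norm (\<Sum>m\<in>I. f m) \<le> (\<Sum>m\<in>I. l1norm (f m))"
proof (induction I rule: infinite_finite_induct)
  case (insert m I)
  then show ?case using l1norm_triangle[of "f m" "sum f I"] by simp
qed (simp_all add: l1norm_def)

section \<open>Lipschitz dependence on the parameter and holomorphy of the mean\<close>

context iid_sampling
begin

text \<open>Cauchy's inequality bounds the derivatives of the entries by \<open>B / r\<close>.
  Halving the radius of a disc inside \<open>E\<close> ensures that the circles of radius
  \<open>r\<close> about all points of \<open>ball \<zeta> r\<close> still lie in \<open>E\<close>.
  Since \<open>B\<close> does not depend on the sample, neither do \<open>r\<close> and
  \<open>L\<close>.\<close>

lemma C_lipschitz:
  assumes "\<zeta> \<in> E"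
  obtains r L where "r > 0" "L \<ge> 0" "ball \<zeta> r \<subseteq> E"
    "\<And>z w \<omega>. z \<in> ball \<zeta> r \<Longrightarrow> w \<in> ball \<zeta> r \<Longrightarrow> \<omega> \<in> space \<mu> \<Longrightarrow> l1norm (C z \<omega> - C w \<omega>) \<le> L * cmod (z - w)"
proof -
  obtain B where B: "B \<ge> 0" "\<And>\<zeta> \<omega>. \<zeta> \<in> E \<Longrightarrow> \<omega> \<in> space \<mu> \<Longrightarrow> l1norm (C \<zeta> \<omega>) \<le> B"
    by (rule C_bound_ex) blast
  obtain e where e: "e > 0" "cball \<zeta> e \<subseteq> E" using open_E assms open_contains_cball by blast
  define r where "r = e / 2"
  have r: "r > 0" using e by (simp add: r_def)
  have sub: "cball z r \<subseteq> E" if "z \<in> ball \<zeta> r" for z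
  proof
    fix w assume "w \<in> cball z r"
    then have "dist \<zeta> w \<le> e" using that dist_triangle[of \<zeta> w z] by (simp add: r_def)
    then show "w \<in> E" using e(2) by auto
  qed
  have rE: "ball \<zeta> r \<subseteq> E" using e by (auto simp: r_def)
  have lip: "cmod (C z \<omega> $ i $ j - C w \<omega> $ i $ j) \<le> B / r * cmod (z - w)"
    if zw: "z \<in> ball \<zeta> r" "w \<in> ball \<zeta> r" and \<omega>: "\<omega> \<in> space \<mu>" for z w \<omega> i j
  proof -
    let ?f = "\<lambda>z. C z \<omega> $ i $ j"
    have hol: "?f holomorphic_on E" using C_analytic[OF \<omega>] by (rule analytic_imp_holomorphic)
    show ?thesis
    proof (rule field_differentiable_bound[OF convex_ball _ _ zw])
      fix x assume x: "x \<in> ball \<zeta> r"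
      then show "(?f has_field_derivative deriv ?f x) (at x within ball \<zeta> r)"
        using holomorphic_derivI[OF hol open_E] rE by blast
      have "cmod ((deriv ^^ 1) ?f x) \<le> fact 1 * B / r ^ 1"
      proof (rule Cauchy_inequality)
        show "?f holomorphic_on ball x r"
          by (rule holomorphic_on_subset[OF hol]) (use sub[OF x] ball_subset_cball in blast)
        show "continuous_on (cball x r) ?f"
          by (rule holomorphic_on_imp_continuous_on[OF holomorphic_on_subset[OF hol sub[OF x]]])
        show "cmod (?f y) \<le> B" if "cmod (x - y) = r" for y
        proof -
          have "y \<in> cball x r" using that by (simp add: dist_norm)
          then have "y \<in> E" using sub[OF x] by blast
          then show ?thesis using cmod_entry_le_l1norm B(2)[OF _ \<omega>] order_trans by blast
        qed
      qed (rule r)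
      then show "cmod (deriv ?f x) \<le> B / r" by simp
    qed
  qed
  show ?thesis
  proof (rule that[OF r _ rE])
    show "0 \<le> (real CARD('n))\<^sup>2 * (B / r)" using B r by simp
    show "l1norm (C z \<omega> - C w \<omega>) \<le> (real CARD('n))\<^sup>2 * (B / r) * cmod (z - w)"
      if "z \<in> ball \<zeta> r" "w \<in> ball \<zeta> r" "\<omega> \<in> space \<mu>" for z w \<omega>
      using l1norm_le_const[of "C z \<omega> - C w \<omega>" "B / r * cmod (z - w)"] lip[OF that]
      by (simp add: mult.assoc)
  qed
qed

lemma norm_integral_le:
  fixes f :: "'a \<Rightarrow> complex"
  assumes "\<And>\<omega>. \<omega> \<in> space \<mu> \<Longrightarrow> cmod (f \<omega>) \<le> K" "integrable \<mu> f"
  shows "cmod (\<integral>\<omega>. f \<omega> \<partial>\<mu>) \<le> K"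
proof -
  have "cmod (\<integral>\<omega>. f \<omega> \<partial>\<mu>) \<le> (\<integral>\<omega>. cmod (f \<omega>) \<partial>\<mu>)" by (rule integral_norm_bound)
  also have "\<dots> \<le> (\<integral>\<omega>. K \<partial>\<mu>)" using assms by (intro integral_mono) auto
  finally show ?thesis by (simp add: prob_space)
qed

lemma C_entry_integrable: "\<zeta> \<in> E \<Longrightarrow> integrable \<mu> (\<lambda>\<omega>. C \<zeta> \<omega> $ i $ j)"
  by (rule integrable_bounded_linear[OF bounded_linear_compose[OF bounded_linear_vec_nth bounded_linear_vec_nth]
        integrable_C])

lemma Cmean_entry: "\<zeta> \<in> E \<Longrightarrow> mean_C \<zeta> $ i $ j = (\<integral>\<omega>. C \<zeta> \<omega> $ i $ j \<partial>\<mu>)"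
  unfolding Cmean_def by (rule integral_vec_nth2[OF integrable_C])

lemma Cmean_bound:
  assumes "\<And>\<omega>. \<omega> \<in> space \<mu> \<Longrightarrow> l1norm (C \<zeta> \<omega>) \<le> B" "\<zeta> \<in> E"
  shows "l1norm (mean_C \<zeta>) \<le> (real CARD('n))\<^sup>2 * B"
proof (rule l1norm_le_const)
  fix i j show "cmod (mean_C \<zeta> $ i $ j) \<le> B"
    unfolding Cmean_entry[OF assms(2)]
    by (rule norm_integral_le[OF _ C_entry_integrable[OF assms(2)]])
      (rule order_trans[OF cmod_entry_le_l1norm assms(1)])
qed

lemma Cmean_diff_bound:
  assumes "\<And>\<omega>. \<omega> \<in> space \<mu> \<Longrightarrow> l1norm (C z \<omega> - C w \<omega>) \<le> K" "z \<in> E" "w \<in> E"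
  shows "l1norm (mean_C z - mean_C w) \<le> (real CARD('n))\<^sup>2 * K"
proof (rule l1norm_le_const)
  fix i j
  have "(mean_C z - mean_C w) $ i $ j = (\<integral>\<omega>. C z \<omega> $ i $ j - C w \<omega> $ i $ j \<partial>\<mu>)"
    using C_entry_integrable assms by (simp add: Cmean_entry)
  also have "cmod \<dots> \<le> K"
  proof (rule norm_integral_le)
    show "cmod (C z \<omega> $ i $ j - C w \<omega> $ i $ j) \<le> K" if "\<omega> \<in> space \<mu>" for \<omega>
      using order_trans[OF cmod_entry_le_l1norm[of "C z \<omega> - C w \<omega>" i j] assms(1)[OF that]] by simp
  qed (use C_entry_integrable assms in auto)
  finally show "cmod ((mean_C z - mean_C w) $ i $ j) \<le> K" .
qed

lemma Chat_bound:
  assumes "\<And>\<omega>. \<omega> \<in> space \<mu> \<Longrightarrow> l1norm (C \<zeta> \<omega>) \<le> B" "M \<ge> 1" "\<omega> \<in> space \<mu>"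
  shows "l1norm (emp_C M \<omega> \<zeta>) \<le> B"
proof -
  have "l1norm (\<Sum>m=1..M. C \<zeta> ((\<theta> ^^ m) \<omega>)) \<le> (\<Sum>m=1..M. B)"
    by (rule order_trans[OF l1norm_sum sum_mono[OF assms(1)[OF theta_pow_space[OF assms(3)]]]])
  then show ?thesis using assms(2) unfolding Chat_def l1norm_scaleR by (simp add: field_simps)
qed

lemma Chat_diff_bound:
  assumes "\<And>\<omega>. \<omega> \<in> space \<mu> \<Longrightarrow> l1norm (C z \<omega> - C w \<omega>) \<le> K" "M \<ge> 1" "\<omega> \<in> space \<mu>"
  shows "l1norm (emp_C M \<omega> z - emp_C M \<omega> w) \<le> K"
proof -
  have "emp_C M \<omega> z - emp_C M \<omega> w = (1 / real M) *\<^sub>R (\<Sum>m=1..M. C z ((\<theta> ^^ m) \<omega>) - C w ((\<theta> ^^ m) \<omega>))"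
    by (simp add: Chat_def sum_subtractf scaleR_diff_right)
  moreover have "l1norm (\<Sum>m=1..M. C z ((\<theta> ^^ m) \<omega>) - C w ((\<theta> ^^ m) \<omega>)) \<le> (\<Sum>m=1..M. K)"
    by (rule order_trans[OF l1norm_sum sum_mono[OF assms(1)[OF theta_pow_space[OF assms(3)]]]])
  ultimately show ?thesis using assms(2) by (simp add: l1norm_scaleR field_simps)
qed

lemma Chat_holomorphic:
  assumes "\<omega> \<in> space \<mu>"
  shows "mat_holomorphic (emp_C M \<omega>) E"
  unfolding mat_holomorphic_def
proof (intro allI)
  fix i j
  have "(\<lambda>z. of_real (1 / real M) * (\<Sum>m=1..M. C z ((\<theta> ^^ m) \<omega>) $ i $ j)) holomorphic_on E"
    using C_analytic[OF theta_pow_space[OF assms]]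
    by (intro holomorphic_intros analytic_imp_holomorphic)
  then show "(\<lambda>z. emp_C M \<omega> z $ i $ j) holomorphic_on E"
    unfolding Chat_def scaleR_entry by (simp only: sum_component)
qed

text \<open>The local Lipschitz bound dominates the difference quotients.\<close>

lemma Cmean_holomorphic: "mat_holomorphic mean_C E"
  unfolding mat_holomorphic_def
proof (intro allI)
  fix i j
  show "(\<lambda>z. mean_C z $ i $ j) holomorphic_on E"
    unfolding holomorphic_on_def
  proof
    fix z assume z: "z \<in> E"
    obtain r L where r: "r > 0" "L \<ge> 0" "ball z r \<subseteq> E" and
      lip: "\<And>u w \<omega>. u \<in> ball z r \<Longrightarrow> w \<in> ball z r \<Longrightarrow> \<omega> \<in> space \<mu> \<Longrightarrow> l1norm (C u \<omega> - C w \<omega>) \<le> L * cmod (u - w)"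
      by (rule C_lipschitz[OF z]) blast
    let ?D = "\<integral>\<omega>. deriv (\<lambda>u. C u \<omega> $ i $ j) z \<partial>\<mu>"
    have "((\<lambda>u. (mean_C u $ i $ j - mean_C z $ i $ j) / (u - z)) \<longlongrightarrow> ?D) (at z within ball z r)"
      \<comment> \<open>The limit is tested along sequences, so that dominated convergence
        applies.\<close>
      unfolding tendsto_at_iff_sequentially
    proof (intro allI impI)
      fix X :: "nat \<Rightarrow> complex"
      assume X: "\<forall>n. X n \<in> ball z r - {z}" "X \<longlonglongrightarrow> z"
      let ?q = "\<lambda>n \<omega>. (C (X n) \<omega> $ i $ j - C z \<omega> $ i $ j) / (X n - z)"
      have XE: "X n \<in> E" for n using X(1) r(3) by blast
      have meas: "(\<lambda>\<omega>. C u \<omega> $ i $ j) \<in> borel_measurable \<mu>" if "u \<in> E" for u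
        by (rule borel_measurable_vec_nth2[OF C_measurable[OF that]])
      have lim: "(\<lambda>n. ?q n \<omega>) \<longlonglongrightarrow> deriv (\<lambda>u. C u \<omega> $ i $ j) z" if "\<omega> \<in> space \<mu>" for \<omega>
      proof -
        have "((\<lambda>u. C u \<omega> $ i $ j) has_field_derivative deriv (\<lambda>u. C u \<omega> $ i $ j) z) (at z within ball z r)"
          using holomorphic_derivI[OF analytic_imp_holomorphic[OF C_analytic[OF that]] open_E z] .
        then show ?thesis using X unfolding has_field_derivative_iff tendsto_at_iff_sequentially by (auto simp: o_def)
      qed
      have "(\<lambda>n. \<integral>\<omega>. ?q n \<omega> \<partial>\<mu>) \<longlonglongrightarrow> ?D"
      proof (rule integral_dominated_convergence[where w = "\<lambda>_. L"])
        show qm: "?q n \<in> borel_measurable \<mu>" for n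
          using meas[OF XE[of n]] meas[OF z] by simp
        \<comment> \<open>Measurability of the derivative in \<open>\<omega>\<close> is inherited
          from the difference quotients, of which it is the pointwise limit.\<close>
        show "(\<lambda>\<omega>. deriv (\<lambda>u. C u \<omega> $ i $ j) z) \<in> borel_measurable \<mu>"
          by (rule borel_measurable_LIMSEQ_metric[OF qm lim])
        show "AE \<omega> in \<mu>. norm (?q n \<omega>) \<le> L" for n
        proof (rule AE_I2)
          fix \<omega> assume \<omega>: "\<omega> \<in> space \<mu>"
          have "cmod (C (X n) \<omega> $ i $ j - C z \<omega> $ i $ j) \<le> L * cmod (X n - z)"
            using order_trans[OF cmod_entry_le_l1norm[of "C (X n) \<omega> - C z \<omega>" i j] lip[OF _ _ \<omega>]] X(1) r(1) by simp
          moreover have "X n - z \<noteq> 0" using X(1) by auto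
          ultimately show "norm (?q n \<omega>) \<le> L" by (simp add: norm_divide divide_le_eq)
        qed
      qed (use lim in auto)
      moreover have "(\<integral>\<omega>. ?q n \<omega> \<partial>\<mu>) = (mean_C (X n) $ i $ j - mean_C z $ i $ j) / (X n - z)" for n
        using C_entry_integrable[OF XE[of n]] C_entry_integrable[OF z] by (simp add: Cmean_entry[OF XE] Cmean_entry[OF z])
      ultimately show "((\<lambda>u. (mean_C u $ i $ j - mean_C z $ i $ j) / (u - z)) \<circ> X) \<longlonglongrightarrow> ?D"
        by (simp only: o_def)
    qed
    then have "((\<lambda>u. mean_C u $ i $ j) has_field_derivative ?D) (at z within ball z r)"
      unfolding has_field_derivative_iff .
    then have "((\<lambda>u. mean_C u $ i $ j) has_field_derivative ?D) (at z)"
      using at_within_open[of z "ball z r"] r(1) by (simp only: open_ball centre_in_ball)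
    then show "(\<lambda>u. mean_C u $ i $ j) field_differentiable at z within E"
      using field_differentiable_def field_differentiable_at_within by blast
  qed
qed

end

section \<open>Finiteness of the essential bound\<close>

lemma matrix_diff_ldistrib: "A ** (B - C) = A ** B - A ** (C :: 'a::ring_1^'p^'n)"
  by (simp add: vec_eq_iff matrix_matrix_mult_def right_diff_distrib sum_subtractf)

lemma matrix_diff_rdistrib: "(A - B) ** (C :: 'a::ring_1^'p^'n) = A ** C - B ** C"
  by (simp add: vec_eq_iff matrix_matrix_mult_def left_diff_distrib sum_subtractf)

lemma adj_diff: "adj (A - B) = adj A - adj B"
  by (simp add: adj_def vec_eq_iff)

text \<open>The convention \<open>quot a 0 = \<infinity>\<close> is consistent with multiplying out,
  because \<open>P * 0 \<le> a\<close>.\<close>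

lemma ereal_le_quot_iff: "0 \<le> a \<Longrightarrow> 0 \<le> b \<Longrightarrow> ereal P \<le> quot a b \<longleftrightarrow> P * b \<le> a"
  by (auto simp: quot_def pos_le_divide_eq)

context iid_sampling
begin

lemma mean_hform_nonneg:
  assumes "posdef Q"
  shows "0 \<le> (\<integral>\<omega>. Re (hform Q (Z \<omega>)) \<partial>\<mu>)"
  by (rule integral_nonneg_AE) (simp add: posdef_nonneg[OF assms])

text \<open>Multiplied out, admissibility of \<open>Q\<close> becomes a family of inequalities
  between expected quadratic forms. In this shape it can be perturbed, and the first family is
  directly a variance bound.\<close>

lemma ereal_le_Psym_Q_iff:
  assumes "posdef Q" "\<zeta> \<in> E" "det (mean_C \<zeta>) \<noteq> 0"
  shows "ereal P \<le> PQ \<zeta> Q \<longleftrightarrow>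
    (\<forall>v. P * mean_form Q (dev \<zeta>) v \<le> Re (hform Q v)) \<and>
    (\<forall>v. P * (\<integral>\<omega>. Re (hform (matrix_inv Q) (adj (dev \<zeta> \<omega>) *v v)) \<partial>\<mu>) \<le> Re (hform (matrix_inv Q) v))"
    (is "_ \<longleftrightarrow> (\<forall>v. ?A v) \<and> (\<forall>v. ?B v)")
proof -
  note I = posdef_matrix_inv[OF assms(1)]
  have "ereal P \<le> PQ \<zeta> Q \<longleftrightarrow> (\<forall>v. v \<noteq> 0 \<longrightarrow> ?A v) \<and> (\<forall>v. v \<noteq> 0 \<longrightarrow> ?B v)"
    unfolding Psym_Q_def min_le_iff_disj le_INF_iff hform_Sop[OF assms(2,3)]
    by (simp add: le_INF_iff hform_Sop[OF assms(2,3)]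
        ereal_le_quot_iff[OF posdef_nonneg[OF assms(1)] mean_hform_nonneg[OF assms(1)]]
        ereal_le_quot_iff[OF posdef_nonneg[OF I] mean_hform_nonneg[OF I]])
  moreover have "?A 0" "?B 0" by simp_all
  ultimately show ?thesis by metis
qed

lemma det_nonzero_if_Psym_pos:
  assumes "\<zeta> \<in> E" "0 \<le> P" "Psym \<mu> \<theta> E C \<zeta> > ereal P"
  shows "det (mean_C \<zeta>) \<noteq> 0"
proof
  assume "det (mean_C \<zeta>) = 0"
  then have "\<zeta> \<in> spec E (mean_C)" using assms(1) by (simp add: spec_def det_eq_0_iff_kernel)
  then have "Psym \<mu> \<theta> E C \<zeta> = 0" by (simp add: Psym_def)
  then show False using assms(2,3) by simp
qed

lemma dev_continuous:
  assumes z: "\<zeta> \<in> E" "det (mean_C \<zeta>) \<noteq> 0" and "\<epsilon> > 0"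
  obtains d where "d > 0" "\<And>w. w \<in> ball \<zeta> d \<Longrightarrow> w \<in> E \<and> det (mean_C w) \<noteq> 0"
    "\<And>w \<omega>. w \<in> ball \<zeta> d \<Longrightarrow> \<omega> \<in> space \<mu> \<Longrightarrow> l1norm (dev w \<omega> - dev \<zeta> \<omega>) < \<epsilon>"
proof -
  obtain B where B: "B \<ge> 0" "\<And>\<zeta> \<omega>. \<zeta> \<in> E \<Longrightarrow> \<omega> \<in> space \<mu> \<Longrightarrow> l1norm (C \<zeta> \<omega>) \<le> B"
    by (rule C_bound_ex) blast
  obtain r L where r: "r > 0" "L \<ge> 0" "ball \<zeta> r \<subseteq> E" and
    lip: "\<And>u w \<omega>. u \<in> ball \<zeta> r \<Longrightarrow> w \<in> ball \<zeta> r \<Longrightarrow> \<omega> \<in> space \<mu> \<Longrightarrow> l1norm (C u \<omega> - C w \<omega>) \<le> L * cmod (u - w)"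
    by (rule C_lipschitz[OF z(1)]) blast
  let ?I = "\<lambda>w. matrix_inv (mean_C w)"
  \<comment> \<open>A bound for \<open>dev w \<omega> - dev \<zeta> \<omega>\<close> from the
    splitting into a change of the inverse and a change of the sample. It does not contain
    \<open>\<omega>\<close>, is continuous and vanishes at \<open>\<zeta>\<close>, which makes the
    continuity uniform in the sample.\<close>
  define \<phi> where "\<phi> w = l1norm (?I w - ?I \<zeta>) * B + l1norm (?I \<zeta>) * (L * cmod (w - \<zeta>))" for w
  define U where "U = {w \<in> E. det (mean_C w) \<noteq> 0}"
  have cd: "continuous_on E (\<lambda>w. det (mean_C w))"
    by (rule holomorphic_on_imp_continuous_on[OF holomorphic_on_det[OF Cmean_holomorphic]])
  have "open (E \<inter> (\<lambda>w. det (mean_C w)) -` (- {0}))"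
    by (rule continuous_open_preimage[OF cd open_E]) auto
  moreover have "E \<inter> (\<lambda>w. det (mean_C w)) -` (- {0}) = U" by (auto simp: U_def)
  ultimately have U: "open U" by simp
  have "mat_holomorphic ?I U"
    by (rule mat_holomorphic_inv[OF mat_holomorphic_subset[OF Cmean_holomorphic]]) (auto simp: U_def)
  then have "continuous_on U (\<lambda>w. ?I w $ i $ j)" for i j
    unfolding mat_holomorphic_def using holomorphic_on_imp_continuous_on by blast
  then have "continuous_on U (\<lambda>w. \<chi> i j. ?I w $ i $ j)"
    by (intro continuous_on_vec_lambda)
  then have "continuous_on U ?I" by simp
  then have "continuous_on U \<phi>"
    unfolding \<phi>_def l1norm_def vector_minus_component by (intro continuous_intros)
  then have "open (U \<inter> \<phi> -` {..<\<epsilon>})" by (rule continuous_open_preimage[OF _ U]) auto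
  then have "open (U \<inter> \<phi> -` {..<\<epsilon>} \<inter> ball \<zeta> r)" by auto
  moreover have "\<zeta> \<in> U \<inter> \<phi> -` {..<\<epsilon>} \<inter> ball \<zeta> r"
    using z r assms(3) by (auto simp: U_def \<phi>_def l1norm_def)
  ultimately obtain d where d: "d > 0" "ball \<zeta> d \<subseteq> U \<inter> \<phi> -` {..<\<epsilon>} \<inter> ball \<zeta> r"
    using open_contains_ball by blast
  show ?thesis
  proof (rule that[OF d(1)])
    show "w \<in> E \<and> det (mean_C w) \<noteq> 0" if "w \<in> ball \<zeta> d" for w using that d(2) by (auto simp: U_def)
    fix w \<omega> assume w: "w \<in> ball \<zeta> d" and \<omega>: "\<omega> \<in> space \<mu>"
    have wr: "w \<in> ball \<zeta> r" "\<phi> w < \<epsilon>" "w \<in> E" using w d(2) r(3) by auto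
    have "dev w \<omega> - dev \<zeta> \<omega> = (?I w - ?I \<zeta>) ** C w \<omega> + ?I \<zeta> ** (C w \<omega> - C \<zeta> \<omega>)"
      by (simp add: dev_def matrix_diff_ldistrib matrix_diff_rdistrib)
    then have "l1norm (dev w \<omega> - dev \<zeta> \<omega>)
        \<le> l1norm (?I w - ?I \<zeta>) * l1norm (C w \<omega>) + l1norm (?I \<zeta>) * l1norm (C w \<omega> - C \<zeta> \<omega>)"
      using order_trans[OF l1norm_triangle add_mono[OF l1norm_mult l1norm_mult]] by simp
    also have "\<dots> \<le> \<phi> w"
      unfolding \<phi>_def using B(2)[OF wr(3) \<omega>] lip[OF wr(1) _ \<omega>, of \<zeta>] r(1)
      by (intro add_mono mult_left_mono l1norm_nonneg) auto
    finally show "l1norm (dev w \<omega> - dev \<zeta> \<omega>) < \<epsilon>" using wr(2) by simp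
  qed
qed

text \<open>The constraint at the larger level \<open>P'\<close> uses only the fraction
  \<open>P / P'\<close> of the form on the right. The remaining \<open>1 - P / P'\<close> absorbs
  the perturbation, which is at most a multiple of \<open>\<epsilon> * (norm v)\<^sup>2\<close>.
  \<open>D\<close> is arbitrary, so that the lemma also applies to adjoints.\<close>

lemma second_moment_constraint_stable:
  fixes D D0 :: "'a \<Rightarrow> complex^'n^'n"
  assumes int: "integrable \<mu> (\<lambda>\<omega>. Re (hform Q (D \<omega> *v v)))" "integrable \<mu> (\<lambda>\<omega>. Re (hform Q (D0 \<omega> *v v)))"
    and bd: "\<And>\<omega>. \<omega> \<in> space \<mu> \<Longrightarrow> l1norm (D0 \<omega>) \<le> B" "B \<ge> 0"
    and close: "\<And>\<omega>. \<omega> \<in> space \<mu> \<Longrightarrow> l1norm (D \<omega> - D0 \<omega>) \<le> \<epsilon>" "0 \<le> \<epsilon>" "\<epsilon> \<le> 1"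
    and m: "m * (norm v)\<^sup>2 \<le> Re (hform Q v)" "m > 0"
    and P: "0 \<le> P" "P < P'"
    and le: "P' * mean_form Q D0 v \<le> Re (hform Q v)"
    and small: "P * (real CARD('n) * l1norm Q * (2 * B + 1)) * \<epsilon> \<le> (1 - P / P') * m"
  shows "P * mean_form Q D v \<le> Re (hform Q v)"
proof -
  let ?k = "real CARD('n) * l1norm Q"
  have k: "?k \<ge> 0" by (simp add: l1norm_nonneg)
  let ?n = "(norm v)\<^sup>2"
  have pt: "Re (hform Q (D \<omega> *v v)) \<le> Re (hform Q (D0 \<omega> *v v)) + ?k * (2 * B + 1) * \<epsilon> * ?n" if \<omega>: "\<omega> \<in> space \<mu>" for \<omega>
  proof -
    let ?a = "D0 \<omega> *v v" and ?d = "(D \<omega> - D0 \<omega>) *v v"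
    have d: "norm ?d \<le> \<epsilon> * norm v"
      by (rule order_trans[OF norm_mult_vec_le mult_right_mono[OF close(1)[OF \<omega>]]]) simp
    have a: "norm ?a \<le> B * norm v"
      by (rule order_trans[OF norm_mult_vec_le mult_right_mono[OF bd(1)[OF \<omega>]]]) simp
    have ad: "D \<omega> *v v = ?a + ?d" by (simp add: matrix_vector_mult_diff_rdistrib)
    have "Re (hform Q (?a + ?d)) - Re (hform Q ?a) \<le> cmod (hform Q (?a + ?d) - hform Q ?a)"
      using complex_Re_le_cmod[of "hform Q (?a + ?d) - hform Q ?a"] by simp
    also have "\<dots> \<le> ?k * (norm ?d * (2 * norm ?a + norm ?d))" by (rule norm_hform_add_diff_le)
    also have "\<dots> \<le> ?k * ((\<epsilon> * norm v) * (2 * (B * norm v) + 1 * norm v))"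
      using d a close(2,3) by (intro mult_left_mono[OF _ k] mult_mono add_mono mult_left_mono
          order_trans[OF d mult_right_mono]) auto
    also have "\<dots> = ?k * (2 * B + 1) * \<epsilon> * ?n" by (simp add: power2_eq_square algebra_simps)
    finally show ?thesis unfolding ad by simp
  qed
  have "mean_form Q D v \<le> (\<integral>\<omega>. Re (hform Q (D0 \<omega> *v v)) + ?k * (2 * B + 1) * \<epsilon> * ?n \<partial>\<mu>)"
    using int pt by (intro integral_mono) auto
  also have "\<dots> = mean_form Q D0 v + ?k * (2 * B + 1) * \<epsilon> * ?n"
    using int by (simp add: prob_space)
  finally have "P * mean_form Q D v
      \<le> P * mean_form Q D0 v + P * (?k * (2 * B + 1)) * \<epsilon> * ?n"
    using P(1) by (auto dest: mult_left_mono[OF _ P(1)] simp: algebra_simps)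
  also have "P * mean_form Q D0 v \<le> P / P' * Re (hform Q v)"
    using mult_left_mono[OF le, of "P / P'"] P by simp
  also have "P * (?k * (2 * B + 1)) * \<epsilon> * ?n \<le> (1 - P / P') * m * ?n"
    by (rule mult_right_mono[OF small]) simp
  also have "\<dots> \<le> (1 - P / P') * Re (hform Q v)"
    using mult_left_mono[OF m(1), of "1 - P / P'"] P by (simp add: mult.assoc)
  finally show ?thesis by (simp add: algebra_simps)
qed

definition R_at :: "complex \<Rightarrow> complex^'n^'n \<Rightarrow> ereal" where
  "R_at \<zeta> Q = esssup \<mu> (\<lambda>\<omega>. ereal (qopnorm Q (dev \<zeta> \<omega>)))"

lemma R_bd_eq: "R_bd \<mu> \<theta> C P S = (SUP \<zeta>\<in>S. INF Q\<in>{Q. posdef Q \<and> PQ \<zeta> Q \<ge> ereal P}. R_at \<zeta> Q)"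
  by (simp add: R_bd_def R_at_def dev_def)

text \<open>One form chosen at \<open>\<zeta>\<close> with level strictly above \<open>P\<close>
  stays admissible at level \<open>P\<close> for all nearby \<open>w\<close>, so it competes in the
  infimum there. Its essential supremum is bounded because the samples are.\<close>

lemma R_at_locally_bounded:
  assumes z: "\<zeta> \<in> E" and P: "0 \<le> P" and Psym: "Psym \<mu> \<theta> E C \<zeta> > ereal P"
  obtains d K where "d > 0" "\<And>w. w \<in> ball \<zeta> d \<Longrightarrow>
    (INF Q\<in>{Q. posdef Q \<and> PQ w Q \<ge> ereal P}. R_at w Q) \<le> ereal K"
proof -
  have nz: "det (mean_C \<zeta>) \<noteq> 0" by (rule det_nonzero_if_Psym_pos[OF assms])
  have "\<zeta> \<notin> spec E (mean_C)" using nz by (simp add: spec_def flip: det_eq_0_iff_kernel)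
  then have "ereal P < (SUP Q\<in>{Q. posdef Q}. PQ \<zeta> Q)" using Psym by (simp add: Psym_def)
  then obtain Q where Q: "posdef Q" "ereal P < PQ \<zeta> Q" by (auto simp: less_SUP_iff)
  obtain P' where P': "P < P'" "ereal P' \<le> PQ \<zeta> Q"
    using ereal_dense2[OF Q(2)] by auto
  note QI = posdef_matrix_inv[OF Q(1)]
  have c1: "\<And>v. P' * mean_form Q (dev \<zeta>) v \<le> Re (hform Q v)"
    and c2: "\<And>v. P' * (\<integral>\<omega>. Re (hform (matrix_inv Q) (adj (dev \<zeta> \<omega>) *v v)) \<partial>\<mu>) \<le> Re (hform (matrix_inv Q) v)"
    using P'(2) ereal_le_Psym_Q_iff[OF Q(1) z nz] by blast+
  obtain m1 where m1: "m1 > 0" "\<And>v. m1 * (norm v)\<^sup>2 \<le> Re (hform Q v)"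
    by (rule posdef_lower_bound[OF Q(1)]) blast
  obtain m2 where m2: "m2 > 0" "\<And>v. m2 * (norm v)\<^sup>2 \<le> Re (hform (matrix_inv Q) v)"
    by (rule posdef_lower_bound[OF QI]) blast
  obtain B where B: "B \<ge> 0" "\<And>\<omega>. \<omega> \<in> space \<mu> \<Longrightarrow> l1norm (dev \<zeta> \<omega>) \<le> B" by (rule dev_bound_ex[OF z]) blast
  obtain k where k: "k \<ge> 0" "\<And>A v. qnorm Q (A *v v) \<le> k * l1norm A * qnorm Q v"
    by (rule qnorm_mult_bound[OF Q(1)]) blast
  define a where "a = P * (real CARD('n) * l1norm Q * (2 * B + 1))"
  define b where "b = P * (real CARD('n) * l1norm (matrix_inv Q) * (2 * B + 1))"
  have ab: "a \<ge> 0" "b \<ge> 0" using P B(1) by (auto simp: a_def b_def l1norm_nonneg)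
  have g: "1 - P / P' > 0" using P P'(1) by simp
  \<comment> \<open>Small enough for both constraints at once; the denominators \<open>a + 1\<close>
    and \<open>b + 1\<close> cover the case \<open>P = 0\<close>, where \<open>a\<close> and
    \<open>b\<close> vanish.\<close>
  define \<epsilon> where "\<epsilon> = min 1 (min ((1 - P / P') * m1 / (a + 1)) ((1 - P / P') * m2 / (b + 1)))"
  have e: "0 < \<epsilon>" "\<epsilon> \<le> 1" using g m1(1) m2(1) ab by (auto simp: \<epsilon>_def intro!: divide_pos_pos mult_pos_pos)
  have small: "a * \<epsilon> \<le> (1 - P / P') * m1" "b * \<epsilon> \<le> (1 - P / P') * m2"
  proof -
    have *: "x * \<epsilon> \<le> y" if "x \<ge> 0" "\<epsilon> \<le> y / (x + 1)" for x y
    proof -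
      have "x * \<epsilon> \<le> (x + 1) * \<epsilon>" using e by (simp add: algebra_simps)
      also have "\<dots> \<le> y" using that by (simp add: pos_le_divide_eq mult.commute)
      finally show ?thesis .
    qed
    show "a * \<epsilon> \<le> (1 - P / P') * m1" by (rule *[OF ab(1)]) (simp add: \<epsilon>_def)
    show "b * \<epsilon> \<le> (1 - P / P') * m2" by (rule *[OF ab(2)]) (simp add: \<epsilon>_def)
  qed
  obtain d where d: "d > 0" "\<And>w. w \<in> ball \<zeta> d \<Longrightarrow> w \<in> E \<and> det (mean_C w) \<noteq> 0"
    "\<And>w \<omega>. w \<in> ball \<zeta> d \<Longrightarrow> \<omega> \<in> space \<mu> \<Longrightarrow> l1norm (dev w \<omega> - dev \<zeta> \<omega>) < \<epsilon>"
    by (rule dev_continuous[OF z nz e(1)]) blast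
  show ?thesis
  proof (rule that[OF d(1)])
    fix w assume w: "w \<in> ball \<zeta> d"
    then have wE: "w \<in> E" "det (mean_C w) \<noteq> 0" using d(2) by auto
    have cl: "l1norm (dev w \<omega> - dev \<zeta> \<omega>) \<le> \<epsilon>" if "\<omega> \<in> space \<mu>" for \<omega>
      using d(3)[OF w that] by simp
    have cl': "l1norm (adj (dev w \<omega>) - adj (dev \<zeta> \<omega>)) \<le> \<epsilon>" if "\<omega> \<in> space \<mu>" for \<omega>
      using cl[OF that] by (simp add: l1norm_adj flip: adj_diff)
    have B': "l1norm (adj (dev \<zeta> \<omega>)) \<le> B" if "\<omega> \<in> space \<mu>" for \<omega>
      using B(2)[OF that] by (simp add: l1norm_adj)
    note Iw = hform_Sop[OF wE] and Iz = hform_Sop[OF z nz]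
    have "P * mean_form Q (dev w) v \<le> Re (hform Q v)" for v
      by (rule second_moment_constraint_stable[OF Iw(3) Iz(3) B(2,1) cl less_imp_le[OF e(1)] e(2)
          m1(2,1) P P'(1) c1 small(1)[unfolded a_def]])
    \<comment> \<open>The same stability argument for the adjoints and the inverse form;
      \<open>l1norm\<close> is invariant under \<open>adj\<close>, so the bounds carry over
      unchanged.\<close>
    moreover have "P * (\<integral>\<omega>. Re (hform (matrix_inv Q) (adj (dev w \<omega>) *v v)) \<partial>\<mu>) \<le> Re (hform (matrix_inv Q) v)" for v
      by (rule second_moment_constraint_stable[OF Iw(4) Iz(4) B' B(1) cl' less_imp_le[OF e(1)] e(2)
          m2(2,1) P P'(1) c2 small(2)[unfolded b_def]])
    ultimately have "ereal P \<le> PQ w Q" using ereal_le_Psym_Q_iff[OF Q(1) wE] by blast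
    then have "(INF Q\<in>{Q. posdef Q \<and> PQ w Q \<ge> ereal P}. R_at w Q) \<le> R_at w Q"
      using Q(1) by (intro INF_lower) auto
    also have "R_at w Q \<le> ereal (k * (B + 1))"
      unfolding R_at_def
    proof (rule esssup_I)
      show "(\<lambda>\<omega>. ereal (qopnorm Q (dev w \<omega>))) \<in> borel_measurable \<mu>"
        by (intro borel_measurable_ereal measurable_compose[OF dev_measurable[OF wE(1)] borel_measurable_qopnorm[OF Q(1)]])
      show "AE \<omega> in \<mu>. ereal (qopnorm Q (dev w \<omega>)) \<le> ereal (k * (B + 1))"
      proof (rule AE_I2)
        fix \<omega> assume \<omega>: "\<omega> \<in> space \<mu>"
        have "l1norm (dev w \<omega>) \<le> l1norm (dev \<zeta> \<omega>) + l1norm (dev w \<omega> - dev \<zeta> \<omega>)"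
          using l1norm_triangle[of "dev \<zeta> \<omega>" "dev w \<omega> - dev \<zeta> \<omega>"] by simp
        also have "\<dots> \<le> B + 1" using B(2)[OF \<omega>] cl[OF \<omega>] e(2) by simp
        finally have "k * l1norm (dev w \<omega>) \<le> k * (B + 1)" using k(1) by (rule mult_left_mono)
        moreover have "qopnorm Q (dev w \<omega>) \<le> k * l1norm (dev w \<omega>)"
          by (rule qopnorm_le[OF Q(1) k(2)])
        ultimately show "ereal (qopnorm Q (dev w \<omega>)) \<le> ereal (k * (B + 1))" by simp
      qed
    qed
    finally show "(INF Q\<in>{Q. posdef Q \<and> PQ w Q \<ge> ereal P}. R_at w Q) \<le> ereal (k * (B + 1))" .
  qed
qed

lemma R_bd_finite:
  assumes S: "compact S" "S \<subseteq> E" and P: "0 \<le> P" and Psym: "\<And>\<zeta>. \<zeta> \<in> S \<Longrightarrow> Psym \<mu> \<theta> E C \<zeta> > ereal P"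
  shows "R_bd \<mu> \<theta> C P S < \<infinity>"
proof -
  let ?f = "\<lambda>w. INF Q\<in>{Q. posdef Q \<and> PQ w Q \<ge> ereal P}. R_at w Q"
  have "\<exists>d K. d > 0 \<and> (\<forall>w\<in>ball \<zeta> d. ?f w \<le> ereal K)" if "\<zeta> \<in> S" for \<zeta>
  proof -
    have "\<zeta> \<in> E" using that S(2) by blast
    then show ?thesis using R_at_locally_bounded[OF _ P Psym[OF that]] by metis
  qed
  then obtain d K where dK: "\<And>\<zeta>. \<zeta> \<in> S \<Longrightarrow> d \<zeta> > 0" "\<And>\<zeta> w. \<zeta> \<in> S \<Longrightarrow> w \<in> ball \<zeta> (d \<zeta>) \<Longrightarrow> ?f w \<le> ereal (K \<zeta>)"
    by metis
  have "S \<subseteq> (\<Union>\<zeta>\<in>S. ball \<zeta> (d \<zeta>))" using dK(1) by force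
  then obtain T where T: "T \<subseteq> S" "finite T" "S \<subseteq> (\<Union>\<zeta>\<in>T. ball \<zeta> (d \<zeta>))"
    using compactE_image[OF S(1), of S "\<lambda>\<zeta>. ball \<zeta> (d \<zeta>)"] by auto
  have "R_bd \<mu> \<theta> C P S \<le> ereal (\<Sum>\<zeta>\<in>T. \<bar>K \<zeta>\<bar>)"
    unfolding R_bd_eq
  proof (rule SUP_least)
    fix w assume "w \<in> S"
    then obtain \<zeta> where \<zeta>: "\<zeta> \<in> T" "w \<in> ball \<zeta> (d \<zeta>)" using T(3) by blast
    then have "?f w \<le> ereal (K \<zeta>)" using dK(2) T(1) by blast
    also have "K \<zeta> \<le> \<bar>K \<zeta>\<bar>" by simp
    also have "\<bar>K \<zeta>\<bar> \<le> (\<Sum>\<zeta>\<in>T. \<bar>K \<zeta>\<bar>)" using \<zeta>(1) T(2) by (intro member_le_sum) auto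
    finally show "?f w \<le> ereal (\<Sum>\<zeta>\<in>T. \<bar>K \<zeta>\<bar>)" by simp
  qed
  then show ?thesis by (rule le_less_trans) simp
qed

end

section \<open>Singular homotopies\<close>

lemma scaleR_matrix_vector: "(r *\<^sub>R (A :: complex^'n^'n)) *v v = r *\<^sub>R (A *v v)"
  by (simp add: vec_eq_iff matrix_vector_mult_def scaleR_sum_right)

lemma sesq_scaleR_right: "sesq Q u (r *\<^sub>R v) = of_real r * sesq Q u v"
  by (simp add: scaleR_conv_smult sesq_scale_right)

lemma linear_sesq_apply: "linear (\<lambda>Z :: complex^'n^'n. Re (sesq Q u (Z *v v)))"
  by (rule linearI)
    (simp_all add: matrix_vector_mult_add_rdistrib sesq_add_right scaleR_matrix_vector sesq_scaleR_right)

lemma sum_matrix_vector: "(\<Sum>i\<in>I. (A i :: complex^'n^'n)) *v v = (\<Sum>i\<in>I. A i *v v)"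
  by (induction I rule: infinite_finite_induct)
    (simp_all add: matrix_vector_mult_add_rdistrib)

text \<open>The multiplicity \<open>m\<close> is left abstract, so that the argument serves
  \<open>alg_mult\<close> and \<open>riesz_rank\<close> alike; it is only compared with the order of
  the zero at isolated zeros.\<close>

lemma count_in_eq_zero_count:
  fixes A :: "complex \<Rightarrow> complex^'n^'n"
  assumes F: "F \<subseteq> E" "compact F" and A: "mat_holomorphic A E"
    and nz: "\<And>z. z \<in> frontier F \<Longrightarrow> det (A z) \<noteq> 0"
    and m: "\<And>\<zeta>. \<zeta> \<in> F \<Longrightarrow> det (A \<zeta>) = 0 \<Longrightarrow> \<forall>\<^sub>F w in at \<zeta>. det (A w) \<noteq> 0 \<Longrightarrow>
      int (m \<zeta>) = zorder (\<lambda>z. det (A z)) \<zeta>"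
  shows "count_in (spec E A) m F = enat (nat (zero_count (\<lambda>z. det (A z)) F))"
proof -
  have hd: "(\<lambda>z. det (A z)) holomorphic_on E" using A by (rule holomorphic_on_det)
  have eq: "spec E A \<inter> F = {z\<in>F. det (A z) = 0}"
    using F(1) unfolding spec_def det_eq_0_iff_kernel by blast
  have fin: "finite (spec E A \<inter> F)" unfolding eq by (rule finite_zeros_compact[OF F hd nz])
  have "int (\<Sum>\<zeta>\<in>spec E A \<inter> F. m \<zeta>) = (\<Sum>\<zeta>\<in>spec E A \<inter> F. zorder (\<lambda>z. det (A z)) \<zeta>)"
    unfolding of_nat_sum
  proof (rule sum.cong[OF refl])
    fix \<zeta> assume "\<zeta> \<in> spec E A \<inter> F"
    then have z: "\<zeta> \<in> F" "det (A \<zeta>) = 0" by (auto simp: eq)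
    show "int (m \<zeta>) = zorder (\<lambda>z. det (A z)) \<zeta>"
      by (rule m[OF z eventually_nonzero_at[OF F hd nz z]])
  qed
  then have "int (\<Sum>\<zeta>\<in>spec E A \<inter> F. m \<zeta>) = zero_count (\<lambda>z. det (A z)) F"
    by (simp add: zero_count_def eq)
  then have "nat (zero_count (\<lambda>z. det (A z)) F) = (\<Sum>\<zeta>\<in>spec E A \<inter> F. m \<zeta>)" by (simp flip: of_nat_sum)
  then show ?thesis using fin by (simp add: count_in_def)
qed

lemma zero_count_det_eq:
  fixes A0 A1 :: "complex \<Rightarrow> complex^'n^'n"
  assumes F: "F \<subseteq> E" "compact F" and A: "mat_holomorphic A0 E" "mat_holomorphic A1 E"
    and nz: "\<And>s z. s \<in> {0..1} \<Longrightarrow> z \<in> frontier F \<Longrightarrow> det (A0 z + s *\<^sub>R (A1 z - A0 z)) \<noteq> 0"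
  shows "zero_count (\<lambda>z. det (A0 z)) F = zero_count (\<lambda>z. det (A1 z)) F"
proof -
  have entry: "(A0 z + s *\<^sub>R (A1 z - A0 z)) $ i $ j = A0 z $ i $ j + of_real s * (A1 z $ i $ j - A0 z $ i $ j)"
    for z s i j using scaleR_entry[of s "A1 z - A0 z" i j] by simp
  have h: "(\<lambda>z. A0 z $ i $ j) holomorphic_on E" "(\<lambda>z. A1 z $ i $ j) holomorphic_on E" for i j
    using A by (auto simp: mat_holomorphic_def)
  have c: "continuous_on ({0..1} \<times> F) (\<lambda>x. A0 (snd x) $ i $ j)" "continuous_on ({0..1} \<times> F) (\<lambda>x. A1 (snd x) $ i $ j)" for i j
    by (rule continuous_on_compose2[OF holomorphic_on_imp_continuous_on[OF holomorphic_on_subset[OF h(1) F(1)]]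
        continuous_on_snd[OF continuous_on_id]], force)
      (rule continuous_on_compose2[OF holomorphic_on_imp_continuous_on[OF holomorphic_on_subset[OF h(2) F(1)]]
        continuous_on_snd[OF continuous_on_id]], force)
  have "zero_count ((\<lambda>s z. det (A0 z + s *\<^sub>R (A1 z - A0 z))) 0) F = zero_count ((\<lambda>s z. det (A0 z + s *\<^sub>R (A1 z - A0 z))) 1) F"
  proof (rule zero_count_homotopy[OF F _ _ nz])
    show "(\<lambda>z. det (A0 z + s *\<^sub>R (A1 z - A0 z))) holomorphic_on E" for s
      by (rule holomorphic_on_det) (auto simp: mat_holomorphic_def entry intro!: holomorphic_intros h
        simp del: vector_add_component vector_scaleR_component)
    show "continuous_on ({0..1} \<times> F) (\<lambda>(s, z). det (A0 z + s *\<^sub>R (A1 z - A0 z)))"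
      unfolding split_beta det_def entry
      by (intro continuous_intros c)
  qed
  then show ?thesis by simp
qed

section \<open>Tails of one scalar form and the cover of the boundary pairs\<close>

context iid_sampling
begin

text \<open>The sign and the normalisation by the form are such that a singular matrix on the
  segment with kernel vector \<open>v\<close> forces the average of these variables to be at least
  \<open>1\<close>.\<close>

definition dev_form :: "complex \<Rightarrow> complex^'n^'n \<Rightarrow> complex^'n \<Rightarrow> 'a \<Rightarrow> real" where
  "dev_form \<zeta> Q v \<omega> = - Re (sesq Q v (dev \<zeta> \<omega> *v v)) / Re (hform Q v)"

text \<open>Cauchy-Schwarz in the form \<open>Q\<close> yields both inputs of the tail bound. It
  bounds the variable by \<open>qopnorm Q\<close> of \<open>dev\<close>, hence by \<open>R\<close>,
  and its square by the ratio of the form at \<open>dev \<zeta> \<omega> *v v\<close> to the form at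
  \<open>v\<close>, whose mean is at most \<open>1 / P\<close> by admissibility.\<close>

lemma dev_form_tail:
  assumes z: "\<zeta> \<in> E" "det (mean_C \<zeta>) \<noteq> 0" and Q: "posdef Q" "ereal P \<le> PQ \<zeta> Q" and P: "P > 0"
    and R: "AE \<omega> in \<mu>. qopnorm Q (dev \<zeta> \<omega>) \<le> R" and v: "v \<noteq> 0"
    and tail: "uniform_tail_bound R (1 / P) (1 - \<eta>) b"
    and M: "M \<ge> 1"
  shows "prob {\<omega> \<in> space \<mu>. real M * (1 - \<eta>) \<le> (\<Sum>m=1..M. dev_form \<zeta> Q v ((\<theta> ^^ m) \<omega>))} \<le> exp (- (b * real M))"
    and "{\<omega> \<in> space \<mu>. real M * (1 - \<eta>) \<le> (\<Sum>m=1..M. dev_form \<zeta> Q v ((\<theta> ^^ m) \<omega>))} \<in> events"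
proof -
  let ?q = "Re (hform Q v)" and ?I = "matrix_inv (mean_C \<zeta>)"
  have q: "?q > 0" using Q(1) v by (simp add: posdef_def)
  \<comment> \<open>The variable as a Borel function of the sample matrix alone, so that
    independence passes from the matrices to the variables.\<close>
  define f where "f Z = - Re (sesq Q v ((?I ** Z - mat 1) *v v)) / ?q" for Z
  have f_dev: "f (C \<zeta> \<omega>) = dev_form \<zeta> Q v \<omega>" for \<omega> by (simp add: f_def dev_form_def dev_def)
  have "continuous_on UNIV (\<lambda>Z. Re (sesq Q v (Z *v v)))"
    using linear_sesq_apply[of Q v v] by (simp add: linear_continuous_on linear_conv_bounded_linear)
  then have "continuous_on UNIV (\<lambda>Z. Re (sesq Q v ((?I ** Z - mat 1) *v v)))"
    by (rule continuous_on_compose2[where f = "\<lambda>Z. ?I ** Z - mat 1"])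
      (intro continuous_intros continuous_on_matrix_mult_left, simp)
  then have "continuous_on UNIV f" unfolding f_def using q
    by (intro continuous_on_divide continuous_on_minus continuous_on_const) auto
  then have fm: "f \<in> borel_measurable borel" by (rule borel_measurable_continuous_onI)
  have ym: "dev_form \<zeta> Q v \<in> borel_measurable \<mu>"
    using measurable_compose[OF C_measurable[OF z(1)] fm] by (simp add: f_dev)
  have ymm: "(\<lambda>\<omega>. dev_form \<zeta> Q v ((\<theta> ^^ m) \<omega>)) \<in> borel_measurable \<mu>" for m
    by (rule measurable_compose[OF theta_pow_measurable ym])
  have "(\<lambda>\<omega>. \<Sum>m=1..M. dev_form \<zeta> Q v ((\<theta> ^^ m) \<omega>)) \<in> borel_measurable \<mu>" using ymm by simp
  then show "{\<omega> \<in> space \<mu>. real M * (1 - \<eta>) \<le> (\<Sum>m=1..M. dev_form \<zeta> Q v ((\<theta> ^^ m) \<omega>))} \<in> events"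
    by measurable
  have ind: "indep_vars (\<lambda>_. borel) (\<lambda>m \<omega>. dev_form \<zeta> Q v ((\<theta> ^^ m) \<omega>)) {1..M}"
    using indep_vars_compose2[OF indep_vars_subset[OF indep_samples_at[OF z(1)], of "{1..M}"], of "\<lambda>_. f" "\<lambda>_. borel"] fm
    by (simp add: f_dev)
  have bnd: "AE \<omega> in \<mu>. \<bar>dev_form \<zeta> Q v ((\<theta> ^^ m) \<omega>)\<bar> \<le> R" for m
  proof (rule AE_theta_pow)
    show "AE \<omega> in \<mu>. \<bar>dev_form \<zeta> Q v \<omega>\<bar> \<le> R"
      using R
    proof eventually_elim
      case (elim \<omega>)
      have "\<bar>Re (sesq Q v (dev \<zeta> \<omega> *v v))\<bar> \<le> cmod (sesq Q v (dev \<zeta> \<omega> *v v))" by (rule abs_Re_le_cmod)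
      also have "\<dots> \<le> qnorm Q v * qnorm Q (dev \<zeta> \<omega> *v v)" by (rule posdef_cauchy_schwarz[OF Q(1)])
      also have "\<dots> \<le> qnorm Q v * (R * qnorm Q v)"
        by (intro mult_left_mono qnorm_nonneg[OF Q(1)] order_trans[OF qnorm_mult_le_qopnorm[OF Q(1)]]
            mult_right_mono elim)
      also have "\<dots> = R * ?q" using q by (simp add: qnorm_def)
      finally show ?case using q by (simp add: dev_form_def pos_divide_le_eq abs_divide)
    qed
  qed
  have int_dev: "integrable \<mu> (dev \<zeta>)"
    using integrable_bounded_linear[OF bounded_linear_matrix_mult_left integrable_C[OF z(1)], of ?I]
    by (simp add: dev_def[abs_def])
  have mean_dev: "(\<integral>\<omega>. dev \<zeta> \<omega> \<partial>\<mu>) = 0"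
    by (simp add: vec_eq_iff integral_vec_nth2[OF int_dev] dev_mean[OF z])
  have "(\<integral>\<omega>. Re (sesq Q v (dev \<zeta> \<omega> *v v)) \<partial>\<mu>) = 0"
    using integral_linear_matrix[OF int_dev linear_sesq_apply[of Q v v]] linear_0[OF linear_sesq_apply[of Q v v]]
    by (simp only: mean_dev)
  then have mean0: "expectation (dev_form \<zeta> Q v) = 0" by (simp add: dev_form_def[abs_def])
  have mean: "expectation (\<lambda>\<omega>. dev_form \<zeta> Q v ((\<theta> ^^ m) \<omega>)) = 0" for m
    using integral_theta_pow[OF ym, of m] mean0 by simp
  have sq: "(dev_form \<zeta> Q v \<omega>)\<^sup>2 \<le> Re (hform Q (dev \<zeta> \<omega> *v v)) / ?q" for \<omega>
  proof -
    have "(Re (sesq Q v (dev \<zeta> \<omega> *v v)))\<^sup>2 \<le> (cmod (sesq Q v (dev \<zeta> \<omega> *v v)))\<^sup>2"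
      using abs_Re_le_cmod by (metis abs_le_square_iff abs_norm_cancel)
    also have "\<dots> \<le> ?q * Re (hform Q (dev \<zeta> \<omega> *v v))" by (rule posdef_cauchy_schwarz_sq[OF Q(1)])
    finally have "(Re (sesq Q v (dev \<zeta> \<omega> *v v)))\<^sup>2 / ?q\<^sup>2 \<le> ?q * Re (hform Q (dev \<zeta> \<omega> *v v)) / ?q\<^sup>2"
      by (rule divide_right_mono) simp
    also have "\<dots> = Re (hform Q (dev \<zeta> \<omega> *v v)) / ?q" using q by (simp add: power2_eq_square)
    finally show ?thesis by (simp add: dev_form_def power_divide)
  qed
  have var0: "expectation (\<lambda>\<omega>. (dev_form \<zeta> Q v \<omega>)\<^sup>2) \<le> 1 / P"
  proof -
    have "expectation (\<lambda>\<omega>. (dev_form \<zeta> Q v \<omega>)\<^sup>2) \<le> expectation (\<lambda>\<omega>. Re (hform Q (dev \<zeta> \<omega> *v v)) / ?q)"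
    proof (rule integral_mono_AE')
      show "integrable \<mu> (\<lambda>\<omega>. Re (hform Q (dev \<zeta> \<omega> *v v)) / ?q)" using hform_Sop(3)[OF z] by simp
    qed (use sq q in \<open>auto intro!: divide_nonneg_pos posdef_nonneg[OF Q(1)]\<close>)
    also have "\<dots> = expectation (\<lambda>\<omega>. Re (hform Q (dev \<zeta> \<omega> *v v))) / ?q" by simp
    also have "\<dots> \<le> 1 / P"
    proof -
      have "P * expectation (\<lambda>\<omega>. Re (hform Q (dev \<zeta> \<omega> *v v))) \<le> ?q"
        using Q(2) ereal_le_Psym_Q_iff[OF Q(1) z] by blast
      then show ?thesis using q P by (simp add: divide_simps mult.commute)
    qed
    finally show ?thesis .
  qed
  have var: "expectation (\<lambda>\<omega>. (dev_form \<zeta> Q v ((\<theta> ^^ m) \<omega>))\<^sup>2) \<le> 1 / P" for m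
    using integral_theta_pow[of "\<lambda>\<omega>. (dev_form \<zeta> Q v \<omega>)\<^sup>2" m] ym var0 by simp
  show "prob {\<omega> \<in> space \<mu>. real M * (1 - \<eta>) \<le> (\<Sum>m=1..M. dev_form \<zeta> Q v ((\<theta> ^^ m) \<omega>))} \<le> exp (- (b * real M))"
    using tail[unfolded uniform_tail_bound_def, THEN spec, THEN spec,
        of "\<lambda>m \<omega>. dev_form \<zeta> Q v ((\<theta> ^^ m) \<omega>)" "{1..M}"] ind bnd mean var M
    by simp
qed

text \<open>The singular equation at \<open>(w, u)\<close> is tested with a functional built from
  the fixed \<open>\<zeta>\<close>, \<open>Q\<close>, \<open>v\<close>, and both of its terms are
  then moved to \<open>(\<zeta>, v)\<close>. Each move costs at most half of \<open>\<eta>\<close>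
  times the form at \<open>v\<close>. The bounds used hold for every sample and every
  \<open>M\<close>, so \<open>\<delta>\<close> depends on neither.\<close>

lemma failure_implies_dev_form_large:
  assumes z: "\<zeta> \<in> E" "det (mean_C \<zeta>) \<noteq> 0" and Q: "posdef Q" and v: "norm v = 1" and \<eta>: "0 < \<eta>" "\<eta> < 1"
  obtains \<delta> where "\<delta> > 0"
    "\<And>M \<omega> w u s. M \<ge> 1 \<Longrightarrow> \<omega> \<in> space \<mu> \<Longrightarrow> w \<in> ball \<zeta> \<delta> \<Longrightarrow> u \<in> ball v \<delta> \<Longrightarrow> norm u = 1 \<Longrightarrow> s \<in> {0..1} \<Longrightarrow>
      (mean_C w + s *\<^sub>R (emp_C M \<omega> w - mean_C w)) *v u = 0 \<Longrightarrow>
      real M * (1 - \<eta>) \<le> (\<Sum>m=1..M. dev_form \<zeta> Q v ((\<theta> ^^ m) \<omega>))"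
proof -
  obtain B where B: "B \<ge> 0" "\<And>\<zeta> \<omega>. \<zeta> \<in> E \<Longrightarrow> \<omega> \<in> space \<mu> \<Longrightarrow> l1norm (C \<zeta> \<omega>) \<le> B"
    by (rule C_bound_ex) blast
  obtain r L where r: "r > 0" "L \<ge> 0" "ball \<zeta> r \<subseteq> E" and
    lip: "\<And>u w \<omega>. u \<in> ball \<zeta> r \<Longrightarrow> w \<in> ball \<zeta> r \<Longrightarrow> \<omega> \<in> space \<mu> \<Longrightarrow> l1norm (C u \<omega> - C w \<omega>) \<le> L * cmod (u - w)"
    by (rule C_lipschitz[OF z(1)]) blast
  let ?q = "Re (hform Q v)" and ?I = "matrix_inv (mean_C \<zeta>)" and ?N = "(real CARD('n))\<^sup>2"
  have "v \<noteq> 0" using v by auto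
  then have q: "?q > 0" using Q by (simp add: posdef_def)
  have inv: "?I ** mean_C \<zeta> = mat 1" using z(2) matrix_inv_left_right invertible_det_nz by blast
  \<comment> \<open>Applied to \<open>mean_C \<zeta> *v v\<close> this functional gives the form at
    \<open>v\<close>, and applied to the error term at \<open>(\<zeta>, v)\<close> it gives
    \<open>sesq Q v (err \<zeta> M \<omega> *v v)\<close>.\<close>
  define l where "l x = sesq Q v (?I *v x)" for x
  define \<kappa> where "\<kappa> = real CARD('n) * l1norm Q * l1norm ?I"
  have \<kappa>: "\<kappa> \<ge> 0" by (simp add: \<kappa>_def l1norm_nonneg)
  have l_le: "cmod (l x) \<le> \<kappa> * norm x" for x
  proof -
    have "cmod (l x) \<le> real CARD('n) * l1norm Q * norm v * norm (?I *v x)"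
      unfolding l_def by (rule norm_sesq_le)
    also have "\<dots> \<le> real CARD('n) * l1norm Q * norm v * (l1norm ?I * norm x)"
      by (intro mult_left_mono norm_mult_vec_le) (simp add: l1norm_nonneg)
    finally show ?thesis by (simp add: v \<kappa>_def mult.assoc)
  qed
  have l_diff: "l (x - y) = l x - l y" for x y
    by (simp add: l_def matrix_vector_mult_diff_distrib sesq_diff_right)
  have l_scale: "l (t *\<^sub>R x) = of_real t * l x" for t x
    by (simp add: l_def scaleR_conv_smult vector_scalar_commute sesq_scale_right)
  \<comment> \<open>\<open>L\<close> accounts for moving \<open>w\<close> and \<open>B\<close> for
    moving \<open>u\<close>. The summand \<open>1\<close> belongs to the empirical mean, and
    \<open>?N\<close> to the true mean, whose bounds are obtained entrywise.\<close>
  define W where "W = (1 + ?N) * (L + B)"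
  have W: "W \<ge> 0" using r(2) B(1) by (simp add: W_def)
  \<comment> \<open>Makes \<open>\<kappa> * W * \<delta>\<close> at most half of the budget
    \<open>\<eta> * ?q\<close>; the added \<open>1\<close> avoids division by zero when
    \<open>\<kappa> * W = 0\<close>.\<close>
  define \<delta> where "\<delta> = min r (\<eta> * ?q / (2 * (\<kappa> * W + 1)))"
  have \<kappa>W: "\<kappa> * W \<ge> 0" using \<kappa> W by simp
  have \<delta>: "\<delta> > 0" "\<delta> \<le> r" using r(1) q \<eta>(1) \<kappa>W by (auto simp: \<delta>_def intro!: divide_pos_pos)
  have small: "\<kappa> * W * \<delta> \<le> \<eta> * ?q / 2"
  proof -
    have "\<kappa> * W * \<delta> \<le> (\<kappa> * W + 1) * (\<eta> * ?q / (2 * (\<kappa> * W + 1)))"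
      using \<delta>(1) \<kappa>W by (intro mult_mono) (auto simp: \<delta>_def)
    also have "\<dots> = \<eta> * ?q / 2" using \<kappa>W by (simp add: divide_simps)
    finally show ?thesis .
  qed
  have pert: "cmod (l (T w *v u) - l (T \<zeta> *v v)) \<le> \<eta> * ?q / 2"
    if T: "l1norm (T w - T \<zeta>) \<le> (1 + ?N) * (L * \<delta>)" "l1norm (T \<zeta>) \<le> (1 + ?N) * B"
      and u: "norm u = 1" "u \<in> ball v \<delta>" for T :: "complex \<Rightarrow> complex^'n^'n" and w u
  proof -
    have "T w *v u - T \<zeta> *v v = (T w - T \<zeta>) *v u + T \<zeta> *v (u - v)"
      by (simp add: matrix_vector_mult_diff_distrib matrix_vector_mult_diff_rdistrib)
    then have "norm (T w *v u - T \<zeta> *v v) \<le> l1norm (T w - T \<zeta>) * norm u + l1norm (T \<zeta>) * norm (u - v)"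
      using order_trans[OF norm_triangle_ineq add_mono[OF norm_mult_vec_le norm_mult_vec_le]] by simp
    also have "\<dots> \<le> (1 + ?N) * (L * \<delta>) * 1 + (1 + ?N) * B * \<delta>"
      using T u B(1) \<delta>(1) r(2) by (intro add_mono mult_mono) (auto simp: dist_norm norm_minus_commute l1norm_nonneg)
    also have "\<dots> = W * \<delta>" by (simp add: W_def algebra_simps)
    finally have "\<kappa> * norm (T w *v u - T \<zeta> *v v) \<le> \<kappa> * (W * \<delta>)" using \<kappa> by (rule mult_left_mono)
    then show ?thesis using l_le[of "T w *v u - T \<zeta> *v v"] small by (simp add: l_diff mult.assoc)
  qed
  show ?thesis
  proof (rule that[OF \<delta>(1)])
    fix M \<omega> w u s
    assume M: "M \<ge> 1" and \<omega>: "\<omega> \<in> space \<mu>" and w: "w \<in> ball \<zeta> \<delta>" and u: "u \<in> ball v \<delta>" "norm u = 1"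
      and s: "s \<in> {0..1::real}" and sing: "(mean_C w + s *\<^sub>R (emp_C M \<omega> w - mean_C w)) *v u = 0"
    let ?A = "mean_C" and ?T = "\<lambda>w. emp_C M \<omega> w - mean_C w"
    have wr: "w \<in> ball \<zeta> r" "w \<in> E" using w \<delta>(2) r(3) by auto
    have Lw: "l1norm (C w \<omega>' - C \<zeta> \<omega>') \<le> L * \<delta>" if "\<omega>' \<in> space \<mu>" for \<omega>'
    proof -
      have "L * cmod (w - \<zeta>) \<le> L * \<delta>"
        using w r(2) by (intro mult_left_mono) (auto simp: dist_norm norm_minus_commute)
      then show ?thesis using lip[OF wr(1) _ that, of \<zeta>] r(1) by simp
    qed
    have Ad: "l1norm (?A w - ?A \<zeta>) \<le> ?N * (L * \<delta>)" by (rule Cmean_diff_bound[OF Lw wr(2) z(1)])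
    have Ab: "l1norm (?A \<zeta>) \<le> ?N * B" by (rule Cmean_bound[OF B(2)[OF z(1)] z(1)])
    have Hd: "l1norm (emp_C M \<omega> w - emp_C M \<omega> \<zeta>) \<le> L * \<delta>" by (rule Chat_diff_bound[OF Lw M \<omega>])
    have Hb: "l1norm (emp_C M \<omega> \<zeta>) \<le> B" by (rule Chat_bound[OF B(2)[OF z(1)] M \<omega>])
    have tri: "l1norm (X - Y) \<le> l1norm X + l1norm Y" for X Y :: "complex^'n^'n"
      using l1norm_triangle[of X "- Y"] by (simp add: l1norm_minus)
    have Td: "l1norm (?T w - ?T \<zeta>) \<le> (1 + ?N) * (L * \<delta>)"
    proof -
      have eq: "?T w - ?T \<zeta> = (emp_C M \<omega> w - emp_C M \<omega> \<zeta>) - (?A w - ?A \<zeta>)" by simp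
      show ?thesis
        unfolding eq distrib_right
        using tri[of "emp_C M \<omega> w - emp_C M \<omega> \<zeta>" "?A w - ?A \<zeta>"] Ad Hd by linarith
    qed
    have Tb: "l1norm (?T \<zeta>) \<le> (1 + ?N) * B"
      using tri[of "emp_C M \<omega> \<zeta>" "?A \<zeta>"] Ab Hb by (simp add: distrib_right)
    have Ld: "L * \<delta> \<ge> 0" using r(2) \<delta>(1) by simp
    have pA: "cmod (l (?A w *v u) - l (?A \<zeta> *v v)) \<le> \<eta> * ?q / 2"
      using Ad Ab Ld B(1) by (intro pert u) (auto simp: distrib_right)
    have pT: "cmod (l (?T w *v u) - l (?T \<zeta> *v v)) \<le> \<eta> * ?q / 2" by (rule pert[OF Td Tb u(2,1)])
    have lA: "Re (l (?A \<zeta> *v v)) = ?q"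
      by (simp add: l_def matrix_vector_mul_assoc inv hform_eq_sesq)
    define t where "t = - Re (l (?T w *v u))"
    have "?A w *v u = (- s) *\<^sub>R (?T w *v u)"
      using sing by (simp add: matrix_vector_mult_add_rdistrib scaleR_matrix_vector eq_neg_iff_add_eq_0)
    then have "Re (l (?A w *v u)) = s * t" by (simp add: l_scale t_def del: scaleR_minus_left)
    moreover have "\<bar>Re (l (?A w *v u)) - ?q\<bar> \<le> \<eta> * ?q / 2"
      using order_trans[OF abs_Re_le_cmod pA] lA by simp
    ultimately have st: "s * t \<ge> ?q - \<eta> * ?q / 2" by linarith
    have "\<eta> * ?q < 1 * ?q" using \<eta>(2) q by (intro mult_strict_right_mono)
    then have stp: "s * t > 0" using st q by linarith
    \<comment> \<open>Positivity of \<open>s * t\<close> rules out \<open>s = 0\<close>, and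
      \<open>s \<le> 1\<close> then gives \<open>t \<ge> s * t\<close>. So the homotopy parameter
      disappears and needs no covering.\<close>
    then have "t > 0" using s by (auto simp: zero_less_mult_iff)
    then have "s * t \<le> t" using s by (simp add: mult_left_le_one_le)
    then have t: "t \<ge> ?q - \<eta> * ?q / 2" using st by simp
    have "\<bar>Re (l (?T w *v u)) - Re (l (?T \<zeta> *v v))\<bar> \<le> \<eta> * ?q / 2"
      using order_trans[OF abs_Re_le_cmod pT] by simp
    then have "- Re (l (?T \<zeta> *v v)) \<ge> ?q - \<eta> * ?q" using t unfolding t_def by linarith
    moreover have "l (?T \<zeta> *v v) = sesq Q v (err \<zeta> M \<omega> *v v)"
      by (simp add: l_def rel_err_def Ctilde_def matrix_vector_mul_assoc)
    moreover have "- Re (sesq Q v (err \<zeta> M \<omega> *v v)) = ?q / real M * (\<Sum>m=1..M. dev_form \<zeta> Q v ((\<theta> ^^ m) \<omega>))"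
      using q by (simp add: rel_err_eq[OF z(2) M] scaleR_matrix_vector sesq_scaleR_right sum_matrix_vector
          sesq_sum_right dev_form_def sum_negf flip: sum_divide_distrib)
    ultimately have "?q * (1 - \<eta>) \<le> ?q * ((\<Sum>m=1..M. dev_form \<zeta> Q v ((\<theta> ^^ m) \<omega>)) / real M)"
      by (simp add: algebra_simps)
    then have "1 - \<eta> \<le> (\<Sum>m=1..M. dev_form \<zeta> Q v ((\<theta> ^^ m) \<omega>)) / real M"
      using q by (simp only: mult_le_cancel_left_pos)
    then show "real M * (1 - \<eta>) \<le> (\<Sum>m=1..M. dev_form \<zeta> Q v ((\<theta> ^^ m) \<omega>))"
      using M by (simp add: pos_le_divide_eq mult.commute)
  qed
qed


lemma R_bd_nonneg:
  assumes "S \<noteq> {}"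
  shows "0 \<le> R_bd \<mu> \<theta> C P S"
proof -
  have R: "0 \<le> R_at w Q" if Q: "posdef Q" for w Q
  proof -
    \<comment> \<open>The claim does not involve \<open>\<omega>\<close>; it may be proved almost
      everywhere because a probability space is not null.\<close>
    have "AE \<omega> in \<mu>. 0 \<le> R_at w Q"
      using esssup_AE[of "\<lambda>\<omega>. ereal (qopnorm Q (dev w \<omega>))" \<mu>]
    proof eventually_elim
      case (elim \<omega>)
      have "0 \<le> ereal (qopnorm Q (dev w \<omega>))" using qopnorm_nonneg[OF Q] by simp
      also have "\<dots> \<le> R_at w Q" using elim by (simp add: R_at_def)
      finally show ?case .
    qed
    then show ?thesis by simp
  qed
  obtain w where w: "w \<in> S" using assms by blast
  have "0 \<le> (INF Q\<in>{Q. posdef Q \<and> PQ w Q \<ge> ereal P}. R_at w Q)"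
    using R by (intro INF_greatest) auto
  also have "\<dots> \<le> R_bd \<mu> \<theta> C P S" unfolding R_bd_eq using w by (rule SUP_upper)
  finally show ?thesis .
qed

text \<open>Outside the degenerate cases \<open>K\<close> is the number of neighbourhoods in a
  finite cover, and \<open>G\<close> is the union of their tail events. The cover is chosen before
  \<open>M\<close>, which makes \<open>K\<close> a constant.\<close>

lemma singular_homotopy_bound:
  fixes P :: real
  assumes S: "compact S" "S \<subseteq> E" and P: "0 \<le> P" and Psym: "\<And>\<zeta>. \<zeta> \<in> S \<Longrightarrow> Psym \<mu> \<theta> E C \<zeta> > ereal P"
  defines "b \<equiv> 1 / (1 + P * real_of_ereal (R_bd \<mu> \<theta> C P S) / 3) * (P / 2)"
  obtains K where "K \<ge> 0" "\<And>M. M \<ge> 1 \<Longrightarrow> \<exists>G\<in>events.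
    {\<omega> \<in> space \<mu>. \<exists>w\<in>S. \<exists>s\<in>{0..1}. det (mean_C w + s *\<^sub>R (emp_C M \<omega> w - mean_C w)) = 0} \<subseteq> G \<and>
    prob G \<le> K * exp (- (b * real M))"
proof (cases "P = 0 \<or> S = {}")
  \<comment> \<open>For \<open>P = 0\<close> the rate \<open>b\<close> is zero and
    \<open>1 / P\<close> would be no variance bound. For empty \<open>S\<close> there is no singular
    pair, while \<open>R_bd\<close> is a supremum over the empty set and thus not a nonnegative
    number.\<close>
  case True
  show ?thesis
  proof (rule that[of 1])
    fix M :: nat
    show "\<exists>G\<in>events.
      {\<omega> \<in> space \<mu>. \<exists>w\<in>S. \<exists>s\<in>{0..1}. det (mean_C w + s *\<^sub>R (emp_C M \<omega> w - mean_C w)) = 0} \<subseteq> G \<and>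
      prob G \<le> 1 * exp (- (b * real M))"
    proof (cases "S = {}")
      case True
      then show ?thesis by (intro bexI[of _ "{}"]) auto
    next
      case False
      then have "b = 0" using \<open>P = 0 \<or> S = {}\<close> by (simp add: b_def)
      then show ?thesis by (intro bexI[of _ "space \<mu>"]) (auto simp: prob_space)
    qed
  qed simp
next
  case False
  then have P0: "P > 0" and ne: "S \<noteq> {}" using P by auto
  define R0 where "R0 = real_of_ereal (R_bd \<mu> \<theta> C P S)"
  have "R_bd \<mu> \<theta> C P S < \<infinity>" by (rule R_bd_finite[OF S P Psym])
  then have R0: "R_bd \<mu> \<theta> C P S = ereal R0" "R0 \<ge> 0"
    using R_bd_nonneg[OF ne, of P] by (auto simp: R0_def ereal_real' real_of_ereal_pos)
  obtain R \<eta> where R: "R > R0" and \<eta>: "0 < \<eta>" "\<eta> < 1" and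
    tail: "uniform_tail_bound R (1 / P) (1 - \<eta>) (1 / (1 + P * R0 / 3) * (P / 2))"
    by (rule bernstein_tail[OF P0 R0(2)])
  have b: "1 / (1 + P * R0 / 3) * (P / 2) = b" by (simp add: b_def R0_def)
  define ev where "ev x Q M = {\<omega> \<in> space \<mu>. real M * (1 - \<eta>) \<le> (\<Sum>m=1..M. dev_form (fst x) Q (snd x) ((\<theta> ^^ m) \<omega>))}"
    for x :: "complex \<times> (complex^'n)" and Q :: "complex^'n^'n" and M :: nat
  let ?sing = "\<lambda>M \<omega> w s. mean_C w + s *\<^sub>R (emp_C M \<omega> w - mean_C w)"
  \<comment> \<open>What a form and a radius must achieve at the pair \<open>x\<close>, for all
    \<open>M\<close> simultaneously, so that the finite subcover is extracted once.\<close>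
  define cov where "cov x Q \<delta> \<longleftrightarrow> \<delta> > 0 \<and>
      (\<forall>M\<ge>1. ev x Q M \<in> events \<and> prob (ev x Q M) \<le> exp (- (b * real M))) \<and>
      (\<forall>M \<omega> w u s. M \<ge> 1 \<longrightarrow> \<omega> \<in> space \<mu> \<longrightarrow> (w, u) \<in> ball (fst x) \<delta> \<times> ball (snd x) \<delta> \<longrightarrow> norm u = 1 \<longrightarrow>
        s \<in> {0..1} \<longrightarrow> ?sing M \<omega> w s *v u = 0 \<longrightarrow> \<omega> \<in> ev x Q M)" for x Q \<delta>
  have "\<exists>Q \<delta>. cov x Q \<delta>"
    if x: "x \<in> S \<times> sphere 0 1" for x
  proof -
    obtain \<zeta> v where x': "x = (\<zeta>, v)" "\<zeta> \<in> S" "norm v = 1" "\<zeta> \<in> E" using x S(2) by (cases x) auto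
    have "v \<noteq> 0" using x'(3) by auto
    have nz: "det (mean_C \<zeta>) \<noteq> 0" by (rule det_nonzero_if_Psym_pos[OF x'(4) P Psym[OF x'(2)]])
    \<comment> \<open>The infimum may fail to be attained; \<open>R0 < R\<close> leaves the gap that
      yields an actual form.\<close>
    have "(INF Q\<in>{Q. posdef Q \<and> PQ \<zeta> Q \<ge> ereal P}. R_at \<zeta> Q) \<le> ereal R0"
      unfolding R0(1)[symmetric] R_bd_eq using x'(2) by (rule SUP_upper)
    also have "\<dots> < ereal R" using R by simp
    finally obtain Q where Q: "posdef Q" "ereal P \<le> PQ \<zeta> Q" "R_at \<zeta> Q < ereal R"
      by (auto simp: INF_less_iff)
    have "AE \<omega> in \<mu>. qopnorm Q (dev \<zeta> \<omega>) \<le> R"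
      using esssup_AE[of "\<lambda>\<omega>. ereal (qopnorm Q (dev \<zeta> \<omega>))" \<mu>]
    proof eventually_elim
      case (elim \<omega>)
      then have "ereal (qopnorm Q (dev \<zeta> \<omega>)) < ereal R" using Q(3) unfolding R_at_def by (rule le_less_trans)
      then show ?case by simp
    qed
    note tl = dev_form_tail[OF x'(4) nz Q(1,2) P0 this \<open>v \<noteq> 0\<close> tail[unfolded b]]
    obtain \<delta> where \<delta>: "\<delta> > 0"
      "\<And>M \<omega> w u s. M \<ge> 1 \<Longrightarrow> \<omega> \<in> space \<mu> \<Longrightarrow> w \<in> ball \<zeta> \<delta> \<Longrightarrow> u \<in> ball v \<delta> \<Longrightarrow> norm u = 1 \<Longrightarrow> s \<in> {0..1} \<Longrightarrow>
        ?sing M \<omega> w s *v u = 0 \<Longrightarrow> real M * (1 - \<eta>) \<le> (\<Sum>m=1..M. dev_form \<zeta> Q v ((\<theta> ^^ m) \<omega>))"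
      by (rule failure_implies_dev_form_large[OF x'(4) nz Q(1) x'(3) \<eta>]) blast
    have "cov x Q \<delta>"
      unfolding cov_def
    proof (intro conjI allI impI)
      show "\<delta> > 0" by (rule \<delta>(1))
      show "ev x Q M \<in> events" "prob (ev x Q M) \<le> exp (- (b * real M))" if "M \<ge> 1" for M
        using tl[OF that] by (simp_all add: ev_def x'(1))
      fix M \<omega> w u and s :: real
      assume "M \<ge> 1" "\<omega> \<in> space \<mu>" "(w, u) \<in> ball (fst x) \<delta> \<times> ball (snd x) \<delta>" "norm u = 1" "s \<in> {0..1}"
        "?sing M \<omega> w s *v u = 0"
      then show "\<omega> \<in> ev x Q M" using \<delta>(2)[of M \<omega> w u s] by (simp add: ev_def x'(1))
    qed
    then show ?thesis by blast
  qed
  then obtain Q \<delta> where "\<And>x. x \<in> S \<times> sphere 0 1 \<Longrightarrow> cov x (Q x) (\<delta> x)" by metis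
  note cov = this[unfolded cov_def]
  have "compact (S \<times> sphere (0 :: complex^'n) 1)" using S(1) by (intro compact_Times compact_sphere)
  moreover have "S \<times> sphere 0 1 \<subseteq> (\<Union>x\<in>S \<times> sphere 0 1. ball (fst x) (\<delta> x) \<times> ball (snd x) (\<delta> x))"
    using cov[THEN conjunct1] by force
  ultimately obtain T where T: "T \<subseteq> S \<times> sphere 0 1" "finite T"
    "S \<times> sphere 0 1 \<subseteq> (\<Union>x\<in>T. ball (fst x) (\<delta> x) \<times> ball (snd x) (\<delta> x))"
    using compactE_image[of "S \<times> sphere (0 :: complex^'n) 1" "S \<times> sphere 0 1" "\<lambda>x. ball (fst x) (\<delta> x) \<times> ball (snd x) (\<delta> x)"]
    by (auto simp: open_Times)
  show ?thesis
  proof (rule that[of "real (card T)"])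
    fix M :: nat assume M: "M \<ge> 1"
    let ?G = "\<Union>x\<in>T. ev x (Q x) M"
    have evT: "ev x (Q x) M \<in> events" "prob (ev x (Q x) M) \<le> exp (- (b * real M))" if "x \<in> T" for x
      using cov[OF subsetD[OF T(1) that], THEN conjunct2, THEN conjunct1, rule_format, OF M] by simp_all
    have "prob ?G \<le> (\<Sum>x\<in>T. prob (ev x (Q x) M))"
      using evT(1) T(2) by (intro finite_measure_subadditive_finite) auto
    also have "\<dots> \<le> real (card T) * exp (- (b * real M))"
      by (rule sum_bounded_above[OF evT(2)])
    finally have "prob ?G \<le> real (card T) * exp (- (b * real M))" .
    moreover have "?G \<in> events" using evT(1) T(2) by (intro sets.finite_UN) auto
    moreover have "{\<omega> \<in> space \<mu>. \<exists>w\<in>S. \<exists>s\<in>{0..1}. det (?sing M \<omega> w s) = 0} \<subseteq> ?G"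
    proof (rule subsetI)
      fix \<omega> assume "\<omega> \<in> {\<omega> \<in> space \<mu>. \<exists>w\<in>S. \<exists>s\<in>{0..1}. det (?sing M \<omega> w s) = 0}"
      then obtain w s where ws: "\<omega> \<in> space \<mu>" "w \<in> S" "s \<in> {0..1}" "det (?sing M \<omega> w s) = 0" by blast
      obtain u0 where u0: "u0 \<noteq> 0" "?sing M \<omega> w s *v u0 = 0" using ws(4) det_eq_0_iff_kernel by blast
      define u where "u = (1 / norm u0) *\<^sub>R u0"
      have nu: "norm u = 1" using u0(1) by (simp add: u_def)
      have "?sing M \<omega> w s *v u = 0"
        unfolding u_def scaleR_conv_smult vector_scalar_commute u0(2) by simp
      note sing = this
      have "(w, u) \<in> S \<times> sphere 0 1" using ws(2) nu by simp
      then obtain x where x: "x \<in> T" "(w, u) \<in> ball (fst x) (\<delta> x) \<times> ball (snd x) (\<delta> x)"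
        using T(3) by blast
      then show "\<omega> \<in> ?G"
        using cov[OF subsetD[OF T(1) x(1)], THEN conjunct2, THEN conjunct2, rule_format, OF M ws(1) x(2) nu ws(3) sing]
        by blast
    qed
    ultimately show "\<exists>G\<in>events. {\<omega> \<in> space \<mu>. \<exists>w\<in>S. \<exists>s\<in>{0..1}. det (?sing M \<omega> w s) = 0} \<subseteq> G \<and>
        prob G \<le> real (card T) * exp (- (b * real M))" by blast
  qed simp
qed

text \<open>The coefficient matrices supplied by \<open>affine_family\<close> come with no
  measurability, so they are not integrated. Each sample is instead written as the interpolation
  between its values at two points \<open>\<zeta>\<close> and \<open>\<xi>\<close> of
  \<open>E\<close>, and these values are integrable.\<close>

lemma Cmean_affine:
  assumes "affine_family \<mu> E C" "\<zeta> \<in> E"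
  obtains K L where "\<And>z. z \<in> E \<Longrightarrow> mean_C z = (\<chi> i j. K $ i $ j - z * L $ i $ j)"
proof -
  obtain k l where kl: "\<And>\<omega> z. \<omega> \<in> space \<mu> \<Longrightarrow> z \<in> E \<Longrightarrow> C z \<omega> = (\<chi> i j. k \<omega> $ i $ j - z * l \<omega> $ i $ j)"
    using assms(1) unfolding affine_family_def by blast
  obtain e where e: "e > 0" "cball \<zeta> e \<subseteq> E" using open_E assms(2) open_contains_cball by blast
  define \<xi> where "\<xi> = \<zeta> + of_real e"
  have "\<xi> \<in> cball \<zeta> e" using e(1) by (simp add: \<xi>_def dist_norm)
  then have \<xi>: "\<xi> \<in> E" "\<xi> - \<zeta> \<noteq> 0" using e by (auto simp: \<xi>_def)
  define L where "L = (\<chi> i j. (mean_C \<zeta> $ i $ j - mean_C \<xi> $ i $ j) / (\<xi> - \<zeta>))"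
  define K where "K = (\<chi> i j. mean_C \<zeta> $ i $ j + \<zeta> * L $ i $ j)"
  have "mean_C z = (\<chi> i j. K $ i $ j - z * L $ i $ j)" if z: "z \<in> E" for z
  proof -
    have "mean_C z $ i $ j = K $ i $ j - z * L $ i $ j" for i j
    proof -
      let ?t = "(z - \<zeta>) / (\<xi> - \<zeta>)"
      have "mean_C z $ i $ j = (\<integral>\<omega>. C \<zeta> \<omega> $ i $ j + ?t * (C \<xi> \<omega> $ i $ j - C \<zeta> \<omega> $ i $ j) \<partial>\<mu>)"
        unfolding Cmean_entry[OF z]
      proof (rule Bochner_Integration.integral_cong[OF refl])
        fix \<omega> assume \<omega>: "\<omega> \<in> space \<mu>"
        have "C \<xi> \<omega> $ i $ j - C \<zeta> \<omega> $ i $ j = - ((\<xi> - \<zeta>) * l \<omega> $ i $ j)"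
          by (simp add: kl[OF \<omega> \<xi>(1)] kl[OF \<omega> assms(2)] algebra_simps)
        then have "?t * (C \<xi> \<omega> $ i $ j - C \<zeta> \<omega> $ i $ j) = - ((z - \<zeta>) * l \<omega> $ i $ j)"
          using \<xi>(2) by simp
        then show "C z \<omega> $ i $ j = C \<zeta> \<omega> $ i $ j + ?t * (C \<xi> \<omega> $ i $ j - C \<zeta> \<omega> $ i $ j)"
          by (simp add: kl[OF \<omega> z] kl[OF \<omega> assms(2)] algebra_simps)
      qed
      also have "\<dots> = mean_C \<zeta> $ i $ j + ?t * (mean_C \<xi> $ i $ j - mean_C \<zeta> $ i $ j)"
        using C_entry_integrable[OF assms(2)] C_entry_integrable[OF \<xi>(1)]
        by (simp add: Cmean_entry[OF assms(2)] Cmean_entry[OF \<xi>(1)])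
      also have "\<dots> = K $ i $ j - z * L $ i $ j"
        using \<xi>(2) by (simp add: K_def L_def divide_simps) (simp add: algebra_simps)
      finally show ?thesis .
    qed
    then show ?thesis by (simp add: vec_eq_iff)
  qed
  then show ?thesis using that by blast
qed

lemma Chat_affine:
  assumes "affine_family \<mu> E C" "\<omega> \<in> space \<mu>"
  obtains K L where "\<And>z. z \<in> E \<Longrightarrow> emp_C M \<omega> z = (\<chi> i j. K $ i $ j - z * L $ i $ j)"
proof -
  obtain k l where kl: "\<And>\<omega> z. \<omega> \<in> space \<mu> \<Longrightarrow> z \<in> E \<Longrightarrow> C z \<omega> = (\<chi> i j. k \<omega> $ i $ j - z * l \<omega> $ i $ j)"
    using assms(1) unfolding affine_family_def by blast
  define K where "K = (\<chi> i j. of_real (1 / real M) * (\<Sum>m=1..M. k ((\<theta> ^^ m) \<omega>) $ i $ j))"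
  define L where "L = (\<chi> i j. of_real (1 / real M) * (\<Sum>m=1..M. l ((\<theta> ^^ m) \<omega>) $ i $ j))"
  have "emp_C M \<omega> z = (\<chi> i j. K $ i $ j - z * L $ i $ j)" if z: "z \<in> E" for z
  proof -
    have "emp_C M \<omega> z $ i $ j = of_real (1 / real M) * (\<Sum>m=1..M. C z ((\<theta> ^^ m) \<omega>) $ i $ j)" for i j
      unfolding Chat_def scaleR_entry by (simp only: sum_component)
    also have "\<dots> i j = K $ i $ j - z * L $ i $ j" for i j
      by (simp add: kl[OF theta_pow_space[OF assms(2)] z] K_def L_def sum_subtractf right_diff_distrib
          mult.left_commute[of z] flip: sum_distrib_left)
    finally show ?thesis by (simp add: vec_eq_iff)
  qed
  then show ?thesis using that by blast
qed

end

lemma outer_measure_of_le: "A \<subseteq> B \<Longrightarrow> B \<in> sets M \<Longrightarrow> outer_measure_of M A \<le> emeasure M B"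
  unfolding outer_measure_of_def by (rule INF_lower) simp

theorem theorem3p2:
  fixes \<mu> :: "'a measure" and \<theta> :: "'a \<Rightarrow> 'a"
    and E F :: "complex set"
    and C :: "complex \<Rightarrow> 'a \<Rightarrow> complex^'n^'n"
    and P :: real
  assumes prob: "prob_space \<mu>"
    and ergodic: "ergodic_map \<mu> \<theta>"
    and E_open: "open E"
    and C_measurable: "\<And>\<zeta>. \<zeta> \<in> E \<Longrightarrow> (\<lambda>\<omega>. C \<zeta> \<omega>) \<in> borel_measurable \<mu>"
    and C_bounded: "\<exists>B. \<forall>\<zeta>\<in>E. \<forall>\<omega>\<in>space \<mu>. norm (C \<zeta> \<omega>) \<le> B"
    and C_analytic: "\<And>\<omega> i j. \<omega> \<in> space \<mu> \<Longrightarrow> (\<lambda>\<zeta>. C \<zeta> \<omega> $ i $ j) analytic_on E"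
    and clt: "clt_assumption \<mu> \<theta> E C"
    and indep: "independent_samples \<mu> \<theta> E C"
    and F: "F \<subseteq> E" "closed F" "bounded F"
    and F_boundary: "\<exists>g. rectifiable_path g \<and> path_image g = frontier F"
    and P_nonneg: "0 \<le> P"
    and Psym_gt: "\<And>\<zeta>. \<zeta> \<in> frontier F \<Longrightarrow> Psym \<mu> \<theta> E C \<zeta> > ereal P"
  shows "R_bd \<mu> \<theta> C P (frontier F) < \<infinity> \<and>
    (\<exists>K::real. \<forall>M\<ge>1.
       outer_measure_of \<mu> {\<omega> \<in> space \<mu>.
           count_in (spec E (Cmean \<mu> C)) (alg_mult (Cmean \<mu> C)) F
         \<noteq> count_in (spec E (Chat \<theta> C M \<omega>)) (alg_mult (Chat \<theta> C M \<omega>)) F}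
       \<le> ennreal (K * real M *
           exp (- (1 / (1 + P * real_of_ereal (R_bd \<mu> \<theta> C P (frontier F)) / 3) * (P / 2) * real M)))) \<and>
    (affine_family \<mu> E C \<longrightarrow>
     (\<exists>K::real. \<forall>M\<ge>1.
       outer_measure_of \<mu> {\<omega> \<in> space \<mu>.
           count_in (spec E (Cmean \<mu> C)) (riesz_rank (Cmean \<mu> C)) F
         \<noteq> count_in (spec E (Chat \<theta> C M \<omega>)) (riesz_rank (Chat \<theta> C M \<omega>)) F}
       \<le> ennreal (K * real M *
           exp (- (1 / (1 + P * real_of_ereal (R_bd \<mu> \<theta> C P (frontier F)) / 3) * (P / 2) * real M)))))"
proof -
  interpret iid_sampling \<mu> \<theta> E C
    using assms by (intro iid_sampling.intro iid_sampling_axioms.intro) (auto simp: ergodic_map_def)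
  have Fc: "compact F" using F(2,3) by (simp add: compact_eq_bounded_closed)
  have S: "compact (frontier F)" "frontier F \<subseteq> E"
    using Fc F(1) frontier_subset_closed[OF F(2)] by (auto intro: compact_frontier)
  let ?b = "1 / (1 + P * real_of_ereal (R_bd \<mu> \<theta> C P (frontier F)) / 3) * (P / 2)"
  let ?bad = "\<lambda>M. {\<omega> \<in> space \<mu>. \<exists>w\<in>frontier F. \<exists>s\<in>{0..1}.
    det (Cmean \<mu> C w + s *\<^sub>R (Chat \<theta> C M \<omega> w - Cmean \<mu> C w)) = 0}"
  obtain K where K: "K \<ge> 0" "\<And>M. M \<ge> 1 \<Longrightarrow> \<exists>G\<in>events. ?bad M \<subseteq> G \<and> prob G \<le> K * exp (- (?b * real M))"
    by (rule singular_homotopy_bound[OF S P_nonneg Psym_gt], assumption) (rule that)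
  have bound: "outer_measure_of \<mu> A \<le> ennreal (K * real M * exp (- (?b * real M)))"
    if M: "M \<ge> 1" and A: "A \<subseteq> ?bad M" for M A
  proof -
    obtain G where G: "G \<in> events" "?bad M \<subseteq> G" "prob G \<le> K * exp (- (?b * real M))" using K(2)[OF M] by blast
    have "outer_measure_of \<mu> A \<le> emeasure \<mu> G" using A G by (intro outer_measure_of_le) auto
    also have "\<dots> = ennreal (prob G)" by (rule emeasure_eq_measure)
    also have "\<dots> \<le> ennreal (K * real M * exp (- (?b * real M)))"
    proof (rule ennreal_leI)
      \<comment> \<open>\<open>1 \<le> real M\<close> inserts the linear factor of the
        claim.\<close>
      have "K * 1 * exp (- (?b * real M)) \<le> K * real M * exp (- (?b * real M))"
        using K(1) M by (intro mult_right_mono mult_left_mono) auto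
      then show "prob G \<le> K * real M * exp (- (?b * real M))" using G(3) by linarith
    qed
    finally show ?thesis .
  qed
  \<comment> \<open>Outside the bad event the endpoints \<open>s = 0\<close> and
    \<open>s = 1\<close> keep both determinants nonzero on the frontier, so both counts are finite,
    and the whole segment connects them.\<close>
  have counts: "count_in (spec E (Cmean \<mu> C)) m0 F = count_in (spec E (Chat \<theta> C M \<omega>)) m1 F"
    if \<omega>: "\<omega> \<in> space \<mu>" "\<omega> \<notin> ?bad M"
      and m0: "\<And>\<zeta>. \<zeta> \<in> F \<Longrightarrow> \<forall>\<^sub>F w in at \<zeta>. det (Cmean \<mu> C w) \<noteq> 0 \<Longrightarrow> int (m0 \<zeta>) = zorder (\<lambda>z. det (Cmean \<mu> C z)) \<zeta>"
      and m1: "\<And>\<zeta>. \<zeta> \<in> F \<Longrightarrow> \<forall>\<^sub>F w in at \<zeta>. det (Chat \<theta> C M \<omega> w) \<noteq> 0 \<Longrightarrow> int (m1 \<zeta>) = zorder (\<lambda>z. det (Chat \<theta> C M \<omega> z)) \<zeta>"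
    for \<omega> M m0 m1
  proof -
    have nz: "det (Cmean \<mu> C z + s *\<^sub>R (Chat \<theta> C M \<omega> z - Cmean \<mu> C z)) \<noteq> 0"
      if "s \<in> {0..1}" "z \<in> frontier F" for s z using \<omega> that by blast
    have nz0: "det (Cmean \<mu> C z) \<noteq> 0" if "z \<in> frontier F" for z using nz[OF _ that, of 0] by simp
    have nz1: "det (Chat \<theta> C M \<omega> z) \<noteq> 0" if "z \<in> frontier F" for z using nz[OF _ that, of 1] by simp
    note h1 = Chat_holomorphic[OF \<omega>(1), of M]
    show ?thesis
      using count_in_eq_zero_count[OF F(1) Fc Cmean_holomorphic nz0 m0]
        count_in_eq_zero_count[OF F(1) Fc h1 nz1 m1]
        zero_count_det_eq[OF F(1) Fc Cmean_holomorphic h1 nz] by simp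
  qed
  have "count_in (spec E (Cmean \<mu> C)) (alg_mult (Cmean \<mu> C)) F
      = count_in (spec E (Chat \<theta> C M \<omega>)) (alg_mult (Chat \<theta> C M \<omega>)) F"
    if "\<omega> \<in> space \<mu>" "\<omega> \<notin> ?bad M" for \<omega> M
    using F(1) by (intro counts[OF that] alg_mult_eq_zorder(1)[OF _ open_E] Cmean_holomorphic Chat_holomorphic that(1)) auto
  then have 1: "{\<omega> \<in> space \<mu>. count_in (spec E (Cmean \<mu> C)) (alg_mult (Cmean \<mu> C)) F
      \<noteq> count_in (spec E (Chat \<theta> C M \<omega>)) (alg_mult (Chat \<theta> C M \<omega>)) F} \<subseteq> ?bad M" for M by blast
  have 2: "{\<omega> \<in> space \<mu>. count_in (spec E (Cmean \<mu> C)) (riesz_rank (Cmean \<mu> C)) F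
      \<noteq> count_in (spec E (Chat \<theta> C M \<omega>)) (riesz_rank (Chat \<theta> C M \<omega>)) F} \<subseteq> ?bad M"
    if aff: "affine_family \<mu> E C" for M
  proof -
    have "count_in (spec E (Cmean \<mu> C)) (riesz_rank (Cmean \<mu> C)) F
        = count_in (spec E (Chat \<theta> C M \<omega>)) (riesz_rank (Chat \<theta> C M \<omega>)) F"
      if "\<omega> \<in> space \<mu>" "\<omega> \<notin> ?bad M" for \<omega>
    proof (rule counts[OF that])
      fix \<zeta> assume \<zeta>: "\<zeta> \<in> F"
      then have "\<zeta> \<in> E" using F(1) by blast
      obtain k l where "\<And>z. z \<in> E \<Longrightarrow> Cmean \<mu> C z = (\<chi> i j. k $ i $ j - z * l $ i $ j)"
        by (rule Cmean_affine[OF aff \<open>\<zeta> \<in> E\<close>]) blast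
      then show "int (riesz_rank (Cmean \<mu> C) \<zeta>) = zorder (\<lambda>z. det (Cmean \<mu> C z)) \<zeta>"
        if "\<forall>\<^sub>F w in at \<zeta>. det (Cmean \<mu> C w) \<noteq> 0"
        by (rule riesz_rank_eq_zorder[OF open_E \<open>\<zeta> \<in> E\<close> that])
      obtain k' l' where "\<And>z. z \<in> E \<Longrightarrow> Chat \<theta> C M \<omega> z = (\<chi> i j. k' $ i $ j - z * l' $ i $ j)"
        by (rule Chat_affine[OF aff \<open>\<omega> \<in> space \<mu>\<close>]) blast
      then show "int (riesz_rank (Chat \<theta> C M \<omega>) \<zeta>) = zorder (\<lambda>z. det (Chat \<theta> C M \<omega> z)) \<zeta>"
        if "\<forall>\<^sub>F w in at \<zeta>. det (Chat \<theta> C M \<omega> w) \<noteq> 0"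
        by (rule riesz_rank_eq_zorder[OF open_E \<open>\<zeta> \<in> E\<close> that])
    qed
    then show ?thesis by blast
  qed
  show ?thesis
    using R_bd_finite[OF S P_nonneg Psym_gt] bound[OF _ 1] bound[OF _ 2] by blast
qed

end
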